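(* Let $d\ge 2$. The maximum of the average fidelity $F[\boldsymbol R]$ over all $1\to2$ cloning instruments for von Neumann measurements on a $d$-dimensional Hilbert space is $$F=\frac{4}{3d}.$$ More precisely, without loss of generality the optimization can be restricted to symmetric instruments described (see context) by a set $\mathsf s=\{s^\nu_\ell\}$ which has at most two non-zero elements, all of rank one, and satisfies the normalization constraints. Among these sets there are two choices achieving the highest value $F=\frac{4}{3d}$. They are $$\mathsf s=\{s^\alpha_{xx,x},\,s^\alpha_{xy,x}\}\quad\text{with } s^\alpha_{xx,x}=A,\ s^\alpha_{xy,x}=B,$$ $$\mathsf s=\{s^\alpha_{xx,x},\,s^\alpha_{xy,y}\}\quad\text{with } s^\alpha_{xx,x}=A,\ s^\alpha_{xy,y}=\sigma_zB\sigma_z$$ (all elements not listed being zero), where, with rows and columns ordered as $+,-$, $$A=\begin{pmatrix}\frac{9d_+-1}{9d}&0\\0&0\end{pmatrix},\qquad B=\begin{pmatrix}\frac1{9d}&\frac{\sqrt{d_-}}{3d}\\ \frac{\sqrt{d_-}}{3d}&\frac{d_-}{d}\end{pmatrix},\qquad \sigma_z=\begin{pmatrix}1&0\\0&-1\end{pmatrix},$$ and $d_\pm=\frac{d(d\pm1)}2$. Consequently any convex combination of these two strategies is also optimal; in particular so is the equal-weight one, $s^\alpha_{xx,x}=A$, $s^\alpha_{xy,x}=\frac12B$, $s^\alpha_{xy,y}=\frac12\sigma_zB\sigma_z$.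
   Context: Setting. Let $\mathcal H=\mathbb C^d$ with a fixed orthonormal basis $\{|i\rangle\}_{i=1}^d$; $^T$ denotes transposition in this basis. For $U\in SU(d)$ let $E_i^{(U)}=U|i\rangle\langle i|U^\dagger$ (a von Neumann measurement). Let $\mathcal H_A,\mathcal H_B,\mathcal H_C,\mathcal H_D$ be copies of $\mathcal H$. A $1\to2$ cloning instrument is a family $\boldsymbol R=\{R_{ij}\}_{i,j=1}^d$ of positive semidefinite operators on $\mathcal H_A\otimes\mathcal H_B\otimes\mathcal H_C\otimes\mathcal H_D$ such that $\sum_{i,j}R_{ij}=I_D\otimes S_{ABC}$ and $\mathrm{Tr}_C[S_{ABC}]=I_{AB}$ for some $S_{ABC}\ge0$. (These are Choi operators of networks which receive a bipartite input on $A,B$, use the unknown measurement once on $C$, and process its classical outcome, encoded in $D$, to produce a pair of outcomes $(i,j)$.) The replicated POVM on $\mathcal H_A\otimes\mathcal H_B$ is $$G_{ij}^{(U)}=\Big[\sum_{k=1}^d\langle k|_C\langle k|_D(U_C^\dagger\otimes I)R_{ij}(U_C\otimes I)|k\rangle_C|k\rangle_D\Big]^T,$$ and the average fidelity is $$F[\boldsymbol R]=\frac1{d^2}\sum_{i,j=1}^d\int dU\,\mathrm{Tr}\big[G_{ij}^{(U)}(E_i^{(U)}\otimes E_j^{(U)})\big],$$ with $dU$ the normalized Haar measure on $SU(d)$. Symmetric instruments. Without loss of generality $R_{ij}=\sum_kR'_{ij,k}\otimes|k\rangle\langle k|_D$ with $R'_{ij,k}\ge0$ on $\mathcal H_A\otimes\mathcal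 H_B\otimes\mathcal H_C$ commuting with $U^*\otimes U^*\otimes U$ for all $U$, and with $R'_{ij,k}$ depending only on the class $\ell$ of $(ij,k)$ under simultaneous relabelling of $i,j,k$ by permutations of $\{1,\dots,d\}$. The classes are $xx,x$ ($i=j=k$); $xx,y$ ($i=j\ne k$); $xy,x$ ($i=k\neq j$); $xy,y$ ($j=k\ne i$); $xy,z$ (all distinct, only for $d>2$). Their cardinalities are $n(xx,x)=d$, $n(xx,y)=n(xy,x)=n(xy,y)=d(d-1)$, $n(xy,z)=d(d-1)(d-2)$. Let $P^\pm$ be the projections onto the symmetric and antisymmetric subspaces of $\mathcal H_A\otimes\mathcal H_B$, $d_\pm=\mathrm{Tr}P^\pm$, $|\omega\rangle_{XY}=\sum_n|n\rangle_X|n\rangle_Y$, and for $m=1,\dots,d$ $$|\Psi^\pm_m\rangle=\frac{|\omega\rangle_{AC}|m\rangle_B\pm|m\rangle_A|\omega\rangle_{BC}}{\sqrt{2(d\pm1)}}.$$ Then for $(ij,k)$ in class $\ell$ $$R'_{ij,k}=\frac{d}{n(\ell)}\Big[\sum_{a,b\in\{+,-\}}s_\ell^{\alpha,a,b}\sum_{m=1}^d|\Psi^a_m\rangle\langle\Psi^b_m|+s_\ell^\beta P^\beta+s_\ell^\gamma P^\gamma\Big],$$ where $P^\beta=I_C\otimes P^+-\sum_m|\Psi^+_m\rangle\langle\Psi^+_m|$ and $P^\gamma=I_C\otimes P^--\sum_m|\Psi^-_m\rangle\langle\Psi^-_m|$ (the $\gamma$ term is absent for $d=2$), $s^\alpha_\ell$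 is a positive semidefinite $2\times2$ matrix, and $s_\ell^\beta,s_\ell^\gamma\ge0$ are numbers (identified with the matrices $\mathrm{diag}(s_\ell^\beta,0)$ and $\mathrm{diag}(0,s_\ell^\gamma)$). With $d_\alpha=d$, $d_\beta=\mathrm{Tr}P^\beta$, $d_\gamma=\mathrm{Tr}P^\gamma$, the normalization constraints are $$d_+=d_\alpha\sum_\ell s_\ell^{\alpha,+,+}+d_\beta\sum_\ell s_\ell^\beta,\qquad d_-=d_\alpha\sum_\ell s_\ell^{\alpha,-,-}+d_\gamma\sum_\ell s_\ell^\gamma .$$
   Formalization: The printed A, B do not reach 4/(3d) (for d=2 they give about 0.659 < 2/3). The formal theorem uses A = diag(8d_+/(9d), 0) and B with diagonal entries d_+/(9d), d_-/d and off-diagonal entries sqrt(d_+ d_-)/(3d); the rest is as stated. *)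

theory Defs
  imports "HOL-Analysis.Analysis"
begin

text \<open>
  Operators on \<open>\<complex>\<^sup>d\<close> (with its standard basis) are matrices \<open>complex^'n^'n\<close> with \<open>CARD('n) = d\<close>;
  a tensor product is indexed by pairs of indices.  Multipartite systems associate to the left,
  so an operator on \<open>ABCD\<close> has index type \<open>(('n \<times> 'n) \<times> 'n) \<times> 'n\<close>.
\<close>

subsection \<open>Linear algebra on tensor products\<close>

definition cadj :: "complex^'m^'n \<Rightarrow> complex^'n^'m"
  where "cadj M = (\<chi> i j. cnj (M $ j $ i))"

definition cinner :: "complex^'m \<Rightarrow> complex^'m \<Rightarrow> complex"
  where "cinner v w = (\<Sum>i\<in>UNIV. cnj (v $ i) * w $ i)"

definition psd :: "complex^'m^'m \<Rightarrow> bool"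
  where "psd M \<longleftrightarrow> (\<forall>v. cinner v (M *v v) \<in> \<real> \<and> 0 \<le> Re (cinner v (M *v v)))"

definition ketbra :: "complex^'m \<Rightarrow> complex^'m \<Rightarrow> complex^'m^'m"
  where "ketbra v w = (\<chi> i j. v $ i * cnj (w $ j))"

definition cscale :: "complex \<Rightarrow> complex^'m^'m \<Rightarrow> complex^'m^'m"
  where "cscale c M = (\<chi> i j. c * M $ i $ j)"

definition kron :: "complex^'m::finite^'m \<Rightarrow> complex^'k::finite^'k \<Rightarrow> complex^('m \<times> 'k)^('m \<times> 'k)"
  where "kron M N = (\<chi> p q. M $ fst p $ fst q * N $ snd p $ snd q)"

text \<open>\<open>\<langle>k| M |k\<rangle>\<close>, the bra and ket acting on the second (i.e. rightmost) factor only:\<close>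

definition sandwich :: "'k::finite \<Rightarrow> complex^('m::finite \<times> 'k)^('m \<times> 'k) \<Rightarrow> complex^'m^'m"
  where "sandwich k M = (\<chi> i j. M $ (i, k) $ (j, k))"

definition ptrace :: "complex^('m::finite \<times> 'k::finite)^('m \<times> 'k) \<Rightarrow> complex^'m^'m"
  where "ptrace M = (\<Sum>k\<in>UNIV. sandwich k M)"


subsection \<open>The special unitary group and its Haar measure\<close>

definition SU :: "(complex^'n^'n) set"
  where "SU = {U. U ** cadj U = mat 1 \<and> det U = 1}"

text \<open>The (unique) left-invariant Borel probability measure on \<open>SU(d)\<close>; regularity is automatic
  for a finite Borel measure on a compact metrizable group.\<close>

definition haar_SU :: "(complex^'n^'n) measure \<Rightarrow> bool"
  where "haar_SU \<mu> \<longleftrightarrow>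
    sets \<mu> = sets (restrict_space borel SU) \<and>
    emeasure \<mu> (space \<mu>) = 1 \<and>
    (\<forall>V\<in>SU. distr \<mu> \<mu> (\<lambda>U. V ** U) = \<mu>)"


subsection \<open>Cloning instruments and the average fidelity\<close>

type_synonym 'n op_AB = "complex^('n \<times> 'n)^('n \<times> 'n)"
type_synonym 'n op_ABC = "complex^(('n \<times> 'n) \<times> 'n)^(('n \<times> 'n) \<times> 'n)"
type_synonym 'n op_ABCD =
  "complex^((('n \<times> 'n) \<times> 'n) \<times> 'n)^((('n \<times> 'n) \<times> 'n) \<times> 'n)"

definition cloning_instrument :: "('n::finite \<Rightarrow> 'n \<Rightarrow> 'n op_ABCD) \<Rightarrow> bool"
  where "cloning_instrument R \<longleftrightarrow>
    (\<forall>i j. psd (R i j)) \<and>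
    (\<exists>S::'n op_ABC. psd S \<and>
       (\<Sum>i\<in>UNIV. \<Sum>j\<in>UNIV. R i j) = kron S (mat 1) \<and>
       ptrace S = mat 1)"

text \<open>The effects \<open>E\<^sub>i\<close> of the von Neumann measurement given by the unitary \<open>U\<close>:\<close>

definition vN :: "complex^'n^'n \<Rightarrow> 'n \<Rightarrow> complex^'n^'n"
  where "vN U i = U ** ketbra (axis i 1) (axis i 1) ** cadj U"

definition on_C :: "complex^'n::finite^'n \<Rightarrow> 'n op_ABCD"
  where "on_C U = kron (kron (mat 1) U) (mat 1)"

definition replicated ::
    "('n::finite \<Rightarrow> 'n \<Rightarrow> 'n op_ABCD) \<Rightarrow> complex^'n^'n \<Rightarrow> 'n \<Rightarrow> 'n \<Rightarrow> 'n op_AB"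
  where "replicated R U i j =
    transpose (\<Sum>k\<in>UNIV. sandwich k (sandwich k (on_C (cadj U) ** R i j ** on_C U)))"

text \<open>For a cloning instrument the trace below is a nonnegative real number, so that \<open>Re\<close> only
  changes its type.\<close>

definition avg_fidelity ::
    "(complex^'n::finite^'n) measure \<Rightarrow> ('n \<Rightarrow> 'n \<Rightarrow> 'n op_ABCD) \<Rightarrow> real"
  where "avg_fidelity \<mu> R =
    (1 / (real CARD('n))\<^sup>2) *
    (\<Sum>i\<in>UNIV. \<Sum>j\<in>UNIV.
       \<integral>U. Re (trace (replicated R U i j ** kron (vN U i) (vN U j))) \<partial>\<mu>)"


subsection \<open>Symmetric instruments\<close>

text \<open>The signs \<open>+\<close> and \<open>-\<close> label the rows and columns, in this order, of \<open>2 \<times> 2\<close> matrices; they are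
  the indices 1 and 2 of type \<open>2\<close>.\<close>

definition sgnval :: "2 \<Rightarrow> real"
  where "sgnval a = (if a = 1 then 1 else - 1)"

datatype cls = XX_X | XX_Y | XY_X | XY_Y | XY_Z

definition classes :: "cls set"
  where "classes = {XX_X, XX_Y, XY_X, XY_Y, XY_Z}"

definition class_of :: "'n \<Rightarrow> 'n \<Rightarrow> 'n \<Rightarrow> cls"
  where "class_of i j k =
    (if i = j then (if k = i then XX_X else XX_Y)
     else if k = i then XY_X else if k = j then XY_Y else XY_Z)"

definition class_size :: "'n::finite itself \<Rightarrow> cls \<Rightarrow> nat"
  where "class_size _ l = card {(i::'n, j, k). class_of i j k = l}"

definition swap_AB :: "'n::finite op_AB"
  where "swap_AB = (\<chi> p q. if fst p = snd q \<and> snd p = fst q then 1 else 0)"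

definition P_sgn :: "2 \<Rightarrow> 'n::finite op_AB"
  where "P_sgn a = (1/2) *\<^sub>R (mat 1 + sgnval a *\<^sub>R swap_AB)"

definition Psi :: "2 \<Rightarrow> 'n::finite \<Rightarrow> complex^(('n \<times> 'n) \<times> 'n)"
  where "Psi a m =
    (1 / sqrt (2 * (real CARD('n) + sgnval a))) *\<^sub>R
      ((\<Sum>n\<in>UNIV. axis ((n, m), n) 1) + sgnval a *\<^sub>R (\<Sum>n\<in>UNIV. axis ((m, n), n) 1))"

text \<open>\<open>P\<^sup>\<beta>\<close> for the sign \<open>+\<close> and \<open>P\<^sup>\<gamma>\<close> for the sign \<open>-\<close>:\<close>

definition P_rest :: "2 \<Rightarrow> 'n::finite op_ABC"
  where "P_rest a = kron (P_sgn a) (mat 1) - (\<Sum>m\<in>UNIV. ketbra (Psi a m) (Psi a m))"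

definition d_sgn :: "'n::finite itself \<Rightarrow> 2 \<Rightarrow> real"
  where "d_sgn _ a = Re (trace (P_sgn a :: 'n op_AB))"

definition d_rest :: "'n::finite itself \<Rightarrow> 2 \<Rightarrow> real"
  where "d_rest _ a = Re (trace (P_rest a :: 'n op_ABC))"

datatype irrep = Alpha | Beta | Gamma

text \<open>The numbers \<open>s\<^sup>\<beta>\<close> and \<open>s\<^sup>\<gamma>\<close> are stored as the matrices \<open>diag(s\<^sup>\<beta>, 0)\<close> and \<open>diag(0, s\<^sup>\<gamma>)\<close>.\<close>

type_synonym sset = "irrep \<Rightarrow> cls \<Rightarrow> complex^2^2"

definition mat2 :: "complex \<Rightarrow> complex \<Rightarrow> complex \<Rightarrow> complex \<Rightarrow> complex^2^2"
  where "mat2 a b c e = vector [vector [a, b], vector [c, e]]"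

text \<open>For \<open>d = 2\<close> the class \<open>xy,z\<close> and the \<open>\<gamma>\<close> term do not exist; the corresponding entries are
  then required to vanish.\<close>

definition symmetric_set :: "'n::finite itself \<Rightarrow> sset \<Rightarrow> bool"
  where "symmetric_set T s \<longleftrightarrow>
    (\<forall>l. psd (s Alpha l)) \<and>
    (\<forall>l. \<exists>b::real. 0 \<le> b \<and> s Beta l = mat2 (of_real b) 0 0 0) \<and>
    (\<forall>l. \<exists>c::real. 0 \<le> c \<and> s Gamma l = mat2 0 0 0 (of_real c)) \<and>
    (CARD('n) = 2 \<longrightarrow> (\<forall>v. s v XY_Z = 0) \<and> (\<forall>l. s Gamma l = 0)) \<and>
    of_real (d_sgn T 1) =
      of_nat CARD('n) * (\<Sum>l\<in>classes. s Alpha l $ 1 $ 1)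
      + of_real (d_rest T 1) * (\<Sum>l\<in>classes. s Beta l $ 1 $ 1) \<and>
    of_real (d_sgn T 2) =
      of_nat CARD('n) * (\<Sum>l\<in>classes. s Alpha l $ 2 $ 2)
      + of_real (d_rest T 2) * (\<Sum>l\<in>classes. s Gamma l $ 2 $ 2)"

definition sparse_set :: "'n::finite itself \<Rightarrow> sset \<Rightarrow> bool"
  where "sparse_set T s \<longleftrightarrow>
    symmetric_set T s \<and>
    card {(v, l). s v l \<noteq> 0} \<le> 2 \<and>
    (\<forall>v l. s v l \<noteq> 0 \<longrightarrow> rank (s v l) = 1)"

definition sym_R' :: "sset \<Rightarrow> 'n::finite \<Rightarrow> 'n \<Rightarrow> 'n \<Rightarrow> 'n op_ABC"
  where "sym_R' s i j k =
    (let l = class_of i j k in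
      (real CARD('n) / real (class_size TYPE('n) l)) *\<^sub>R
        ((\<Sum>a\<in>UNIV. \<Sum>b\<in>UNIV.
            cscale (s Alpha l $ a $ b) (\<Sum>m\<in>UNIV. ketbra (Psi a m) (Psi b m)))
         + cscale (s Beta l $ 1 $ 1) (P_rest 1)
         + cscale (s Gamma l $ 2 $ 2) (P_rest 2)))"

definition sym_instrument :: "sset \<Rightarrow> 'n::finite \<Rightarrow> 'n \<Rightarrow> 'n op_ABCD"
  where "sym_instrument s i j =
    (\<Sum>k\<in>UNIV. kron (sym_R' s i j k) (ketbra (axis k 1) (axis k 1)))"


subsection \<open>The optimal sets\<close>

text \<open>
  The matrices printed in the literature are \<open>A = diag((9 d\<^sub>+ - 1) / (9 d), 0)\<close> and \<open>B\<close> with entries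
  \<open>1 / (9 d)\<close>, \<open>sqrt d\<^sub>- / (3 d)\<close>, \<open>d\<^sub>- / d\<close>.  They satisfy the normalization constraints but have
  average fidelity \<open>(5/4 + 1 / (6 sqrt d\<^sub>+) - 1 / (12 d\<^sub>+)) / d\<close>, which is less than \<open>4 / (3 d)\<close>
  because \<open>d\<^sub>+ > 1\<close>.  The value \<open>4 / (3 d)\<close> stated there is attained when the weight \<open>1 / (9 d)\<close> is
  replaced by \<open>d\<^sub>+ / (9 d)\<close>, with the other entries of \<open>A\<close> and \<open>B\<close> adjusted so as to keep the
  normalization and the rank of \<open>B\<close>; these are the matrices below.
\<close>

definition opt_A :: "'n::finite itself \<Rightarrow> complex^2^2"
  where "opt_A T =
    mat2 (of_real ((9 * d_sgn T 1 - d_sgn T 1) / (9 * real CARD('n)))) 0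
         0 0"

definition opt_B :: "'n::finite itself \<Rightarrow> complex^2^2"
  where "opt_B T =
    mat2 (of_real (d_sgn T 1 / (9 * real CARD('n))))
         (of_real (sqrt (d_sgn T 1 * d_sgn T 2) / (3 * real CARD('n))))
         (of_real (sqrt (d_sgn T 1 * d_sgn T 2) / (3 * real CARD('n))))
         (of_real (d_sgn T 2 / real CARD('n)))"

definition sigma_z :: "complex^2^2"
  where "sigma_z = mat2 1 0 0 (- 1)"

definition alpha_set :: "(cls \<Rightarrow> complex^2^2) \<Rightarrow> sset"
  where "alpha_set f v l = (case v of Alpha \<Rightarrow> f l | Beta \<Rightarrow> 0 | Gamma \<Rightarrow> 0)"

definition opt_set_1 :: "'n::finite itself \<Rightarrow> sset"
  where "opt_set_1 T = alpha_set ((\<lambda>_. 0)(XX_X := opt_A T, XY_X := opt_B T))"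

definition opt_set_2 :: "'n::finite itself \<Rightarrow> sset"
  where "opt_set_2 T =
    alpha_set ((\<lambda>_. 0)(XX_X := opt_A T, XY_Y := sigma_z ** opt_B T ** sigma_z))"

definition opt_set_mid :: "'n::finite itself \<Rightarrow> sset"
  where "opt_set_mid T =
    alpha_set ((\<lambda>_. 0)(XX_X := opt_A T, XY_X := (1/2) *\<^sub>R opt_B T,
                       XY_Y := (1/2) *\<^sub>R (sigma_z ** opt_B T ** sigma_z)))"

end

theory Submission
  imports Defs
begin

text \<open>
  The fidelity of \<open>R\<close> is \<open>d\<^sup>-\<^sup>2 \<Sum>\<^sub>i\<^sub>j\<^sub>k Tr (R\<^sub>i\<^sub>j\<^sub>,\<^sub>k T\<^sub>i\<^sub>j\<^sub>k)\<close>, where \<open>T\<^sub>i\<^sub>j\<^sub>k\<close> is the Haar average of the projection onto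
  \<open>U\<^sup>*|i\<rangle> \<otimes> U\<^sup>*|j\<rangle> \<otimes> U|k\<rangle>\<close>. The bound \<open>4/(3d)\<close> is semidefinite duality: every \<open>T\<^sub>i\<^sub>j\<^sub>k\<close> is at most
  \<open>P\<^sup>+/d\<^sub>+ + P\<^sup>-/(3 d\<^sub>-)\<close> (tensored with the identity on \<open>C\<close>), whose trace against \<open>\<Sum>\<^sub>i\<^sub>j R\<^sub>i\<^sub>j\<^sub>,\<^sub>k\<close> is \<open>4/3\<close> by the
  normalization of \<open>R\<close>. This operator inequality needs only the fourth moments of a column of \<open>U\<close>:
  summing over one index with the unitarity of \<open>U\<close> expresses the averages for distinct indices through
  \<open>T\<^sub>i\<^sub>i\<^sub>i\<close>, and \<open>T\<^sub>i\<^sub>i\<^sub>i\<close> acts on the span of the vectors \<open>\<Psi>\<^sup>+\<^sub>m\<close> as the scalar \<open>1/d\<^sub>+\<close>. For symmetric instruments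
  the integrand does not depend on \<open>U\<close>, so the fidelity is an explicit linear function of \<open>s\<close>, and the
  optimal \<open>s\<close> are found from the equality case of the same duality.
\<close>

section \<open>Averages over the special unitary group\<close>

text \<open>The dual weights can be read off from the span of the \<open>Psi\<close> vectors, where
  the averaged operators act as 2 by 2 blocks. For i = j = k the only entry is 1/d_+, so the weight
  of P^+ must be at least 1/d_+. For i = k different from j the block is v v^T with v = (1/(2 sqrt
  d_+), 1/(2 sqrt d_-)), and it lies below diag(1/d_+, z) iff 1/4 + 1/(4 d_- z) <= 1, that is z >=
  1/(3 d_-). This is the origin of the factor 3 and of the value 1 + 1/3. Two obstacles shape the
  averaging. The Haar measure is only given as left invariant, whereas relabelling outcomes
  multiplies U from the right; inversion invariance bridges the gap. The test unitaries
  (transpositions, a phase on one coordinate) need not have determinant one; the integrands ignore a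
  global phase, so these unitaries can be rescaled into SU(d). Positive operators are split into
  rank-one terms, so that every operator inequality becomes one about a single vector with three
  indices.\<close>

definition unitary :: "complex^'n^'n \<Rightarrow> bool"
  where "unitary V \<longleftrightarrow> V ** cadj V = mat 1"

lemma cadj_nth [simp]: "cadj M $ i $ j = cnj (M $ j $ i)"
  by (simp add: cadj_def)

lemma cadj_cadj [simp]: "cadj (cadj M) = M"
  by (simp add: vec_eq_iff)

lemma cadj_mult: "cadj (M ** N) = cadj N ** cadj M"
  by (simp add: vec_eq_iff matrix_matrix_mult_def mult.commute)

lemma unitary_mult: "unitary V \<Longrightarrow> unitary W \<Longrightarrow> unitary (V ** W)"
  unfolding unitary_def cadj_mult by (metis matrix_mul_assoc matrix_mul_lid)

lemma unitary_cadj: "unitary V \<Longrightarrow> unitary (cadj V)"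
  by (simp add: unitary_def matrix_left_right_inverse)

lemma det_cadj: "det (cadj M) = cnj (det M)"
proof -
  have "cnj (det M) = det (transpose (cadj M))"
    by (simp add: det_def transpose_def)
  then show ?thesis by simp
qed

lemma SU_unitary: "U \<in> SU \<Longrightarrow> unitary U"
  by (simp add: SU_def unitary_def)

lemma SU_mult: "U \<in> SU \<Longrightarrow> V \<in> SU \<Longrightarrow> U ** V \<in> SU"
  using unitary_mult[of U V] by (simp add: SU_def unitary_def det_mul)

lemma SU_cadj: "U \<in> SU \<Longrightarrow> cadj U \<in> SU"
  using unitary_cadj[of U] by (simp add: SU_def unitary_def det_cadj)

lemma unitary_rows: "unitary U \<Longrightarrow> (\<Sum>j\<in>UNIV. U $ a $ j * cnj (U $ b $ j)) = of_bool (a = b)"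
  by (auto simp: unitary_def vec_eq_iff matrix_matrix_mult_def mat_def)

lemma unitary_columns: "unitary U \<Longrightarrow> (\<Sum>a\<in>UNIV. U $ a $ i * cnj (U $ a $ j)) = of_bool (i = j)"
  using unitary_rows[OF unitary_cadj, of U j i] by (simp add: mult.commute eq_commute)

section \<open>Compactness of SU(d) and rescaling of unitaries into it\<close>

lemma continuous_on_matrix_mult:
  fixes f g :: "'a::topological_space \<Rightarrow> complex^'n^'n"
  shows "continuous_on S f \<Longrightarrow> continuous_on S g \<Longrightarrow> continuous_on S (\<lambda>x. f x ** g x)"
  unfolding matrix_matrix_mult_def by (intro continuous_intros) auto

lemma continuous_on_cadj:
  fixes f :: "'a::topological_space \<Rightarrow> complex^'n^'n"
  shows "continuous_on S f \<Longrightarrow> continuous_on S (\<lambda>x. cadj (f x))"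
  unfolding cadj_def by (intro continuous_intros) auto

lemma continuous_on_complex_det: "continuous_on S (det :: complex^'n^'n \<Rightarrow> complex)"
  unfolding det_def by (intro continuous_intros)

text \<open>Rows of a unitary have norm one, which bounds the entries; the defining equations are
  closed. Compactness makes every continuous integrand bounded, hence integrable.\<close>

lemma compact_SU: "compact (SU :: (complex^'n^'n) set)"
proof (rule compact_eq_bounded_closed[THEN iffD2, OF conjI])
  have "norm U \<le> (\<Sum>a\<in>(UNIV::'n set). \<Sum>j\<in>(UNIV::'n set). 1)"
    if "U \<in> SU" for U :: "complex^'n^'n"
  proof -
    have "norm (U $ a $ j) \<le> 1" for a j
    proof -
      have "(norm (U $ a $ j))\<^sup>2 \<le> (\<Sum>j\<in>UNIV. (norm (U $ a $ j))\<^sup>2)"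
        by (rule member_le_sum) auto
      also have "complex_of_real \<dots> = 1"
        using unitary_rows[OF SU_unitary[OF that], of a a]
        by (simp only: of_real_sum complex_norm_square) simp
      then have "(\<Sum>j\<in>UNIV. (norm (U $ a $ j))\<^sup>2) = 1" by (simp only: of_real_eq_1_iff)
      finally show ?thesis by (simp add: power_le_one_iff abs_square_le_1)
    qed
    then show ?thesis
      unfolding norm_vec_def
      by (intro order_trans[OF L2_set_le_sum] sum_mono) (auto intro: L2_set_nonneg)
  qed
  then show "bounded (SU :: (complex^'n^'n) set)" unfolding bounded_iff by blast
  have "SU = (\<lambda>U::complex^'n^'n. U ** cadj U) -` {mat 1} \<inter> det -` {1}"
    by (auto simp: SU_def)
  moreover have "closed \<dots>"
    by (intro closed_Int closed_vimage continuous_on_matrix_mult continuous_on_cadj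
        continuous_on_complex_det continuous_on_id closed_singleton)
  ultimately show "closed (SU :: (complex^'n^'n) set)" by simp
qed

text \<open>Multiplying V by c multiplies the determinant by c^d, so a d-th root of the inverse
  determinant does it.\<close>

lemma SU_phase:
  fixes V :: "complex^'n^'n"
  assumes "unitary V"
  obtains c where "norm c = 1" "(\<chi> i j. c * V $ i $ j) \<in> SU"
proof -
  have "det V * cnj (det V) = 1"
    unfolding det_cadj[symmetric] det_mul[symmetric] using assms by (simp add: unitary_def)
  then have "(norm (det V))\<^sup>2 = 1"
    unfolding complex_norm_square[symmetric] by (simp only: of_real_eq_1_iff)
  then have n1: "norm (det V) = 1"
    using power2_eq_1_iff[of "norm (det V)"] norm_ge_zero[of "det V"] by linarith
  define d where "d = CARD('n)"
  \<comment> \<open>\<open>det V\<close> has modulus one, so dividing minus its argument by d gives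
    the required root.\<close>
  define c where "c = cis (- Arg (det V) / d)"
  have "d > 0" by (simp add: d_def)
  then have "real d * (- Arg (det V) / d) = - Arg (det V)" by simp
  then have "c ^ d = cis (- Arg (det V))"
    using Complex.DeMoivre[of "- Arg (det V) / d" d] unfolding c_def by (simp only:)
  moreover have "det V = cis (Arg (det V))"
    using n1 rcis_cmod_Arg[of "det V"] by (simp add: rcis_def)
  moreover have "cis (- Arg (det V)) * cis (Arg (det V)) = 1"
    by (simp only: cis_mult) simp
  ultimately have cd: "c ^ d * det V = 1"
    by (simp only:)
  have "(\<chi> i j. c * V $ i $ j) = (\<chi> i. c *s V $ i)"
    by (simp add: vec_eq_iff)
  then have 1: "det (\<chi> i j. c * V $ i $ j) = 1"
    using cd det_rows_mul[of "\<lambda>_. c" "\<lambda>i. V $ i"] by (simp add: d_def)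
  have c1: "norm c = 1" by (simp add: c_def)
  then have "c * cnj c = 1" unfolding complex_norm_square[symmetric] by simp
  then have "c * x * (cnj c * y) = x * y" for x y
    by (simp add: mult.assoc mult.left_commute[of x] flip: mult.assoc[of c "cnj c"])
  then have "(\<chi> i j. c * V $ i $ j) ** cadj (\<chi> i j. c * V $ i $ j) = V ** cadj V"
    by (simp only: vec_eq_iff matrix_matrix_mult_def cadj_nth vec_lambda_beta complex_cnj_mult) simp
  with 1 c1 show ?thesis using assms that[of c] by (simp add: SU_def unitary_def)
qed

section \<open>Integration over the Haar measure and its invariances\<close>

locale haar =
  fixes \<mu> :: "(complex^'n^'n) measure"
  assumes haar: "haar_SU \<mu>"
begin

abbreviation E :: "(complex^'n^'n \<Rightarrow> 'b::{banach,second_countable_topology}) \<Rightarrow> 'b"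
  where "E \<equiv> integral\<^sup>L \<mu>"

lemma sets_mu: "sets \<mu> = sets (restrict_space borel SU)"
  using haar by (simp add: haar_SU_def)

lemma space_mu [simp]: "space \<mu> = SU"
  using sets_eq_imp_space_eq[OF sets_mu] by (simp add: space_restrict_space)

lemma emeasure_mu: "emeasure \<mu> (space \<mu>) = 1"
  using haar unfolding haar_SU_def by blast

lemma measure_mu [simp]: "measure \<mu> SU = 1"
  using emeasure_mu unfolding measure_def by simp

sublocale prob_mu: finite_measure \<mu>
proof
  from emeasure_mu show "emeasure \<mu> (space \<mu>) \<noteq> \<infinity>" by (simp del: space_mu)
qed

lemma measurable_mu_borel: "g \<in> borel_measurable borel \<Longrightarrow> g \<in> borel_measurable \<mu>"
  unfolding measurable_cong_sets[OF sets_mu refl] by (rule measurable_restrict_space1)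

lemma measurable_id_mu [measurable]: "(\<lambda>U. U) \<in> borel_measurable \<mu>"
  by (rule measurable_mu_borel) simp

lemma integrable_continuous:
  fixes f :: "complex^'n^'n \<Rightarrow> 'b::{banach,second_countable_topology}"
  assumes "continuous_on UNIV f"
  shows "integrable \<mu> f"
proof -
  have "compact (f ` SU)"
    by (rule compact_continuous_image[OF continuous_on_subset[OF assms] compact_SU]) simp
  then obtain B where "norm (f U) \<le> B" if "U \<in> SU" for U
    using compact_imp_bounded[of "f ` SU"] unfolding bounded_iff by auto
  then show ?thesis
    by (intro prob_mu.integrable_const_bound[of _ B] measurable_mu_borel borel_measurable_continuous_onI assms)
      auto
qed

lemma expectation_const [simp]: "E (\<lambda>_. c) = c"
  by simp

lemma expectation_cong: "(\<And>U. U \<in> SU \<Longrightarrow> f U = g U) \<Longrightarrow> E f = E g"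
  by (rule Bochner_Integration.integral_cong) auto

lemma left_invariant:
  fixes f :: "complex^'n^'n \<Rightarrow> 'b::{banach,second_countable_topology}"
  assumes f: "continuous_on UNIV f" and V: "V \<in> SU"
  shows "E (\<lambda>U. f (V ** U)) = E f"
proof -
  have "(\<lambda>U. V ** U) \<in> borel_measurable \<mu>"
    by (intro measurable_mu_borel borel_measurable_continuous_onI continuous_on_matrix_mult
        continuous_on_const continuous_on_id)
  then have m: "(\<lambda>U. V ** U) \<in> measurable \<mu> \<mu>"
    using V unfolding measurable_cong_sets[OF refl sets_mu]
    by (intro measurable_restrict_space2) (auto intro: SU_mult)
  have "E f = integral\<^sup>L (distr \<mu> \<mu> (\<lambda>U. V ** U)) f"
    using haar V by (simp add: haar_SU_def)
  also have "\<dots> = E (\<lambda>U. f (V ** U))"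
    by (intro integral_distr m measurable_mu_borel borel_measurable_continuous_onI f)
  finally show ?thesis ..
qed

text \<open>Averaging \<open>f (V\<^sup>* U)\<close> over \<open>U\<close> first gives \<open>E f\<close>; averaging over \<open>V\<close> first, after the shift
  \<open>V \<mapsto> U V\<close>, gives the average of \<open>f (V\<^sup>*)\<close>.\<close>

lemma inverse_invariant:
  fixes f :: "complex^'n^'n \<Rightarrow> 'b::{banach,second_countable_topology}"
  assumes f: "continuous_on UNIV f"
  shows "E (\<lambda>U. f (cadj U)) = E f"
proof -
  interpret P: pair_sigma_finite \<mu> \<mu> by standard
  have "continuous_on UNIV (\<lambda>p::(complex^'n^'n) \<times> (complex^'n^'n). cadj (fst p) ** snd p)"
    by (intro continuous_on_matrix_mult continuous_on_cadj continuous_on_fst continuous_on_snd continuous_on_id)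
  then have cont: "continuous_on UNIV (\<lambda>p::(complex^'n^'n) \<times> (complex^'n^'n). f (cadj (fst p) ** snd p))"
    by (rule continuous_on_compose2[OF f]) simp
  have "(\<lambda>p::(complex^'n^'n) \<times> (complex^'n^'n). f (cadj (fst p) ** snd p)) \<in> borel_measurable borel"
    by (intro borel_measurable_continuous_onI cont)
  from measurable_compose[OF _ this, of "\<lambda>p. (fst p, snd p)" "\<mu> \<Otimes>\<^sub>M \<mu>"]
  have meas: "(\<lambda>p. f (cadj (fst p) ** snd p)) \<in> borel_measurable (\<mu> \<Otimes>\<^sub>M \<mu>)"
    using borel_measurable_Pair[of fst "\<mu> \<Otimes>\<^sub>M \<mu>" snd]
      measurable_compose[OF measurable_fst measurable_id_mu, of \<mu>]
      measurable_compose[OF measurable_snd measurable_id_mu, of \<mu>] by simp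
  have "compact (f ` SU)"
    by (rule compact_continuous_image[OF continuous_on_subset[OF f] compact_SU]) simp
  then obtain B where B: "norm (f U) \<le> B" if "U \<in> SU" for U
    using compact_imp_bounded[of "f ` SU"] unfolding bounded_iff by auto
  have "finite_measure (\<mu> \<Otimes>\<^sub>M \<mu>)"
    by (intro finite_measure_pair_measure prob_mu.finite_measure_axioms)
  then have int: "integrable (\<mu> \<Otimes>\<^sub>M \<mu>) (\<lambda>(V, U). f (cadj V ** U))"
    unfolding case_prod_beta
    by (intro finite_measure.integrable_const_bound[of _ _ B] meas)
      (auto intro!: AE_I2 B SU_mult SU_cadj simp: space_pair_measure)
  have "E f = E (\<lambda>V. E (\<lambda>U. f (cadj V ** U)))"
    by (subst expectation_cong[of _ "\<lambda>_. E f"]) (auto intro: left_invariant f SU_cadj)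
  also have "\<dots> = E (\<lambda>U. E (\<lambda>V. f (cadj V ** U)))"
    by (rule P.Fubini_integral[OF int, symmetric])
  also have "\<dots> = E (\<lambda>U. E (\<lambda>V. f (cadj V)))"
  proof (rule expectation_cong)
    fix U :: "complex^'n^'n" assume U: "U \<in> SU"
    have "E (\<lambda>V. f (cadj V ** U)) = E (\<lambda>V. f (cadj (U ** V) ** U))"
      by (rule left_invariant[OF _ U, symmetric])
        (intro continuous_on_compose2[OF f] continuous_on_matrix_mult continuous_on_cadj
          continuous_on_const continuous_on_id; simp)
    moreover have "cadj (U ** V) ** U = cadj V" for V :: "complex^'n^'n"
      using unitary_cadj[OF SU_unitary[OF U]]
      by (simp add: cadj_mult unitary_def flip: matrix_mul_assoc)
    ultimately show "E (\<lambda>V. f (cadj V ** U)) = E (\<lambda>V. f (cadj V))" by simp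
  qed
  finally show ?thesis by simp
qed

text \<open>Right translation by V is left translation by the adjoint of V carried out between two
  inversions.\<close>

lemma right_invariant:
  fixes f :: "complex^'n^'n \<Rightarrow> 'b::{banach,second_countable_topology}"
  assumes f: "continuous_on UNIV f" and V: "V \<in> SU"
  shows "E (\<lambda>U. f (U ** V)) = E f"
proof -
  have c: "continuous_on UNIV (\<lambda>U. f (cadj U))"
    by (intro continuous_on_compose2[OF f] continuous_on_cadj continuous_on_id) auto
  have "E (\<lambda>U. f (U ** V)) = E (\<lambda>U. f (cadj U ** V))"
    by (rule inverse_invariant[symmetric])
      (intro continuous_on_compose2[OF f] continuous_on_matrix_mult continuous_on_const continuous_on_id; simp)
  also have "\<dots> = E (\<lambda>U. f (cadj (cadj V ** U)))"
    by (simp add: cadj_mult)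
  also have "\<dots> = E f"
    using left_invariant[OF c SU_cadj[OF V]] inverse_invariant[OF f] by simp
  finally show ?thesis .
qed

text \<open>A unitary differs from an element of SU(d) by a phase, and \<open>phase\<close> says
  that f does not see it.\<close>

lemma unitary_invariant:
  fixes f :: "complex^'n^'n \<Rightarrow> 'b::{banach,second_countable_topology}"
  assumes f: "continuous_on UNIV f"
    and phase: "\<And>c U. norm c = 1 \<Longrightarrow> f (\<chi> i j. c * U $ i $ j) = f U"
    and V: "unitary V"
  shows "E (\<lambda>U. f (V ** U)) = E f" and "E (\<lambda>U. f (U ** V)) = E f"
proof -
  obtain c where c: "norm c = 1" and S: "(\<chi> i j. c * V $ i $ j) \<in> SU" (is "?W \<in> SU")
    using SU_phase[OF V] .
  have "?W ** U = (\<chi> i j. c * (V ** U) $ i $ j)" "U ** ?W = (\<chi> i j. c * (U ** V) $ i $ j)" for U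
    by (auto simp: vec_eq_iff matrix_matrix_mult_def sum_distrib_left mult_ac)
  then show "E (\<lambda>U. f (V ** U)) = E f" "E (\<lambda>U. f (U ** V)) = E f"
    using left_invariant[OF f S] right_invariant[OF f S] by (simp_all add: phase c)
qed

end

subsection \<open>Fourth moments of a column\<close>

text \<open>Because \<sigma> is an involution, one matrix acts by \<sigma> both on rows (from the
  left) and on columns (from the right).\<close>

lemma unitary_perm:
  assumes "\<And>i. \<sigma> (\<sigma> i) = (i::'n::finite)"
  defines "P \<equiv> (\<chi> i j. if j = \<sigma> i then 1 else 0) :: complex^'n^'n"
  shows "unitary P" and "(P ** U) $ a $ j = U $ \<sigma> a $ j" and "(U ** P) $ a $ j = U $ a $ \<sigma> j"
proof -
  have eq: "j = \<sigma> i \<longleftrightarrow> i = \<sigma> j" for i j using assms(1) by metis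
  have inj: "\<sigma> i = \<sigma> j \<longleftrightarrow> i = j" for i j using assms(1) by metis
  show "unitary P"
    by (simp add: unitary_def P_def vec_eq_iff matrix_matrix_mult_def mat_def if_distrib[of cnj]
        if_distrib[of "\<lambda>x. x * _"] inj cong: if_cong)
  show "(P ** U) $ a $ j = U $ \<sigma> a $ j"
    by (simp add: P_def matrix_matrix_mult_def if_distrib[of "\<lambda>x. x * _"] cong: if_cong)
  show "(U ** P) $ a $ j = U $ a $ \<sigma> j"
    by (simp add: P_def matrix_matrix_mult_def eq[of j] if_distrib[of "\<lambda>x. _ * x"] cong: if_cong)
qed

lemma unitary_phase:
  fixes a :: "'n::finite"
  assumes "norm c = 1"
  defines "P \<equiv> (\<chi> i j. if i = j then if i = a then c else 1 else 0) :: complex^'n^'n"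
  shows "unitary P" and "(P ** U) $ b $ j = (if b = a then c else 1) * U $ b $ j"
proof -
  have c: "c * cnj c = 1" unfolding complex_norm_square[symmetric] by (simp add: assms(1))
  show "(P ** U) $ b $ j = (if b = a then c else 1) * U $ b $ j" for U j b
    by (simp add: P_def matrix_matrix_mult_def if_distrib[of "\<lambda>x. x * _"] cong: if_cong)
  from this[of "cadj P"] show "unitary P"
    using c by (simp add: unitary_def vec_eq_iff mat_def) (simp add: P_def)
qed

text \<open>The identity outside the plane of \<open>a\<close> and \<open>b\<close>, and there \<open>((1 + \<i>) 1 + (1 - \<i>) \<sigma>\<^sub>x) / 2\<close>, a square root
  of the transposition.\<close>

lemma unitary_mix:
  fixes a b :: "'n::finite"
  assumes "a \<noteq> b"
  obtains P :: "complex^'n^'n" where "unitary P"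
    "\<And>U j. (P ** U) $ a $ j = ((1 + \<i>) * U $ a $ j + (1 - \<i>) * U $ b $ j) / 2"
    "\<And>U j. (P ** U) $ b $ j = ((1 - \<i>) * U $ a $ j + (1 + \<i>) * U $ b $ j) / 2"
proof
  define z :: "'n \<Rightarrow> complex" where "z k = (if k = a then 1 else 0) - (if k = b then 1 else 0)" for k
  \<comment> \<open>Since z = e_a - e_b has squared length 2, P multiplies z by \<i> and fixes its
    orthogonal complement.\<close>
  define P :: "complex^'n^'n" where "P = (\<chi> i j. (if i = j then 1 else 0) + (\<i> - 1) / 2 * z i * z j)"
  have zs: "(\<Sum>k\<in>UNIV. z k * g k) = g a - g b" for g
    by (simp add: z_def left_diff_distrib sum_subtractf if_distrib[of "\<lambda>x. x * _"] cong: if_cong)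
  have PU: "(P ** U) $ p $ j = U $ p $ j + (\<i> - 1) / 2 * z p * (U $ a $ j - U $ b $ j)" for U p j
  proof -
    have "(P ** U) $ p $ j = (\<Sum>k\<in>UNIV. (if p = k then U $ k $ j else 0) + (\<i> - 1) / 2 * z p * (z k * U $ k $ j))"
      unfolding P_def matrix_matrix_mult_def
      by (auto simp: algebra_simps if_distrib[of "\<lambda>x. x * _"] intro!: sum.cong)
    then show ?thesis by (simp only: sum.distrib zs sum_distrib_left[symmetric]) simp
  qed
  show "(P ** U) $ a $ j = ((1 + \<i>) * U $ a $ j + (1 - \<i>) * U $ b $ j) / 2" for U j
    using assms by (simp add: PU z_def field_simps)
  show "(P ** U) $ b $ j = ((1 - \<i>) * U $ a $ j + (1 + \<i>) * U $ b $ j) / 2" for U j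
    using assms by (simp add: PU z_def field_simps)
  have cz: "cnj (z k) = z k" for k by (simp add: z_def)
  have zab: "z a = 1" "z b = - 1" using assms by (auto simp: z_def)
  have zd: "(if p = a then 1 else 0) - (if p = b then 1 else 0) = z p"
    "(if a = p then 1 else 0) - (if b = p then 1 else 0) = z p" for p by (auto simp: z_def)
  have "(P ** cadj P) $ p $ q = (if p = q then 1 else 0)" for p q
  proof -
    have "(P ** cadj P) $ p $ q = cnj (P $ q $ p) + (\<i> - 1) / 2 * z p * (cnj (P $ q $ a) - cnj (P $ q $ b))"
      by (simp add: PU)
    also have "cnj (P $ q $ a) - cnj (P $ q $ b) = z q + (- \<i> - 1) * z q"
    proof -
      define A B :: complex where "A = (if q = a then 1 else 0)" and "B = (if q = b then 1 else 0)"
      have e: "cnj (P $ q $ a) = A + (- \<i> - 1) / 2 * z q" "cnj (P $ q $ b) = B - (- \<i> - 1) / 2 * z q"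
        by (simp_all add: P_def cz zab A_def B_def)
      have "cnj (P $ q $ a) - cnj (P $ q $ b) = (A - B) + (- \<i> - 1) * z q"
        unfolding e by (simp add: field_simps)
      then show ?thesis by (simp only: A_def B_def zd)
    qed
    also have "cnj (P $ q $ p) = (if p = q then 1 else 0) + (- \<i> - 1) / 2 * z q * z p"
      by (simp add: P_def cz)
    finally show ?thesis by (simp add: algebra_simps flip: add_divide_distrib)
  qed
  then show "unitary P" by (simp add: unitary_def vec_eq_iff mat_def)
qed

lemma sum_rotate3:
  "(\<Sum>a\<in>A. \<Sum>b\<in>B. \<Sum>c\<in>C. f a b c) = (\<Sum>c\<in>C. \<Sum>a\<in>A. \<Sum>b\<in>B. (f a b c :: 'a::comm_monoid_add))"
  by (subst sum.swap[of _ A C], rule sum.cong[OF refl], rule sum.swap)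

context haar
begin

lemma expectation_sum:
  fixes f :: "'i::finite \<Rightarrow> complex^'n^'n \<Rightarrow> 'b::{banach,second_countable_topology}"
  assumes "\<And>i. continuous_on UNIV (f i)"
  shows "E (\<lambda>U. \<Sum>i\<in>UNIV. f i U) = (\<Sum>i\<in>UNIV. E (f i))"
  by (intro Bochner_Integration.integral_sum integrable_continuous assms)

lemma expectation_scale: "E (\<lambda>U. c * f U) = c * (E f :: complex)"
  by simp

text \<open>Symmetry determines these moments up to a factor. Phases kill every moment whose row
  indices do not pair up, transpositions identify the diagonal ones, and \<open>unitary_mix\<close>
  ties the remaining type to the diagonal one. The unit length of the column fixes the
  factor.\<close>

lemma moment4:
  "E (\<lambda>U. U $ a $ i * U $ b $ i * cnj (U $ a' $ i) * cnj (U $ b' $ i)) =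
    (of_bool (a = a' \<and> b = b') + of_bool (a = b' \<and> b = a')) / (of_nat CARD('n) * (of_nat CARD('n) + 1))"
proof -
  define F where "F a b a' b' U = U $ a $ i * U $ b $ i * cnj (U $ a' $ i) * cnj (U $ b' $ i)"
    for a b a' b' and U :: "complex^'n^'n"
  define M where "M a b a' b' = E (F a b a' b')" for a b a' b'
  have cont: "continuous_on UNIV (F a b a' b')" for a b a' b'
    unfolding F_def by (intro continuous_intros)
  have phase: "F a b a' b' (\<chi> i j. c * U $ i $ j) = F a b a' b' U" if "norm c = 1" for a b a' b' c U
  proof -
    have "c * cnj c = 1" unfolding complex_norm_square[symmetric] by (simp add: that)
    then have "(c * cnj c) * (c * cnj c) * F a b a' b' U = F a b a' b' U" by simp
    then show ?thesis unfolding F_def by (simp add: mult_ac)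
  qed
  have inv: "E (\<lambda>U. F a b a' b' (V ** U)) = E (F a b a' b')" if "unitary V" for a b a' b' V
    by (rule unitary_invariant(1)[OF cont phase that])
  have zero: "M a b a' b' = 0" if "\<not> (a = a' \<and> b = b')" "\<not> (a = b' \<and> b = a')" for a b a' b'
  proof -
    define t where "t p q = (if q = p then \<i> else 1)" for p q :: 'n
    have "M a b a' b' = t p a * t p b * cnj (t p a') * cnj (t p b') * M a b a' b'" for p
    proof -
      obtain V :: "complex^'n^'n" where V: "unitary V" "\<And>(U::complex^'n^'n) b j. (V ** U) $ b $ j = t p b * U $ b $ j"
        using unitary_phase[OF norm_ii, of p] unfolding t_def by blast
      have "M a b a' b' = E (\<lambda>U. F a b a' b' (V ** U))"
        unfolding M_def by (rule inv[OF V(1), symmetric])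
      also have "\<dots> = E (\<lambda>U. (t p a * t p b * cnj (t p a') * cnj (t p b')) * F a b a' b' U)"
        unfolding F_def V(2) by (simp add: mult_ac)
      also have "\<dots> = t p a * t p b * cnj (t p a') * cnj (t p b') * M a b a' b'"
        unfolding M_def by (rule expectation_scale)
      finally show ?thesis .
    qed
    \<comment> \<open>The phase at p multiplies the moment by \<i> to the power (occurrences of p in
      a, b) - (occurrences in a', b'). This exponent lies between -2 and 2, so the factor is 1 only
      if the occurrences agree.\<close>
    from this[of a] this[of b] this[of a'] this[of b'] that show ?thesis
      unfolding t_def by (cases "a = b"; cases "a = a'"; cases "a = b'"; cases "b = a'"; cases "b = b'"; cases "a' = b'") auto
  qed
  have diag: "M a a a a = M b b b b" for a b
  proof -
    define \<sigma> where "\<sigma> = Transposition.transpose a b"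
    have s: "\<sigma> (\<sigma> i) = i" for i by (simp add: \<sigma>_def)
    show ?thesis
      using inv[OF unitary_perm(1)[of \<sigma>, OF s], of a a a a] unitary_perm(2)[of \<sigma>, OF s]
      unfolding M_def F_def by (simp add: \<sigma>_def)
  qed
  have off: "M a b a b = M a a a a / 2" if ab: "a \<noteq> b" for a b
  proof -
    obtain V :: "complex^'n^'n" where V: "unitary V"
      "\<And>(U::complex^'n^'n) j. (V ** U) $ a $ j = ((1 + \<i>) * U $ a $ j + (1 - \<i>) * U $ b $ j) / 2"
      "\<And>(U::complex^'n^'n) j. (V ** U) $ b $ j = ((1 - \<i>) * U $ a $ j + (1 + \<i>) * U $ b $ j) / 2"
      using unitary_mix[OF ab] by metis
    \<comment> \<open>The cross terms cancel because (1 + \<i>)^2 + (1 - \<i>)^2 = 0. Hence only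
      diagonal moments and vanishing ones remain after the substitution.\<close>
    have sq: "((1 + \<i>) * x + (1 - \<i>) * y) / 2 * (((1 - \<i>) * x + (1 + \<i>) * y) / 2) = (x * x + y * y) / 2" for x y
      by (simp add: field_simps)
    have "F a b a b (V ** U) = (F a a a a U + F a a b b U + (F b b a a U + F b b b b U)) / 4" for U
    proof -
      let ?x = "U $ a $ i" and ?y = "U $ b $ i"
      have "F a b a b (V ** U) = ((?x * ?x + ?y * ?y) / 2) * cnj ((?x * ?x + ?y * ?y) / 2)"
        unfolding F_def V(2,3) sq[symmetric] by (simp add: mult_ac)
      then show ?thesis by (simp add: F_def field_simps)
    qed
    then have "M a b a b = E (\<lambda>U. (F a a a a U + F a a b b U + (F b b a a U + F b b b b U)) / 4)"
      unfolding M_def using inv[OF V(1), of a b a b] by (simp only:)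
    also have "\<dots> = (M a a a a + M a a b b + (M b b a a + M b b b b)) / 4"
      unfolding M_def by (simp add: Bochner_Integration.integral_add integrable_continuous cont)
    also have "M a a b b = 0" using ab by (auto intro: zero)
    also have "M b b a a = 0" using ab by (auto intro: zero)
    also have "M b b b b = M a a a a" by (rule diag)
    finally show ?thesis by simp
  qed
  \<comment> \<open>The square of the squared length of the column, integrated.\<close>
  have "1 = (\<Sum>a\<in>UNIV. \<Sum>b\<in>UNIV. M a b a b)"
  proof -
    have "(\<Sum>a\<in>UNIV. \<Sum>b\<in>UNIV. M a b a b) = E (\<lambda>U. \<Sum>a\<in>UNIV. \<Sum>b\<in>UNIV. F a b a b U)"
      unfolding M_def by (simp add: expectation_sum cont continuous_on_sum)
    also have "\<dots> = E (\<lambda>U. 1)"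
    proof (rule expectation_cong)
      fix U :: "complex^'n^'n" assume "U \<in> SU"
      then have "(\<Sum>a\<in>UNIV. U $ a $ i * cnj (U $ a $ i)) = 1"
        using unitary_columns[OF SU_unitary, of U i i] by simp
      then have "1 = (\<Sum>a\<in>UNIV. U $ a $ i * cnj (U $ a $ i)) * (\<Sum>a\<in>UNIV. U $ a $ i * cnj (U $ a $ i))"
        by simp
      also have "\<dots> = (\<Sum>a\<in>UNIV. \<Sum>b\<in>UNIV. F a b a b U)"
        unfolding sum_product F_def by (simp add: mult_ac)
      finally show "(\<Sum>a\<in>UNIV. \<Sum>b\<in>UNIV. F a b a b U) = 1" ..
    qed
    finally show ?thesis by simp
  qed
  also have "\<dots> = (\<Sum>a\<in>(UNIV::'n set). \<Sum>b\<in>(UNIV::'n set). M i i i i / 2 + (if b = a then M i i i i / 2 else 0))"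
    by (intro sum.cong refl) (use off diag[of _ i] in auto)
  also have "\<dots> = M i i i i / 2 * (of_nat CARD('n) * (of_nat CARD('n) + 1))"
    by (simp add: sum.distrib algebra_simps)
  finally have k: "1 = M i i i i / 2 * (of_nat CARD('n) * (of_nat CARD('n) + 1))" .
  have "M i i i i = 2 / K" if "1 = M i i i i / 2 * K" for K
  proof -
    have "K \<noteq> 0" using that by auto
    moreover have "M i i i i * K = 2" using that by simp
    ultimately show ?thesis by (rule nonzero_eq_divide_eq[THEN iffD2])
  qed
  from this[OF k] have d: "M a a a a = 2 / (of_nat CARD('n) * (of_nat CARD('n) + 1))" for a
    unfolding diag[of a i] .
  have sym: "M a b b a = M a b a b" for a b
    unfolding M_def F_def by (simp add: mult_ac)
  consider "a = a' \<and> b = b' \<and> a = b" | "a = a' \<and> b = b' \<and> a \<noteq> b" | "a = b' \<and> b = a' \<and> a \<noteq> b"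
    | "\<not> (a = a' \<and> b = b')" "\<not> (a = b' \<and> b = a')" by blast
  then have "M a b a' b' = (of_bool (a = a' \<and> b = b') + of_bool (a = b' \<and> b = a'))
      / (of_nat CARD('n) * (of_nat CARD('n) + 1))"
  proof cases
    case 1
    then have eq: "b = a" "a' = a" "b' = a" by auto
    show ?thesis unfolding eq d by simp
  next
    case 2
    then have eq: "a' = a" "b' = b" and ne: "a \<noteq> b" "b \<noteq> a" by auto
    show ?thesis unfolding eq off[OF ne(1)] d using ne by simp
  next
    case 3
    then have eq: "a' = b" "b' = a" and ne: "a \<noteq> b" "b \<noteq> a" by auto
    show ?thesis unfolding eq sym off[OF ne(1)] d using ne by simp
  next
    case 4
    then have eq: "(a = a' \<and> b = b') = False" "(a = b' \<and> b = a') = False" by blast+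
    show ?thesis unfolding zero[OF 4] eq by simp
  qed
  moreover have "M a b a' b' = E (\<lambda>U. U $ a $ i * U $ b $ i * cnj (U $ a' $ i) * cnj (U $ b' $ i))"
    unfolding M_def by (rule expectation_cong) (rule F_def)
  ultimately show ?thesis by (simp only:)
qed


lemma moment4_sum:
  "E (\<lambda>U. \<Sum>a\<in>UNIV. \<Sum>b\<in>UNIV. \<Sum>a'\<in>UNIV. \<Sum>b'\<in>UNIV.
      g a b a' b' * (U $ a $ i * U $ b $ i * cnj (U $ a' $ i) * cnj (U $ b' $ i))) =
    (\<Sum>a\<in>UNIV. \<Sum>b\<in>UNIV. g a b a b + g a b b a) / (of_nat CARD('n) * (of_nat CARD('n) + 1))"
proof -
  have "E (\<lambda>U. \<Sum>a\<in>UNIV. \<Sum>b\<in>UNIV. \<Sum>a'\<in>UNIV. \<Sum>b'\<in>UNIV.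
      g a b a' b' * (U $ a $ i * U $ b $ i * cnj (U $ a' $ i) * cnj (U $ b' $ i))) =
    (\<Sum>a\<in>UNIV. \<Sum>b\<in>UNIV. \<Sum>a'\<in>UNIV. \<Sum>b'\<in>UNIV.
      g a b a' b' * ((of_bool (a = a' \<and> b = b') + of_bool (a = b' \<and> b = a'))
        / (of_nat CARD('n) * (of_nat CARD('n) + 1))))"
    by (subst expectation_sum, (intro continuous_intros)[1])+
      (simp only: expectation_scale moment4)
  also have "\<dots> = (\<Sum>a\<in>UNIV. \<Sum>b\<in>UNIV. g a b a b + g a b b a) / (of_nat CARD('n) * (of_nat CARD('n) + 1))"
  proof -
    have "(\<Sum>a'\<in>UNIV. \<Sum>b'\<in>UNIV. g a b a' b' * ((of_bool (a = a' \<and> b = b') + of_bool (a = b' \<and> b = a')) / D))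
        = (g a b a b + g a b b a) / D" for a b and D :: complex
    proof -
      have "(\<Sum>a'\<in>UNIV. \<Sum>b'\<in>UNIV. g a b a' b' * ((of_bool (a = a' \<and> b = b') + of_bool (a = b' \<and> b = a')) / D))
        = (\<Sum>a'\<in>UNIV. \<Sum>b'\<in>UNIV. (if b' = b then if a' = a then g a b a b / D else 0 else 0)
            + (if b' = a then if a' = b then g a b b a / D else 0 else 0))"
        by (intro sum.cong refl) (auto simp: add_divide_distrib distrib_left)
      then show ?thesis by (simp add: sum.distrib add_divide_distrib)
    qed
    then show ?thesis by (simp only: sum_divide_distrib)
  qed
  finally show ?thesis .
qed

text \<open>A second moment is a sum of fourth moments once the squared length 1 of the column is
  inserted as a factor.\<close>

lemma moment2: "E (\<lambda>U. U $ a $ i * cnj (U $ a' $ i)) = of_bool (a = a') / of_nat CARD('n)"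
proof -
  have "E (\<lambda>U. U $ a $ i * cnj (U $ a' $ i))
      = E (\<lambda>U. \<Sum>b\<in>UNIV. U $ a $ i * U $ b $ i * cnj (U $ a' $ i) * cnj (U $ b $ i))"
  proof (rule expectation_cong)
    fix U :: "complex^'n^'n" assume "U \<in> SU"
    then have "(\<Sum>b\<in>UNIV. U $ b $ i * cnj (U $ b $ i)) = 1"
      using unitary_columns[OF SU_unitary, of U i i] by simp
    moreover have "(\<Sum>b\<in>UNIV. U $ a $ i * U $ b $ i * cnj (U $ a' $ i) * cnj (U $ b $ i))
        = U $ a $ i * cnj (U $ a' $ i) * (\<Sum>b\<in>UNIV. U $ b $ i * cnj (U $ b $ i))"
      by (simp add: sum_distrib_left mult_ac)
    ultimately show "U $ a $ i * cnj (U $ a' $ i)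
        = (\<Sum>b\<in>UNIV. U $ a $ i * U $ b $ i * cnj (U $ a' $ i) * cnj (U $ b $ i))"
      by simp
  qed
  also have "\<dots> = (\<Sum>b\<in>UNIV. (of_bool (a = a') + (if b = a then of_bool (a = a') else 0))
      / (of_nat CARD('n) * (of_nat CARD('n) + 1)))"
    by (subst expectation_sum, intro continuous_intros) (cases "a = a'"; auto simp: moment4 intro!: sum.cong sum.neutral)
  also have "\<dots> = of_bool (a = a') * (of_nat CARD('n) + 1) / (of_nat CARD('n) * (of_nat CARD('n) + 1))"
    by (simp add: sum.distrib algebra_simps flip: sum_divide_distrib)
  also have "\<dots> = of_bool (a = a') / of_nat CARD('n)"
  proof -
    have "of_nat (CARD('n) + 1) \<noteq> (0::complex)" by (simp only: of_nat_eq_0_iff)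
    then show ?thesis by (simp add: add.commute)
  qed
  finally show ?thesis .
qed

lemma expectation_norm_sq:
  assumes "\<And>U. (norm (f U))\<^sup>2 = r U"
  shows "complex_of_real (E r) = E (\<lambda>U. f U * cnj (f U))"
  unfolding complex_norm_square[symmetric] assms by simp

lemma expectation_x:
  "E (\<lambda>U. (norm (\<Sum>a\<in>UNIV. U $ a $ i * w a))\<^sup>2) = (\<Sum>a\<in>UNIV. (norm (w a))\<^sup>2) / CARD('n)"
proof -
  have "complex_of_real (E (\<lambda>U. (norm (\<Sum>a\<in>UNIV. U $ a $ i * w a))\<^sup>2))
      = E (\<lambda>U. \<Sum>a\<in>UNIV. \<Sum>b\<in>UNIV. (w a * cnj (w b)) * (U $ a $ i * cnj (U $ b $ i)))"
    unfolding expectation_norm_sq[OF refl] cnj_sum sum_product by (simp add: mult_ac)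
  also have "\<dots> = (\<Sum>a\<in>UNIV. \<Sum>b\<in>UNIV. (w a * cnj (w b)) * (of_bool (a = b) / of_nat CARD('n)))"
    by (subst expectation_sum, (intro continuous_intros)[1])+ (simp only: expectation_scale moment2)
  also have "\<dots> = complex_of_real ((\<Sum>a\<in>UNIV. (norm (w a))\<^sup>2) / CARD('n))"
    unfolding of_real_divide of_real_sum complex_norm_square sum_divide_distrib of_bool_def
    by (simp add: if_distrib[of "\<lambda>x. _ * x"] if_distrib[of "\<lambda>x. x / _"] cong: if_cong)
  finally show ?thesis by (simp only: of_real_eq_iff)
qed

text \<open>The average of the projection onto x \<otimes> x, for x a column, is proportional to the
  symmetric projection, so only the symmetrization of w survives.\<close>

lemma expectation_xx:
  "E (\<lambda>U. (norm (\<Sum>a\<in>UNIV. \<Sum>b\<in>UNIV. U $ a $ i * U $ b $ i * w a b))\<^sup>2) =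
    (\<Sum>a\<in>UNIV. \<Sum>b\<in>UNIV. (norm (w a b + w b a))\<^sup>2) / (2 * (real CARD('n) * (real CARD('n) + 1)))"
proof -
  have "complex_of_real (E (\<lambda>U. (norm (\<Sum>a\<in>UNIV. \<Sum>b\<in>UNIV. U $ a $ i * U $ b $ i * w a b))\<^sup>2))
      = E (\<lambda>U. \<Sum>a\<in>UNIV. \<Sum>b\<in>UNIV. \<Sum>a'\<in>UNIV. \<Sum>b'\<in>UNIV.
        (w a b * cnj (w a' b')) * (U $ a $ i * U $ b $ i * cnj (U $ a' $ i) * cnj (U $ b' $ i)))"
  proof -
    have *: "(\<Sum>a\<in>UNIV. \<Sum>b\<in>UNIV. f a b) * (\<Sum>a\<in>UNIV. \<Sum>b\<in>UNIV. g a b)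
        = (\<Sum>a\<in>UNIV. \<Sum>b\<in>UNIV. \<Sum>a'\<in>UNIV. \<Sum>b'\<in>UNIV. f a b * g a' b')"
      for f g :: "'n \<Rightarrow> 'n \<Rightarrow> complex"
      by (simp only: sum_distrib_right) (simp only: sum_distrib_left)
    show ?thesis unfolding expectation_norm_sq[OF refl] cnj_sum * by (simp add: mult_ac)
  qed
  also have "\<dots> = (\<Sum>a\<in>UNIV. \<Sum>b\<in>UNIV. w a b * cnj (w a b) + w a b * cnj (w b a))
      / (of_nat CARD('n) * (of_nat CARD('n) + 1))"
    by (rule moment4_sum)
  also have "(\<Sum>a\<in>UNIV. \<Sum>b\<in>UNIV. w a b * cnj (w a b) + w a b * cnj (w b a))
      = complex_of_real ((\<Sum>a\<in>UNIV. \<Sum>b\<in>UNIV. (norm (w a b + w b a))\<^sup>2) / 2)"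
  proof -
    \<comment> \<open>Averaging with the sum in which a and b are exchanged completes the
      square.\<close>
    let ?h = "\<lambda>a b. w a b * cnj (w a b) + w a b * cnj (w b a)"
    have "(\<Sum>a\<in>UNIV. \<Sum>b\<in>UNIV. ?h a b) = (\<Sum>a\<in>UNIV. \<Sum>b\<in>UNIV. ?h b a)"
      by (rule sum.swap)
    then have "2 * (\<Sum>a\<in>UNIV. \<Sum>b\<in>UNIV. ?h a b) = (\<Sum>a\<in>UNIV. \<Sum>b\<in>UNIV. ?h a b + ?h b a)"
      by (simp only: sum.distrib mult_2)
    also have "\<dots> = complex_of_real (\<Sum>a\<in>UNIV. \<Sum>b\<in>UNIV. (norm (w a b + w b a))\<^sup>2)"
      unfolding of_real_sum complex_norm_square by (intro sum.cong refl) (simp add: algebra_simps)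
    finally show ?thesis unfolding of_real_divide by (simp only: eq_divide_eq) (simp add: mult.commute)
  qed
  finally have "complex_of_real (E (\<lambda>U. (norm (\<Sum>a\<in>UNIV. \<Sum>b\<in>UNIV. U $ a $ i * U $ b $ i * w a b))\<^sup>2))
      = complex_of_real ((\<Sum>a\<in>UNIV. \<Sum>b\<in>UNIV. (norm (w a b + w b a))\<^sup>2) / 2 / (real CARD('n) * (real CARD('n) + 1)))"
    by simp
  then show ?thesis unfolding of_real_eq_iff by simp
qed

text \<open>This is the partial transpose of the previous average: the exchange of the two factors
  turns into the projection onto the maximally entangled vector, which produces the trace of
  w.\<close>

lemma expectation_xxbar:
  "E (\<lambda>U. (norm (\<Sum>a\<in>UNIV. \<Sum>c\<in>UNIV. U $ a $ i * cnj (U $ c $ i) * w a c))\<^sup>2) =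
    ((\<Sum>a\<in>UNIV. \<Sum>c\<in>UNIV. (norm (w a c))\<^sup>2) + (norm (\<Sum>a\<in>UNIV. w a a))\<^sup>2) / (real CARD('n) * (real CARD('n) + 1))"
proof -
  have "complex_of_real (E (\<lambda>U. (norm (\<Sum>a\<in>UNIV. \<Sum>c\<in>UNIV. U $ a $ i * cnj (U $ c $ i) * w a c))\<^sup>2))
      = E (\<lambda>U. \<Sum>a\<in>UNIV. \<Sum>b\<in>UNIV. \<Sum>a'\<in>UNIV. \<Sum>b'\<in>UNIV.
        (w a a' * cnj (w b' b)) * (U $ a $ i * U $ b $ i * cnj (U $ a' $ i) * cnj (U $ b' $ i)))"
  proof -
    have *: "(\<Sum>a\<in>UNIV. \<Sum>b\<in>UNIV. f a b) * (\<Sum>a\<in>UNIV. \<Sum>b\<in>UNIV. g a b)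
        = (\<Sum>a\<in>UNIV. \<Sum>b\<in>UNIV. \<Sum>a'\<in>UNIV. \<Sum>b'\<in>UNIV. f a a' * g b' b)"
      \<comment> \<open>The inner indices are regrouped so that unconjugated entries come with a, b
        and conjugated ones with a', b', as \<open>moment4_sum\<close> requires.\<close>
      for f g :: "'n \<Rightarrow> 'n \<Rightarrow> complex"
    proof -
      have "(\<Sum>a\<in>UNIV. \<Sum>b\<in>UNIV. f a b) * (\<Sum>a\<in>UNIV. \<Sum>b\<in>UNIV. g a b)
          = (\<Sum>a\<in>UNIV. \<Sum>a'\<in>UNIV. \<Sum>b'\<in>UNIV. \<Sum>b\<in>UNIV. f a a' * g b' b)"
        by (simp only: sum_distrib_right) (simp only: sum_distrib_left)
      also have "\<dots> = (\<Sum>a\<in>UNIV. \<Sum>b\<in>UNIV. \<Sum>a'\<in>UNIV. \<Sum>b'\<in>UNIV. f a a' * g b' b)"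
        by (rule sum.cong[OF refl], rule sum_rotate3)
      finally show ?thesis .
    qed
    show ?thesis unfolding expectation_norm_sq[OF refl] cnj_sum * by (simp add: mult_ac)
  qed
  also have "\<dots> = (\<Sum>a\<in>UNIV. \<Sum>b\<in>UNIV. w a a * cnj (w b b) + w a b * cnj (w a b))
      / (of_nat CARD('n) * (of_nat CARD('n) + 1))"
    by (rule moment4_sum)
  also have "(\<Sum>a\<in>UNIV. \<Sum>b\<in>UNIV. w a a * cnj (w b b) + w a b * cnj (w a b))
      = complex_of_real ((\<Sum>a\<in>UNIV. \<Sum>c\<in>UNIV. (norm (w a c))\<^sup>2) + (norm (\<Sum>a\<in>UNIV. w a a))\<^sup>2)"
    unfolding of_real_add of_real_sum complex_norm_square cnj_sum sum_product sum.distrib by simp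
  finally have "complex_of_real (E (\<lambda>U. (norm (\<Sum>a\<in>UNIV. \<Sum>c\<in>UNIV. U $ a $ i * cnj (U $ c $ i) * w a c))\<^sup>2))
      = complex_of_real (((\<Sum>a\<in>UNIV. \<Sum>c\<in>UNIV. (norm (w a c))\<^sup>2) + (norm (\<Sum>a\<in>UNIV. w a a))\<^sup>2) / (real CARD('n) * (real CARD('n) + 1)))"
    by simp
  then show ?thesis unfolding of_real_eq_iff by simp
qed

end

subsection \<open>The average of one outcome\<close>

text \<open>A vector of \<open>ABC\<close> is written as a function of its three indices; \<open>part\<close> is the squared norm of its
  (anti)symmetric part, and \<open>contr\<close> is, up to normalization, its inner product with \<open>\<Psi>\<^sup>\<plusminus>\<^sub>m\<close>.\<close>

definition part :: "2 \<Rightarrow> ('n::finite \<Rightarrow> 'n \<Rightarrow> 'n \<Rightarrow> complex) \<Rightarrow> real"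
  where "part s w = (\<Sum>a\<in>UNIV. \<Sum>b\<in>UNIV. \<Sum>c\<in>UNIV. (norm (w a b c + of_real (sgnval s) * w b a c))\<^sup>2) / 4"

definition contr :: "2 \<Rightarrow> ('n::finite \<Rightarrow> 'n \<Rightarrow> 'n \<Rightarrow> complex) \<Rightarrow> 'n \<Rightarrow> complex"
  where "contr s w m = (\<Sum>n\<in>UNIV. w n m n) + of_real (sgnval s) * (\<Sum>n\<in>UNIV. w m n n)"

text \<open>The inner product of the product vector \<open>phi U i j k\<close>, introduced later,
  with w.\<close>

definition amp :: "complex^'n^'n \<Rightarrow> 'n \<Rightarrow> 'n \<Rightarrow> 'n \<Rightarrow> ('n::finite \<Rightarrow> 'n \<Rightarrow> 'n \<Rightarrow> complex) \<Rightarrow> complex"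
  where "amp U i j k w =
    (\<Sum>a\<in>UNIV. \<Sum>b\<in>UNIV. \<Sum>c\<in>UNIV. U $ a $ i * U $ b $ j * cnj (U $ c $ k) * w a b c)"

lemma sgnval_simps [simp]: "sgnval 1 = 1" "sgnval 2 = - 1" "sgnval a * sgnval a = 1" "sgnval a * (sgnval a * x) = x"
  by (simp_all add: sgnval_def)

lemma part_nonneg: "0 \<le> part s w"
  unfolding part_def by (intro divide_nonneg_nonneg sum_nonneg) auto

lemma norm_sq_diff: "(norm (x - y))\<^sup>2 = (norm x)\<^sup>2 + (norm y)\<^sup>2 - 2 * Re (x * cnj y)"
  by (simp add: cmod_power2) (simp add: power2_eq_square algebra_simps)

lemma norm_sq_add: "(norm (x + y))\<^sup>2 = (norm x)\<^sup>2 + (norm y)\<^sup>2 + 2 * Re (x * cnj y)"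
  by (simp add: cmod_power2) (simp add: power2_eq_square algebra_simps)

lemma part_add: "part 1 w + part 2 w = (\<Sum>a\<in>UNIV. \<Sum>b\<in>UNIV. \<Sum>c\<in>UNIV. (norm (w a b c))\<^sup>2)"
proof -
  have "part 1 w + part 2 w = (\<Sum>a\<in>UNIV. \<Sum>b\<in>UNIV. \<Sum>c\<in>UNIV. ((norm (w a b c))\<^sup>2 + (norm (w b a c))\<^sup>2) / 2)"
    unfolding part_def sum_divide_distrib sum.distrib[symmetric]
    by (intro sum.cong refl) (simp add: norm_sq_add norm_sq_diff field_simps)
  also have "\<dots> = ((\<Sum>a\<in>UNIV. \<Sum>b\<in>UNIV. \<Sum>c\<in>UNIV. (norm (w a b c))\<^sup>2)
      + (\<Sum>a\<in>UNIV. \<Sum>b\<in>UNIV. \<Sum>c\<in>UNIV. (norm (w b a c))\<^sup>2)) / 2"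
    by (simp only: sum.distrib sum_divide_distrib[symmetric])
  also have "(\<Sum>a\<in>UNIV. \<Sum>b\<in>UNIV. \<Sum>c\<in>UNIV. (norm (w b a c))\<^sup>2) = (\<Sum>a\<in>UNIV. \<Sum>b\<in>UNIV. \<Sum>c\<in>UNIV. (norm (w a b c))\<^sup>2)"
    by (rule sum.swap)
  finally show ?thesis by simp
qed

lemma part_swap: "part s (\<lambda>a b. w b a) = part s w"
  unfolding part_def
  by (subst sum.swap) (rule refl)

text \<open>The norm of \<open>P\<^sup>\<plusminus> w - \<lambda> \<Sum>\<^sub>m \<langle>\<Psi>\<^sub>m|w\<rangle> \<Psi>\<^sub>m\<close> is nonnegative.\<close>

lemma contr_bound: "(\<Sum>m\<in>UNIV. (norm (contr s w m))\<^sup>2) \<le> 2 * (CARD('n) + sgnval s) * part s (w :: 'n::finite \<Rightarrow> _)"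
proof -
  define \<sigma> where "\<sigma> = sgnval s"
  have \<sigma>2: "\<sigma> * \<sigma> = 1" "\<sigma> * (\<sigma> * x) = x" "cnj (of_real \<sigma>) = of_real \<sigma>"
    "complex_of_real \<sigma> * of_real \<sigma> = 1" "complex_of_real \<sigma> * (of_real \<sigma> * z) = z" for x z
    by (simp_all add: \<sigma>_def sgnval_def)
  define y where "y a b c = (w a b c + of_real \<sigma> * w b a c) / 2" for a b c
  define t where "t = contr s w"
  \<comment> \<open>Up to a constant, D is the component of w along the \<open>Psi\<close> vectors,
    and y is the (anti)symmetric part of w.\<close>
  define D where "D a b c = (if a = c then t b else 0) + of_real \<sigma> * (if b = c then t a else 0)" for a b c
  define T where "T = (\<Sum>m\<in>UNIV. (norm (t m))\<^sup>2)"
  have T: "complex_of_real T = (\<Sum>m\<in>UNIV. t m * cnj (t m))"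
    unfolding T_def of_real_sum complex_norm_square ..
  have "part s w = (\<Sum>a\<in>UNIV. \<Sum>b\<in>UNIV. \<Sum>c\<in>UNIV. (norm (y a b c))\<^sup>2)"
    unfolding part_def y_def \<sigma>_def sum_divide_distrib by (simp add: norm_divide power_divide)
  have y1: "(\<Sum>a\<in>UNIV. y a b a) = t b / 2" for b
    unfolding y_def t_def contr_def \<sigma>_def by (simp add: sum.distrib sum_distrib_left flip: sum_divide_distrib)
  have y2: "(\<Sum>b\<in>UNIV. y a b b) = of_real \<sigma> * t a / 2" for a
  proof -
    have "(\<Sum>b\<in>UNIV. y a b b) = ((\<Sum>b\<in>UNIV. w a b b) + of_real \<sigma> * (\<Sum>b\<in>UNIV. w b a b)) / 2"
      unfolding y_def by (simp add: sum.distrib sum_distrib_left flip: sum_divide_distrib)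
    then show ?thesis
      unfolding t_def contr_def \<sigma>_def[symmetric] distrib_left \<sigma>2 by (simp add: add.commute)
  qed
  have yD: "(\<Sum>a\<in>UNIV. \<Sum>b\<in>UNIV. \<Sum>c\<in>UNIV. y a b c * cnj (D a b c)) = T"
  proof -
    have "(\<Sum>a\<in>UNIV. \<Sum>b\<in>UNIV. \<Sum>c\<in>UNIV. y a b c * cnj (D a b c))
        = (\<Sum>a\<in>UNIV. \<Sum>b\<in>UNIV. \<Sum>c\<in>UNIV. (if c = a then y a b a * cnj (t b) else 0) + (if c = b then of_real \<sigma> * cnj (t a) * y a b b else 0))"
      unfolding D_def by (intro sum.cong refl) (auto simp: \<sigma>2 algebra_simps)
    also have "\<dots> = (\<Sum>a\<in>UNIV. \<Sum>b\<in>UNIV. y a b a * cnj (t b)) + (\<Sum>a\<in>UNIV. \<Sum>b\<in>UNIV. of_real \<sigma> * cnj (t a) * y a b b)"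
      by (simp add: sum.distrib)
    also have "(\<Sum>a\<in>UNIV. \<Sum>b\<in>UNIV. y a b a * cnj (t b)) = (\<Sum>b\<in>UNIV. t b / 2 * cnj (t b))"
      by (subst sum.swap) (simp add: y1 flip: sum_distrib_right)
    also have "(\<Sum>a\<in>UNIV. \<Sum>b\<in>UNIV. of_real \<sigma> * cnj (t a) * y a b b) = (\<Sum>a\<in>UNIV. t a / 2 * cnj (t a))"
      unfolding sum_distrib_left[symmetric] y2
      by (intro sum.cong refl) (simp add: \<sigma>2 mult_ac)
    finally show ?thesis unfolding T by (simp flip: sum_divide_distrib)
  qed
  have DD: "(\<Sum>a\<in>UNIV. \<Sum>b\<in>UNIV. \<Sum>c\<in>UNIV. (norm (D a b c))\<^sup>2) = 2 * (CARD('n) + \<sigma>) * T"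
  proof -
    have "(\<Sum>a\<in>UNIV. \<Sum>b\<in>UNIV. \<Sum>c\<in>UNIV. (norm (D a b c))\<^sup>2)
        = (\<Sum>a\<in>UNIV. \<Sum>b\<in>UNIV. \<Sum>c\<in>UNIV. (if c = a then (norm (t b))\<^sup>2 else 0)
          + (if c = b then (norm (t a))\<^sup>2 else 0) + (if c = b then if b = a then 2 * \<sigma> * (norm (t b))\<^sup>2 else 0 else 0))"
    proof (intro sum.cong refl)
      have n1: "norm (of_real \<sigma> * z) = norm z" for z :: complex
        by (simp add: \<sigma>_def sgnval_def norm_mult)
      have n2: "2 * Re (z * cnj (of_real \<sigma> * z)) = 2 * \<sigma> * (norm z)\<^sup>2" for z
        by (simp add: cmod_power2) (simp add: power2_eq_square algebra_simps)
      show "(norm (D a b c))\<^sup>2 = (if c = a then (norm (t b))\<^sup>2 else 0)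
          + (if c = b then (norm (t a))\<^sup>2 else 0) + (if c = b then if b = a then 2 * \<sigma> * (norm (t b))\<^sup>2 else 0 else 0)" for a b c
      proof (cases "a = c \<and> b = c")
        case True
        then show ?thesis unfolding D_def norm_sq_add by (simp only: simp_thms if_True n1 n2)
      next
        case False
        then show ?thesis unfolding D_def by (auto simp: n1)
      qed
    qed
    then show ?thesis by (simp add: sum.distrib T_def algebra_simps sum_distrib_left)
  qed
  show ?thesis
  proof (cases "CARD('n) + \<sigma> = 0")
    \<comment> \<open>Only d = 1 with the minus sign: there the \<open>Psi\<close> vectors
      degenerate and D vanishes.\<close>
    case True
    have "(\<Sum>a\<in>UNIV. \<Sum>b\<in>UNIV. \<Sum>c\<in>UNIV. (norm (D a b c))\<^sup>2) = 0" unfolding DD True by simp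
    then have "D a b c = 0" for a b c
      by (simp add: sum_nonneg_eq_0_iff sum_nonneg)
    then have "T = 0" using yD by simp
    then show ?thesis using True by (simp add: T_def t_def \<sigma>_def)
  next
    case False
    moreover have "real CARD('n) \<ge> 1" using zero_less_card_finite[where 'a='n] by linarith
    moreover have "\<sigma> \<ge> -1" by (simp add: \<sigma>_def sgnval_def)
    ultimately have pos: "CARD('n) + \<sigma> > 0" by linarith
    \<comment> \<open>The minimizer over l of |y - l D|^2, which equals \<open>part s w\<close> - 2
      l T + 2 l^2 (d + \<sigma>) T.\<close>
    define l where "l = 1 / (2 * (CARD('n) + \<sigma>))"
    have "0 \<le> (\<Sum>a\<in>UNIV. \<Sum>b\<in>UNIV. \<Sum>c\<in>UNIV. (norm (y a b c - of_real l * D a b c))\<^sup>2)"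
      by (intro sum_nonneg) auto
    also have "\<dots> = (\<Sum>a\<in>UNIV. \<Sum>b\<in>UNIV. \<Sum>c\<in>UNIV. (norm (y a b c))\<^sup>2 + l\<^sup>2 * (norm (D a b c))\<^sup>2 - 2 * l * Re (y a b c * cnj (D a b c)))"
      unfolding norm_sq_diff by (intro sum.cong refl) (simp add: norm_mult power_mult_distrib algebra_simps)
    also have "\<dots> = part s w + l\<^sup>2 * (2 * (CARD('n) + \<sigma>) * T) - 2 * l * Re (of_real T)"
      unfolding \<open>part s w = _\<close> yD[symmetric] DD[symmetric] Re_sum
      by (simp only: sum.distrib sum_subtractf sum_distrib_left)
    also have "l\<^sup>2 * (2 * (CARD('n) + \<sigma>) * T) = l * T"
      using pos by (simp add: l_def power2_eq_square)
    finally have "l * T \<le> part s w" by (simp add: mult.commute)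
    then show ?thesis
      using pos by (simp add: l_def field_simps T_def t_def \<sigma>_def)
  qed
qed

lemma parseval:
  assumes "unitary U"
  shows "(\<Sum>j\<in>UNIV. (norm (\<Sum>b\<in>UNIV. U $ b $ j * y b))\<^sup>2) = (\<Sum>b\<in>UNIV. (norm (y b))\<^sup>2)"
proof -
  have "complex_of_real (\<Sum>j\<in>UNIV. (norm (\<Sum>b\<in>UNIV. U $ b $ j * y b))\<^sup>2)
      = (\<Sum>j\<in>UNIV. \<Sum>b\<in>UNIV. \<Sum>b'\<in>UNIV. y b * cnj (y b') * (U $ b $ j * cnj (U $ b' $ j)))"
    unfolding of_real_sum complex_norm_square cnj_sum sum_product by (simp add: mult_ac)
  also have "\<dots> = (\<Sum>b\<in>UNIV. \<Sum>b'\<in>UNIV. \<Sum>j\<in>UNIV. y b * cnj (y b') * (U $ b $ j * cnj (U $ b' $ j)))"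
    by (rule sum_rotate3[symmetric])
  also have "\<dots> = (\<Sum>b\<in>UNIV. \<Sum>b'\<in>UNIV. if b = b' then y b * cnj (y b') else 0)"
    by (intro sum.cong refl) (simp add: unitary_rows[OF assms] flip: sum_distrib_left)
  also have "\<dots> = complex_of_real (\<Sum>b\<in>UNIV. (norm (y b))\<^sup>2)"
    unfolding of_real_sum complex_norm_square by simp
  finally show ?thesis by (simp only: of_real_eq_iff)
qed

lemma parseval_cnj:
  assumes "unitary U"
  shows "(\<Sum>k\<in>UNIV. (norm (\<Sum>c\<in>UNIV. cnj (U $ c $ k) * y c))\<^sup>2) = (\<Sum>c\<in>UNIV. (norm (y c))\<^sup>2)"
proof -
  have "norm (\<Sum>c\<in>UNIV. cnj (U $ c $ k) * y c) = norm (\<Sum>c\<in>UNIV. U $ c $ k * cnj (y c))" for k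
    by (metis (no_types, lifting) cnj_sum complex_cnj_cnj complex_cnj_mult complex_mod_cnj sum.cong)
  then show ?thesis using parseval[OF assms, of "\<lambda>c. cnj (y c)"] by simp
qed

lemma amp_swap: "amp U j i k (\<lambda>a b. w b a) = amp U i j k w"
  unfolding amp_def by (subst sum.swap) (simp add: mult_ac)

lemma amp_by_B: "amp U i j k w = (\<Sum>b\<in>UNIV. U $ b $ j * (\<Sum>a\<in>UNIV. \<Sum>c\<in>UNIV. U $ a $ i * cnj (U $ c $ k) * w a b c))"
  unfolding amp_def sum_distrib_left by (subst sum.swap) (simp add: mult_ac)

lemma amp_by_C: "amp U i j k w = (\<Sum>c\<in>UNIV. cnj (U $ c $ k) * (\<Sum>a\<in>UNIV. \<Sum>b\<in>UNIV. U $ a $ i * U $ b $ j * w a b c))"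
  unfolding amp_def sum_distrib_left by (subst sum_rotate3) (simp add: mult_ac)

lemma continuous_on_amp [continuous_intros]: "continuous_on S (\<lambda>U. amp U i j k w)"
  unfolding amp_def by (intro continuous_intros)

lemma sum_two_valued:
  assumes "\<And>j. j \<noteq> i \<Longrightarrow> f j = (y::real)"
  shows "(\<Sum>j\<in>(UNIV::'n::finite set). f j) = f i + (real CARD('n) - 1) * y"
proof -
  have "(\<Sum>j\<in>UNIV. f j) = f i + (\<Sum>j\<in>UNIV - {i}. f j)"
    by (rule sum.remove) auto
  also have "(\<Sum>j\<in>UNIV - {i}. f j) = (\<Sum>j\<in>UNIV - {i}. y)"
    by (intro sum.cong) (auto simp: assms)
  also have "\<dots> = (real CARD('n) - 1) * y"
    using zero_less_card_finite[where 'a='n] by (simp add: card_Diff_singleton of_nat_diff)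
  finally show ?thesis .
qed


section \<open>Averages of squared amplitudes over one column or several\<close>

context haar
begin

text \<open>The quadratic form of the averaged operator T_ijk at w.\<close>

definition Q :: "'n \<Rightarrow> 'n \<Rightarrow> 'n \<Rightarrow> ('n \<Rightarrow> 'n \<Rightarrow> 'n \<Rightarrow> complex) \<Rightarrow> real"
  where "Q i j k w = E (\<lambda>U. (norm (amp U i j k w))\<^sup>2)"

lemma Q_nonneg: "0 \<le> Q i j k w"
  unfolding Q_def by simp

text \<open>Relabelling the outcomes is right multiplication by a permutation matrix; a global phase
  changes the amplitude only by a factor of modulus one.\<close>

lemma Q_permute:
  assumes "\<And>i. \<sigma> (\<sigma> i) = i"
  shows "Q (\<sigma> i) (\<sigma> j) (\<sigma> k) w = Q i j k w"
proof -
  define f where "f U = (norm (amp U i j k w))\<^sup>2" for U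
  have phase: "f (\<chi> i j. c * U $ i $ j) = f U" if "norm c = 1" for c U
  proof -
    have "amp (\<chi> i j. c * U $ i $ j) i j k w = c * c * cnj c * amp U i j k w"
      unfolding amp_def sum_distrib_left by (simp add: mult_ac)
    then show ?thesis by (simp add: f_def norm_mult that)
  qed
  have "E (\<lambda>U. f (U ** (\<chi> i j. if j = \<sigma> i then 1 else 0))) = E f"
    by (rule unitary_invariant(2)[OF _ phase unitary_perm(1)[of \<sigma>, OF assms]])
      (unfold f_def, intro continuous_intros)
  then show ?thesis
    unfolding Q_def f_def amp_def unitary_perm(3)[of \<sigma>, OF assms] by simp
qed

lemma Q_swap: "Q j i k (\<lambda>a b. w b a) = Q i j k w"
  unfolding Q_def amp_swap[of _ j i k w] ..

text \<open>The sum of \<open>Q i j k w\<close> over k: the orthonormal columns of U resolve the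
  identity on C, so that C is merely summed over.\<close>

definition N :: "'n \<Rightarrow> 'n \<Rightarrow> ('n \<Rightarrow> 'n \<Rightarrow> 'n \<Rightarrow> complex) \<Rightarrow> real"
  where "N i j w = E (\<lambda>U. \<Sum>c\<in>UNIV. (norm (\<Sum>a\<in>UNIV. \<Sum>b\<in>UNIV. U $ a $ i * U $ b $ j * w a b c))\<^sup>2)"

lemma sum_Q_C: "(\<Sum>k\<in>UNIV. Q i j k w) = N i j w"
proof -
  have "(\<Sum>k\<in>UNIV. Q i j k w) = E (\<lambda>U. \<Sum>k\<in>UNIV. (norm (amp U i j k w))\<^sup>2)"
    unfolding Q_def by (rule expectation_sum[symmetric]) (intro continuous_intros)
  also have "\<dots> = N i j w"
    unfolding N_def amp_by_C by (rule expectation_cong) (rule parseval_cnj[OF SU_unitary])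
  finally show ?thesis .
qed

lemma N_same: "N i i w = 2 / (real CARD('n) * (real CARD('n) + 1)) * part 1 w"
proof -
  have "N i i w = (\<Sum>c\<in>UNIV. (\<Sum>a\<in>UNIV. \<Sum>b\<in>UNIV. (norm (w a b c + w b a c))\<^sup>2) / (2 * (real CARD('n) * (real CARD('n) + 1))))"
    unfolding N_def
    by (subst expectation_sum, intro continuous_intros) (simp only: expectation_xx)
  also have "\<dots> = (\<Sum>a\<in>UNIV. \<Sum>b\<in>UNIV. \<Sum>c\<in>UNIV. (norm (w a b c + w b a c))\<^sup>2) / (2 * (real CARD('n) * (real CARD('n) + 1)))"
    unfolding sum_divide_distrib[symmetric] by (subst sum_rotate3[symmetric]) (rule refl)
  finally show ?thesis unfolding part_def by simp
qed

lemma sum_N: "(\<Sum>j\<in>UNIV. N i j w) = (part 1 w + part 2 w) / CARD('n)"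
proof -
  have "(\<Sum>j\<in>UNIV. N i j w) = E (\<lambda>U. \<Sum>j\<in>UNIV. \<Sum>c\<in>UNIV. (norm (\<Sum>a\<in>UNIV. \<Sum>b\<in>UNIV. U $ a $ i * U $ b $ j * w a b c))\<^sup>2)"
    unfolding N_def by (rule expectation_sum[symmetric]) (intro continuous_intros)
  also have "\<dots> = E (\<lambda>U. \<Sum>c\<in>UNIV. \<Sum>b\<in>UNIV. (norm (\<Sum>a\<in>UNIV. U $ a $ i * w a b c))\<^sup>2)"
  proof (rule expectation_cong)
    fix U :: "complex^'n^'n" assume "U \<in> SU"
    have "(\<Sum>a\<in>UNIV. \<Sum>b\<in>UNIV. U $ a $ i * U $ b $ j * w a b c)
        = (\<Sum>b\<in>UNIV. U $ b $ j * (\<Sum>a\<in>UNIV. U $ a $ i * w a b c))" for j c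
      unfolding sum_distrib_left by (subst sum.swap) (simp add: mult_ac)
    then have "(\<Sum>j\<in>UNIV. \<Sum>c\<in>UNIV. (norm (\<Sum>a\<in>UNIV. \<Sum>b\<in>UNIV. U $ a $ i * U $ b $ j * w a b c))\<^sup>2)
        = (\<Sum>c\<in>UNIV. \<Sum>j\<in>UNIV. (norm (\<Sum>b\<in>UNIV. U $ b $ j * (\<Sum>a\<in>UNIV. U $ a $ i * w a b c)))\<^sup>2)"
      by (simp only:) (rule sum.swap)
    then show "(\<Sum>j\<in>UNIV. \<Sum>c\<in>UNIV. (norm (\<Sum>a\<in>UNIV. \<Sum>b\<in>UNIV. U $ a $ i * U $ b $ j * w a b c))\<^sup>2)
        = (\<Sum>c\<in>UNIV. \<Sum>b\<in>UNIV. (norm (\<Sum>a\<in>UNIV. U $ a $ i * w a b c))\<^sup>2)"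
      by (simp only: parseval[OF SU_unitary[OF \<open>U \<in> SU\<close>]])
  qed
  also have "\<dots> = (\<Sum>c\<in>UNIV. \<Sum>b\<in>UNIV. (\<Sum>a\<in>UNIV. (norm (w a b c))\<^sup>2) / CARD('n))"
    by (subst expectation_sum, (intro continuous_intros)[1])+ (simp only: expectation_x)
  also have "(\<Sum>c\<in>UNIV. \<Sum>b\<in>UNIV. (\<Sum>a\<in>UNIV. (norm (w a b c))\<^sup>2) / CARD('n)) = (part 1 w + part 2 w) / CARD('n)"
    unfolding part_add sum_divide_distrib
    by (subst sum.swap, subst sum_rotate3, rule refl)
  finally show ?thesis .
qed

text \<open>All j different from i give the same value, so it is obtained from the total over j by
  removing j = i and dividing by d - 1. No moment mixing two columns has to be evaluated.\<close>

lemma N_distinct: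
  assumes "i \<noteq> j"
  shows "N i j w = part 1 w / (real CARD('n) * (real CARD('n) + 1)) + part 2 w / (real CARD('n) * (real CARD('n) - 1))"
proof -
  have "N i j' w = N i j w" if "j' \<noteq> i" for j'
  proof -
    define \<sigma> where "\<sigma> = Transposition.transpose j j'"
    have inv: "\<sigma> (\<sigma> i) = i" for i by (simp add: \<sigma>_def)
    have "N (\<sigma> i) (\<sigma> j) w = N i j w"
    proof -
      have "(\<Sum>k\<in>UNIV. Q (\<sigma> i) (\<sigma> j) k w) = (\<Sum>k\<in>UNIV. Q (\<sigma> i) (\<sigma> j) (\<sigma> k) w)"
        by (rule sum.reindex_bij_witness[of _ \<sigma> \<sigma>]) (auto simp: inv)
      then show ?thesis unfolding sum_Q_C[symmetric] Q_permute[of \<sigma>, OF inv] by simp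
    qed
    then show ?thesis using that assms by (simp add: \<sigma>_def Transposition.transpose_def)
  qed
  then have "(\<Sum>j\<in>UNIV. N i j w) = N i i w + (real CARD('n) - 1) * N i j w"
    by (rule sum_two_valued)
  then have eq: "(real CARD('n) - 1) * N i j w
      = (part 1 w + part 2 w) / CARD('n) - 2 / (real CARD('n) * (real CARD('n) + 1)) * part 1 w"
    unfolding sum_N N_same by linarith
  have "card {i, j} \<le> CARD('n)" by (rule card_mono) auto
  then have "real CARD('n) - 1 > 0" using assms by simp
  moreover from this have "real CARD('n) > 0" "real CARD('n) + 1 > 0" by linarith+
  ultimately show ?thesis using eq by (simp add: divide_simps) (simp add: algebra_simps)
qed

text \<open>The best approximation of the amplitude by a linear combination of the entries of the column has
  nonnegative error; this bounds the sixth moment \<open>Q i i i\<close> by fourth ones.\<close>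

lemma Q_iii_bound:
  "Q i i i w \<ge> (\<Sum>m\<in>UNIV. (norm (contr 1 w m))\<^sup>2) / (real CARD('n) * (real CARD('n) + 1)\<^sup>2)"
proof -
  define d where "d = real CARD('n)"
  have d: "d > 0" by (simp add: d_def)
  define t where "t = contr 1 w"
  define T where "T = (\<Sum>m\<in>UNIV. (norm (t m))\<^sup>2)"
  \<comment> \<open>The regression coefficient of the amplitude on the entry m: the correlation t m
    / (d (d + 1)) divided by the variance 1/d.\<close>
  define B where "B U = (\<Sum>m\<in>UNIV. U $ m $ i * (t m / (d + 1)))" for U :: "complex^'n^'n"
  have contB: "continuous_on UNIV B" unfolding B_def by (intro continuous_intros)
  have cor: "E (\<lambda>U. amp U i i i w * cnj (U $ m $ i)) = t m / (of_real d * (of_real d + 1))" for m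
  proof -
    have "E (\<lambda>U. amp U i i i w * cnj (U $ m $ i)) = E (\<lambda>U. \<Sum>a\<in>UNIV. \<Sum>b\<in>UNIV. \<Sum>c\<in>UNIV.
        w a b c * (U $ a $ i * U $ b $ i * cnj (U $ c $ i) * cnj (U $ m $ i)))"
      unfolding amp_def sum_distrib_right by (simp add: mult_ac)
    also have "\<dots> = (\<Sum>a\<in>UNIV. \<Sum>b\<in>UNIV. \<Sum>c\<in>UNIV. w a b c * ((of_bool (a = c \<and> b = m) + of_bool (a = m \<and> b = c))
        / (of_real d * (of_real d + 1))))"
      by (subst expectation_sum, (intro continuous_intros)[1])+ (simp only: expectation_scale moment4 d_def of_real_of_nat_eq)
    also have "\<dots> = (\<Sum>a\<in>UNIV. \<Sum>b\<in>UNIV. \<Sum>c\<in>UNIV. (if c = a then if b = m then w a m a else 0 else 0)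
        + (if c = b then if a = m then w m b b else 0 else 0)) / (of_real d * (of_real d + 1))"
      unfolding sum_divide_distrib by (intro sum.cong refl) (auto simp: add_divide_distrib distrib_left)
    also have "(\<Sum>a\<in>UNIV. \<Sum>b\<in>UNIV. \<Sum>c\<in>UNIV. (if c = a then if b = m then w a m a else 0 else 0)
        + (if c = b then if a = m then w m b b else 0 else 0)) = t m"
    proof -
      have "(\<Sum>a\<in>UNIV. \<Sum>b\<in>UNIV. if a = m then w m b b else 0) = (\<Sum>b\<in>UNIV. w m b b)"
        by (subst sum.swap) simp
      then show ?thesis by (simp add: sum.distrib t_def contr_def)
    qed
    finally show ?thesis .
  qed
  have "E (\<lambda>U. amp U i i i w * cnj (B U)) = of_real (T / (d * (d + 1)\<^sup>2))"
  proof -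
    have "E (\<lambda>U. amp U i i i w * cnj (B U))
        = E (\<lambda>U. \<Sum>m\<in>UNIV. (cnj (t m) / (of_real d + 1)) * (amp U i i i w * cnj (U $ m $ i)))"
      unfolding B_def cnj_sum sum_distrib_left by (simp add: mult_ac)
    also have "\<dots> = (\<Sum>m\<in>UNIV. (cnj (t m) / (of_real d + 1)) * (t m / (of_real d * (of_real d + 1))))"
      by (subst expectation_sum, (intro continuous_intros)[1]) (simp only: expectation_scale cor)
    also have "\<dots> = (\<Sum>m\<in>UNIV. t m * cnj (t m)) / (of_real d * (of_real d + 1)\<^sup>2)"
      unfolding sum_divide_distrib by (simp add: power2_eq_square mult_ac)
    also have "\<dots> = of_real (T / (d * (d + 1)\<^sup>2))"
      unfolding T_def of_real_divide of_real_sum complex_norm_square by simp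
    finally show ?thesis .
  qed
  then have AB: "E (\<lambda>U. Re (amp U i i i w * cnj (B U))) = T / (d * (d + 1)\<^sup>2)"
    by (subst integral_Re) (intro integrable_continuous continuous_intros contB, simp)
  have BB: "E (\<lambda>U. (norm (B U))\<^sup>2) = T / (d * (d + 1)\<^sup>2)"
  proof -
    have "(norm (t m / (complex_of_real d + 1)))\<^sup>2 = (norm (t m))\<^sup>2 / (d + 1)\<^sup>2" for m
    proof -
      have "norm (complex_of_real d + 1) = d + 1"
        using d by (metis norm_of_real of_real_1 of_real_add abs_of_pos add_pos_pos zero_less_one)
      then show ?thesis by (simp add: norm_divide power_divide)
    qed
    then show ?thesis
      unfolding B_def expectation_x T_def by (simp add: d_def mult.commute flip: sum_divide_distrib)
  qed
  have "0 \<le> E (\<lambda>U. (norm (amp U i i i w - B U))\<^sup>2)" by simp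
  also have "\<dots> = E (\<lambda>U. (norm (amp U i i i w))\<^sup>2 + (norm (B U))\<^sup>2 - 2 * Re (amp U i i i w * cnj (B U)))"
    unfolding norm_sq_diff ..
  also have "\<dots> = E (\<lambda>U. (norm (amp U i i i w))\<^sup>2) + E (\<lambda>U. (norm (B U))\<^sup>2) - E (\<lambda>U. 2 * Re (amp U i i i w * cnj (B U)))"
  proof -
    have iA: "integrable \<mu> (\<lambda>U. (norm (amp U i i i w))\<^sup>2)"
      and iB: "integrable \<mu> (\<lambda>U. (norm (B U))\<^sup>2)"
      and iC: "integrable \<mu> (\<lambda>U. 2 * Re (amp U i i i w * cnj (B U)))"
      by (intro integrable_continuous continuous_intros contB)+
    show ?thesis
      by (simp only: Bochner_Integration.integral_diff[OF Bochner_Integration.integrable_add[OF iA iB] iC]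
          Bochner_Integration.integral_add[OF iA iB])
  qed
  also have "\<dots> = Q i i i w - T / (d * (d + 1)\<^sup>2)"
    unfolding Q_def BB integral_mult_right_zero AB by simp
  finally show ?thesis unfolding T_def t_def d_def by simp
qed

text \<open>Summing over j makes column j disappear and leaves an average in column i alone; the d -
  1 terms with j different from i are equal.\<close>

lemma Q_iji:
  assumes "i \<noteq> j"
  shows "(real CARD('n) - 1) * Q i j i w =
    (part 1 w + part 2 w + (\<Sum>m\<in>UNIV. (norm (\<Sum>n\<in>UNIV. w n m n))\<^sup>2)) / (real CARD('n) * (real CARD('n) + 1)) - Q i i i w"
proof -
  have "Q i j' i w = Q i j i w" if "j' \<noteq> i" for j'
  proof -
    define \<sigma> where "\<sigma> = Transposition.transpose j j'"
    have inv: "\<sigma> (\<sigma> i) = i" for i by (simp add: \<sigma>_def)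
    have "\<sigma> i = i" "\<sigma> j = j'"
      using that assms by (simp_all add: \<sigma>_def Transposition.transpose_def)
    then show ?thesis using Q_permute[of \<sigma> i j i w, OF inv] by simp
  qed
  then have "(\<Sum>j\<in>UNIV. Q i j i w) = Q i i i w + (real CARD('n) - 1) * Q i j i w"
    by (rule sum_two_valued)
  moreover have "(\<Sum>j\<in>UNIV. Q i j i w) = (part 1 w + part 2 w + (\<Sum>m\<in>UNIV. (norm (\<Sum>n\<in>UNIV. w n m n))\<^sup>2))
      / (real CARD('n) * (real CARD('n) + 1))"
  proof -
    have "(\<Sum>j\<in>UNIV. Q i j i w) = E (\<lambda>U. \<Sum>j\<in>UNIV. (norm (amp U i j i w))\<^sup>2)"
      unfolding Q_def by (rule expectation_sum[symmetric]) (intro continuous_intros)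
    also have "\<dots> = E (\<lambda>U. \<Sum>b\<in>UNIV. (norm (\<Sum>a\<in>UNIV. \<Sum>c\<in>UNIV. U $ a $ i * cnj (U $ c $ i) * w a b c))\<^sup>2)"
      unfolding amp_by_B by (rule expectation_cong) (rule parseval[OF SU_unitary])
    also have "\<dots> = (\<Sum>b\<in>UNIV. ((\<Sum>a\<in>UNIV. \<Sum>c\<in>UNIV. (norm (w a b c))\<^sup>2) + (norm (\<Sum>n\<in>UNIV. w n b n))\<^sup>2)
        / (real CARD('n) * (real CARD('n) + 1)))"
      by (subst expectation_sum, (intro continuous_intros)[1]) (simp only: expectation_xxbar)
    also have "\<dots> = ((\<Sum>b\<in>UNIV. \<Sum>a\<in>UNIV. \<Sum>c\<in>UNIV. (norm (w a b c))\<^sup>2) + (\<Sum>b\<in>UNIV. (norm (\<Sum>n\<in>UNIV. w n b n))\<^sup>2))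
        / (real CARD('n) * (real CARD('n) + 1))"
      by (simp only: sum.distrib sum_divide_distrib[symmetric])
    also have "(\<Sum>b\<in>UNIV. \<Sum>a\<in>UNIV. \<Sum>c\<in>UNIV. (norm (w a b c))\<^sup>2) = part 1 w + part 2 w"
      unfolding part_add by (rule sum.swap)
    finally show ?thesis .
  qed
  ultimately show ?thesis by linarith
qed

end

text \<open>The right-hand side is what the target bound on \<open>Q i j i w\<close> leaves after
  multiplication by (d - 1) d (d + 1) and removal of \<open>part 1 w + part 2 w\<close>. The
  contraction of A with C is half the sum of the two signed contractions, so a weighted square
  inequality splits it, and \<open>contr_bound\<close> is then applied to each sign.\<close>

lemma contr_bound_2:
  assumes "CARD('n) \<ge> 2"
  shows "(\<Sum>m\<in>UNIV. (norm (\<Sum>n\<in>UNIV. w n m n))\<^sup>2) - (\<Sum>m\<in>UNIV. (norm (contr 1 w m))\<^sup>2) / (real CARD('n) + 1)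
    \<le> (2 * real CARD('n) - 3) * part 1 w + (2 * real CARD('n) - 1) / 3 * part 2 (w :: 'n::finite \<Rightarrow> _)"
proof -
  define d where "d = real CARD('n)"
  have d: "d \<ge> 2" using assms by (simp add: d_def)
  define p where "p m = (\<Sum>n\<in>UNIV. w n m n)" for m
  define A where "A = (\<Sum>m\<in>UNIV. (norm (contr 1 w m))\<^sup>2)"
  define B where "B = (\<Sum>m\<in>UNIV. (norm (contr 2 w m))\<^sup>2)"
  \<comment> \<open>The reciprocals of the two coefficients add up to 4, which is the condition for
    ((x + y)/2)^2 to lie below the weighted sum of squares with a perfect square as defect.\<close>
  have "(norm (p m))\<^sup>2 \<le> (2 * d - 1) / (2 * (d + 1)) * (norm (contr 1 w m))\<^sup>2
      + (2 * d - 1) / (6 * (d - 1)) * (norm (contr 2 w m))\<^sup>2" for m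
  proof -
    define x y where "x = norm (contr 1 w m)" and "y = norm (contr 2 w m)"
    have "norm (p m) = norm ((contr 1 w m + contr 2 w m) / 2)"
      by (simp add: contr_def p_def)
    also have "\<dots> \<le> (x + y) / 2"
      unfolding x_def y_def by (simp add: norm_divide norm_triangle_ineq)
    finally have "(norm (p m))\<^sup>2 \<le> ((x + y) / 2)\<^sup>2" by (rule power_mono) simp
    also have "\<dots> = (2 * d - 1) / (2 * (d + 1)) * x\<^sup>2 + (2 * d - 1) / (6 * (d - 1)) * y\<^sup>2
        - (3 * (d - 1) * x - (d + 1) * y)\<^sup>2 / (12 * (d - 1) * (d + 1))"
      using d by (simp add: divide_simps) (simp add: power2_eq_square algebra_simps)
    also have "\<dots> \<le> (2 * d - 1) / (2 * (d + 1)) * x\<^sup>2 + (2 * d - 1) / (6 * (d - 1)) * y\<^sup>2"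
      using d by simp
    finally show ?thesis unfolding x_def y_def .
  qed
  then have "(\<Sum>m\<in>UNIV. (norm (p m))\<^sup>2) \<le> (2 * d - 1) / (2 * (d + 1)) * A + (2 * d - 1) / (6 * (d - 1)) * B"
    unfolding A_def B_def sum_distrib_left sum.distrib[symmetric] by (intro sum_mono) auto
  moreover have "(2 * d - 1) / (2 * (d + 1)) * A - A / (d + 1) = (2 * d - 3) * (A / (2 * (d + 1)))"
    using d by (simp add: divide_simps) (simp add: algebra_simps)
  moreover have "(2 * d - 3) * (A / (2 * (d + 1))) \<le> (2 * d - 3) * part 1 w"
    using contr_bound[of 1 w] d by (intro mult_left_mono) (simp_all add: A_def d_def divide_simps mult_ac)
  moreover have "(2 * d - 1) / (6 * (d - 1)) * B = (2 * d - 1) / 3 * (B / (2 * (d - 1)))"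
    using d by (simp add: divide_simps)
  moreover have "(2 * d - 1) / 3 * (B / (2 * (d - 1))) \<le> (2 * d - 1) / 3 * part 2 w"
    using contr_bound[of 2 w] d by (intro mult_left_mono) (simp_all add: B_def d_def divide_simps mult_ac)
  ultimately show ?thesis unfolding A_def[symmetric] d_def[symmetric] p_def[symmetric] by linarith
qed

section \<open>The operator inequality, class by class\<close>

context haar
begin

text \<open>One nonnegative summand of \<open>N i i w\<close>. With \<open>k = i\<close> it also
  supplies the upper bound on \<open>Q i i i w\<close> used for distinct indices.\<close>

lemma Q_iij_bound: "Q i i k w \<le> 2 / (real CARD('n) * (real CARD('n) + 1)) * part 1 w"
proof -
  have "Q i i k w \<le> (\<Sum>k\<in>UNIV. Q i i k w)"
    by (rule member_le_sum) (auto simp: Q_nonneg)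
  then show ?thesis unfolding sum_Q_C N_same .
qed

lemma Q_iji_bound:
  assumes d2: "CARD('n) \<ge> 2" and "i \<noteq> j"
  shows "Q i j i w \<le> 2 / (real CARD('n) * (real CARD('n) + 1)) * part 1 w
    + 2 / (3 * real CARD('n) * (real CARD('n) - 1)) * part 2 w"
proof -
  define d where "d = real CARD('n)"
  have d: "d \<ge> 2" using assms by (simp add: d_def)
  define S where "S = (\<Sum>m\<in>UNIV. (norm (\<Sum>n\<in>UNIV. w n m n))\<^sup>2)"
  define A where "A = (\<Sum>m\<in>UNIV. (norm (contr 1 w m))\<^sup>2)"
  have "(d - 1) * Q i j i w = (part 1 w + part 2 w + S) / (d * (d + 1)) - Q i i i w"
    using Q_iji[OF assms(2)] unfolding d_def S_def .
  \<comment> \<open>\<open>Q i i i w\<close> enters with a minus sign, so its lower bound is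
    enough.\<close>
  also have "\<dots> \<le> (part 1 w + part 2 w + S) / (d * (d + 1)) - A / (d * (d + 1)\<^sup>2)"
    using Q_iii_bound[where i=i and w=w] unfolding A_def d_def by linarith
  also have "\<dots> = (part 1 w + part 2 w + (S - A / (d + 1))) / (d * (d + 1))"
    using d by (simp add: divide_simps) (simp add: power2_eq_square algebra_simps)
  also have "\<dots> \<le> (part 1 w + part 2 w + ((2 * d - 3) * part 1 w + (2 * d - 1) / 3 * part 2 w)) / (d * (d + 1))"
    using contr_bound_2[OF d2, of w] d unfolding S_def A_def d_def
    by (intro divide_right_mono) auto
  also have "\<dots> = (d - 1) * (2 / (d * (d + 1)) * part 1 w + 2 / (3 * d * (d - 1)) * part 2 w)"
    using d by (simp add: divide_simps) (simp add: power2_eq_square algebra_simps)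
  finally show ?thesis using d unfolding d_def by simp
qed

text \<open>Summing over k expresses the value through \<open>N i j w\<close>,
  \<open>Q i j i w\<close> and \<open>Q i j j w\<close>. The last two enter with a minus sign, and
  crude lower bounds on them suffice.\<close>

lemma Q_ijk_bound:
  assumes "i \<noteq> j" "k \<noteq> i" "k \<noteq> j"
  shows "Q i j k w \<le> 2 / (real CARD('n) * (real CARD('n) + 1)) * part 1 w
    + 2 / (3 * real CARD('n) * (real CARD('n) - 1)) * part 2 w"
proof -
  define d where "d = real CARD('n)"
  have "card {i, j, k} \<le> CARD('n)" by (rule card_mono) auto
  then have d: "d \<ge> 3" using assms by (simp add: d_def)
  have "Q i j k' w = (if k' = i then Q i j i w else if k' = j then Q i j j w else Q i j k w)" for k'
  proof -
    define \<sigma> where "\<sigma> = Transposition.transpose k k'"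
    have inv: "\<sigma> (\<sigma> i) = i" for i by (simp add: \<sigma>_def)
    have "\<sigma> i = i" "\<sigma> j = j" "\<sigma> k = k'" if "k' \<noteq> i" "k' \<noteq> j"
      using that assms by (simp_all add: \<sigma>_def Transposition.transpose_def)
    then show ?thesis using Q_permute[of \<sigma> i j k w, OF inv] by auto
  qed
  then have "N i j w = (\<Sum>k'\<in>UNIV. if k' = i then Q i j i w else if k' = j then Q i j j w else Q i j k w)"
    unfolding sum_Q_C[symmetric] by (intro sum.cong refl) blast
  also have "\<dots> = (\<Sum>k'\<in>UNIV. Q i j k w + (if k' = i then Q i j i w - Q i j k w else 0)
      + (if k' = j then Q i j j w - Q i j k w else 0))"
    using assms by (intro sum.cong refl) auto
  also have "\<dots> = (d - 2) * Q i j k w + Q i j i w + Q i j j w"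
    by (simp add: sum.distrib d_def algebra_simps)
  finally have N: "(d - 2) * Q i j k w = N i j w - Q i j i w - Q i j j w" by linarith
  \<comment> \<open>In the formula for \<open>Q i j i w\<close> the squared contraction is dropped
    and \<open>Q i i i w\<close> is replaced by its upper bound.\<close>
  have low: "(d - 1) * Q i j i w \<ge> (part 2 w - part 1 w) / (d * (d + 1))" if "i \<noteq> j" for i j w
  proof -
    have "(d - 1) * Q i j i w \<ge> (part 1 w + part 2 w) / (d * (d + 1)) - 2 / (d * (d + 1)) * part 1 w"
      using Q_iji[OF that, of w] Q_iij_bound[of i i w] d
      by (simp add: d_def add_divide_distrib sum_nonneg add_nonneg_nonneg)
        (smt (verit) divide_nonneg_nonneg sum_nonneg zero_le_power2 of_nat_0_le_iff mult_nonneg_nonneg)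
    moreover have "(part 1 w + part 2 w) / (d * (d + 1)) - 2 / (d * (d + 1)) * part 1 w = (part 2 w - part 1 w) / (d * (d + 1))"
      by (simp add: diff_divide_distrib add_divide_distrib)
    ultimately show ?thesis by simp
  qed
  have "(d - 1) * Q i j j w \<ge> (part 2 w - part 1 w) / (d * (d + 1))"
    using low[of j i "\<lambda>a b. w b a"] assms unfolding part_swap[of _ w] Q_swap[of j i j w] by auto
  with low[OF assms(1), of w] have "(d - 1) * (Q i j i w + Q i j j w) \<ge> 2 * ((part 2 w - part 1 w) / (d * (d + 1)))"
    unfolding distrib_left by linarith
  then have "(d - 1) * ((d - 2) * Q i j k w) \<le> (d - 1) * N i j w - 2 * ((part 2 w - part 1 w) / (d * (d + 1)))"
    unfolding N by (simp add: algebra_simps)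
  also have "\<dots> = (d - 1) * ((part 1 w) / (d * (d - 1)) + part 2 w / (d * (d + 1)))"
    unfolding N_distinct[OF assms(1)] d_def[symmetric]
    using d by (simp add: divide_simps) (simp add: power2_eq_square algebra_simps)
  finally have "(d - 2) * Q i j k w \<le> part 1 w / (d * (d - 1)) + part 2 w / (d * (d + 1))"
    using d by simp
  also have "\<dots> \<le> (d - 2) * (2 / (d * (d + 1)) * part 1 w + 2 / (3 * d * (d - 1)) * part 2 w)"
  proof -
    \<comment> \<open>This product is the gap between the symmetric coefficients; it closes at d =
      3, the smallest dimension with three distinct indices.\<close>
    have "(2 * d - 1) * (d - 3) \<ge> 0" using d by simp
    then have "d * (d * 2) \<ge> d * 7 - 3" by (simp add: algebra_simps)
    then have "1 / (d * (d - 1)) \<le> (d - 2) * (2 / (d * (d + 1)))" "1 / (d * (d + 1)) \<le> (d - 2) * (2 / (3 * d * (d - 1)))"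
      using d by (simp_all add: divide_simps) (simp_all add: algebra_simps)
    from add_mono[OF mult_right_mono[OF this(1) part_nonneg[of 1 w]] mult_right_mono[OF this(2) part_nonneg[of 2 w]]]
    show ?thesis by (simp add: algebra_simps)
  qed
  finally show ?thesis using d unfolding d_def by simp
qed

text \<open>The coefficients are 1/d_+ and 1/(3 d_-). The case k = j follows from k = i by
  exchanging A and B.\<close>

lemma Q_bound:
  assumes "CARD('n) \<ge> 2"
  shows "Q i j k w \<le> 2 / (real CARD('n) * (real CARD('n) + 1)) * part 1 w
    + 2 / (3 * real CARD('n) * (real CARD('n) - 1)) * part 2 w"
proof -
  consider "i = j" | "i \<noteq> j" "k = i" | "i \<noteq> j" "k = j" | "i \<noteq> j" "k \<noteq> i" "k \<noteq> j" by blast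
  then show ?thesis
  proof cases
    case 1
    have "0 \<le> 2 / (3 * real CARD('n) * (real CARD('n) - 1)) * part 2 w"
      using assms by (intro mult_nonneg_nonneg divide_nonneg_nonneg part_nonneg) auto
    then show ?thesis using Q_iij_bound[of i k w] unfolding 1 by linarith
  next
    case 2
    then show ?thesis using Q_iji_bound[OF assms, of i j w] by simp
  next
    case 3
    then show ?thesis
      using Q_iji_bound[OF assms, of j i "\<lambda>a b. w b a"] unfolding part_swap[of _ w] Q_swap[of j i j w] by auto
  next
    case 4
    then show ?thesis by (rule Q_ijk_bound)
  qed
qed

end

section \<open>Positive semidefinite matrices\<close>

lemma cinner_matrix: "cinner v (M *v w) = (\<Sum>i\<in>UNIV. \<Sum>j\<in>UNIV. cnj (v $ i) * M $ i $ j * w $ j)"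
  by (simp add: cinner_def matrix_vector_mult_def sum_distrib_left mult_ac)

lemma ketbra_nth [simp]: "ketbra v w $ i $ j = v $ i * cnj (w $ j)"
  by (simp add: ketbra_def)

lemma cinner_ketbra: "cinner v (ketbra x y *v w) = cinner v x * cinner y w"
  unfolding cinner_matrix unfolding cinner_def sum_product by (simp add: mult_ac)

lemma cinner_commute: "cinner v w = cnj (cinner w v)"
  by (simp add: cinner_def mult_ac)

lemma psd_ketbra: "psd (ketbra x x)"
proof -
  have "cinner v (ketbra x x *v v) = complex_of_real ((norm (cinner v x))\<^sup>2)" for v
    unfolding cinner_ketbra complex_norm_square using cinner_commute[of x v] by simp
  then show ?thesis by (simp add: psd_def)
qed

lemma cinner_add_right: "cinner v (x + y) = cinner v x + cinner v y"
  by (simp add: cinner_def sum.distrib algebra_simps)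

lemma psd_0: "psd 0"
  by (simp add: psd_def cinner_def)

lemma psd_add: "psd M \<Longrightarrow> psd N \<Longrightarrow> psd (M + N)"
  by (auto simp: psd_def matrix_vector_mult_add_rdistrib cinner_add_right)

lemma psd_sum: "(\<And>i. i \<in> I \<Longrightarrow> psd (f i)) \<Longrightarrow> psd (sum f I)"
  by (induction I rule: infinite_finite_induct) (auto simp: psd_0 psd_add)

lemma psd_scaleR: "psd M \<Longrightarrow> 0 \<le> c \<Longrightarrow> psd (c *\<^sub>R M)"
proof -
  have "cinner v ((c *\<^sub>R M) *v v) = of_real c * cinner v (M *v v)" for v
  proof -
    have "(c *\<^sub>R M) $ i $ j = of_real c * M $ i $ j" for i j
      by (simp only: vector_scaleR_component scaleR_conv_of_real[of c "M $ i $ j"])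
    then show ?thesis unfolding cinner_matrix sum_distrib_left by (simp add: mult_ac)
  qed
  then show "psd M \<Longrightarrow> 0 \<le> c \<Longrightarrow> psd (c *\<^sub>R M)" by (auto simp: psd_def)
qed

lemma psd_diag:
  assumes "psd M"
  shows "M $ i $ i = of_real (Re (M $ i $ i))" "0 \<le> Re (M $ i $ i)"
proof -
  have "cinner (axis i 1) (M *v axis i 1) = M $ i $ i"
    unfolding cinner_matrix axis_def
    by (simp add: if_distrib[of "\<lambda>x. _ * x"] if_distrib[of "\<lambda>x. x * _"] if_distrib[of cnj] cong: if_cong)
  then have "M $ i $ i \<in> \<real>" "0 \<le> Re (M $ i $ i)"
    using assms unfolding psd_def by metis+
  then show "M $ i $ i = of_real (Re (M $ i $ i))" "0 \<le> Re (M $ i $ i)" by (simp_all add: of_real_Re)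
qed

lemma cinner_two:
  assumes "i \<noteq> j"
  shows "cinner (x *s axis i 1 + y *s axis j 1) (M *v (x *s axis i 1 + y *s axis j 1))
    = cnj x * x * M $ i $ i + cnj x * y * M $ i $ j + cnj y * x * M $ j $ i + cnj y * y * M $ j $ j"
proof -
  have v: "(x *s axis i 1 + y *s axis j 1) $ p = (if p = i then x else 0) + (if p = j then y else 0)" for p
    by (auto simp: axis_def)
  have s: "(\<Sum>p\<in>UNIV. ((if p = i then x' else 0) + (if p = j then y' else 0)) * g p) = x' * g i + y' * g j" for g and x' y' :: complex
    by (simp add: distrib_right sum.distrib if_distrib[of "\<lambda>x. x * _"] cong: if_cong)
  show ?thesis
    unfolding cinner_matrix
  proof -
    have "(\<Sum>p\<in>UNIV. \<Sum>q\<in>UNIV. cnj ((x *s axis i 1 + y *s axis j 1) $ p) * M $ p $ q * (x *s axis i 1 + y *s axis j 1) $ q)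
      = (\<Sum>p\<in>UNIV. ((if p = i then cnj x else 0) + (if p = j then cnj y else 0)) * (\<Sum>q\<in>UNIV. ((if q = i then x else 0) + (if q = j then y else 0)) * M $ p $ q))"
      unfolding v sum_distrib_left by (intro sum.cong refl) (auto simp: algebra_simps)
    then show "(\<Sum>p\<in>UNIV. \<Sum>q\<in>UNIV. cnj ((x *s axis i 1 + y *s axis j 1) $ p) * M $ p $ q * (x *s axis i 1 + y *s axis j 1) $ q)
      = cnj x * x * M $ i $ i + cnj x * y * M $ i $ j + cnj y * x * M $ j $ i + cnj y * y * M $ j $ j"
      unfolding s by (simp add: algebra_simps)
  qed
qed

text \<open>Polarization: the form is real at e_i + e_j and at e_i + \<i> e_j, which fixes the
  imaginary and the real parts respectively.\<close>

lemma psd_hermitian: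
  assumes "psd M"
  shows "M $ j $ i = cnj (M $ i $ j)"
proof (cases "i = j")
  case True
  then show ?thesis using psd_diag(1)[OF assms, of i] by (metis complex_cnj_complex_of_real)
next
  case False
  have re: "cnj x * x * M $ i $ i + cnj x * y * M $ i $ j + cnj y * x * M $ j $ i + cnj y * y * M $ j $ j \<in> \<real>" for x y
    using assms unfolding psd_def cinner_two[OF False, symmetric] by blast
  have im: "Im (M $ i $ i) = 0" "Im (M $ j $ j) = 0"
    using psd_diag(1)[OF assms] by (metis Im_complex_of_real)+
  show ?thesis
    using re[of 1 1] re[of 1 \<i>] im by (simp add: complex_is_Real_iff complex_eq_iff)
qed

text \<open>Nonnegativity of the principal 2 by 2 minor, obtained by testing the form on the span of
  e_i and e_j.\<close>

lemma psd_offdiag: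
  assumes "psd M"
  shows "(norm (M $ i $ j))\<^sup>2 \<le> Re (M $ i $ i) * Re (M $ j $ j)"
proof (cases "i = j")
  case True
  have "norm (M $ i $ i) = Re (M $ i $ i)"
    by (subst psd_diag(1)[OF assms]) (simp add: psd_diag(2)[OF assms])
  then show ?thesis using True by (simp add: power2_eq_square)
next
  case False
  define a b c where "a = Re (M $ i $ i)" and "b = Re (M $ j $ j)" and "c = M $ i $ j"
  have M: "M $ i $ i = of_real a" "M $ j $ j = of_real b" "M $ j $ i = cnj c"
    unfolding a_def b_def c_def
    by (rule psd_diag(1)[OF assms] psd_hermitian[OF assms])+
  have ab: "0 \<le> a" "0 \<le> b" unfolding a_def b_def by (rule psd_diag(2)[OF assms])+
  have nn: "0 \<le> Re (cnj x * x * M $ i $ i + cnj x * y * M $ i $ j + cnj y * x * M $ j $ i + cnj y * y * M $ j $ j)" for x y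
    using assms unfolding psd_def cinner_two[OF False, symmetric] by blast
  \<comment> \<open>The factor c in the test vector aligns the phases. The choice t = b, s = |c|^2
    gives the minor when b is positive; b = 0 forces c = 0.\<close>
  have form: "0 \<le> a * t\<^sup>2 * (norm c)\<^sup>2 - 2 * t * s * (norm c)\<^sup>2 + b * s\<^sup>2" for t s :: real
    using nn[of "- of_real t * c" "of_real s"] unfolding M c_def[symmetric]
    by (simp add: cmod_power2) (simp add: power2_eq_square algebra_simps)
  show ?thesis
  proof (cases "a = 0 \<and> b = 0")
    case True
    then show ?thesis using form[of 1 1] unfolding a_def[symmetric] b_def[symmetric] c_def[symmetric] by simp
  next
    case False
    show ?thesis
    proof (cases "b = 0")
      case True
      have "0 \<le> a * (norm c)\<^sup>2 - 2 * (a + 1) * (norm c)\<^sup>2" using form[of 1 "a + 1"] True by simp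
      then have "(a + 2) * (norm c)\<^sup>2 \<le> 0" by (simp add: algebra_simps)
      then have "(norm c)\<^sup>2 \<le> 0" using ab by (simp add: mult_le_0_iff)
      then show ?thesis using True unfolding a_def[symmetric] b_def[symmetric] c_def[symmetric] by simp
    next
      case False
      have "0 \<le> a * b\<^sup>2 * (norm c)\<^sup>2 - 2 * b * (norm c)\<^sup>2 * (norm c)\<^sup>2 + b * ((norm c)\<^sup>2)\<^sup>2"
        using form[of b "(norm c)\<^sup>2"] by simp
      also have "\<dots> = b * (norm c)\<^sup>2 * (a * b - (norm c)\<^sup>2)"
        by (simp add: power2_eq_square algebra_simps)
      finally have "0 \<le> b * (norm c)\<^sup>2 * (a * b - (norm c)\<^sup>2)" .
      then have "(norm c)\<^sup>2 \<le> a * b \<or> norm c = 0"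
        using False ab by (auto simp: zero_le_mult_iff mult_le_0_iff)
      then show ?thesis using ab unfolding a_def[symmetric] b_def[symmetric] c_def[symmetric] by auto
    qed
  qed
qed

text \<open>Induction on the number of nonzero rows: subtracting \<open>M e\<^sub>a e\<^sub>a\<^sup>* M / M\<^sub>a\<^sub>a\<close> leaves the Schur complement.\<close>

lemma psd_gram:
  assumes "psd (M :: complex^'m^'m)"
  obtains rs where "M = (\<Sum>r\<leftarrow>rs. ketbra r r)"
proof -
  have "\<exists>rs. M = (\<Sum>r\<leftarrow>rs. ketbra r r)" if "psd M" "card {i. M $ i $ i \<noteq> 0} = n" for n and M :: "complex^'m^'m"
    using that
  proof (induction n arbitrary: M rule: less_induct)
    case (less n)
    show ?case
    proof (cases "\<exists>a. M $ a $ a \<noteq> 0")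
      case False
      then have "M $ i $ j = 0" for i j
        using psd_offdiag[OF less.prems(1), of i j] by simp
      then show ?thesis by (intro exI[of _ "[]"]) (simp add: vec_eq_iff)
    next
      case True
      then obtain a where a: "M $ a $ a \<noteq> 0" by blast
      define m where "m = Re (M $ a $ a)"
      have Maa: "M $ a $ a = of_real m" unfolding m_def by (rule psd_diag(1)[OF less.prems(1)])
      have "m \<noteq> 0" using a Maa by auto
      then have m: "m > 0" using psd_diag(2)[OF less.prems(1), of a] unfolding m_def by linarith
      define r where "r = (\<chi> i. M $ i $ a / of_real (sqrt m))"
      define M' where "M' = M - ketbra r r"
      have sq: "complex_of_real (sqrt m) * of_real (sqrt m) = of_real m"
        using m by (metis of_real_mult real_sqrt_mult_self abs_of_pos)
      have M': "M' $ i $ j = M $ i $ j - M $ i $ a * M $ a $ j / of_real m" for i j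
        unfolding M'_def r_def using sq psd_hermitian[OF less.prems(1), of a j] by simp
      have "psd M'"
        unfolding psd_def
      proof
        fix v
        define s where "s = (\<Sum>j\<in>UNIV. M $ a $ j * v $ j)"
        \<comment> \<open>Shifting entry a makes M w vanish there, so the form of M at w equals the
          form of the complement \<open>M'\<close> at v.\<close>
        define w where "w = v - (s / of_real m) *s axis a 1"
        have s': "(\<Sum>i\<in>UNIV. cnj (v $ i) * M $ i $ a) = cnj s"
          unfolding s_def by (simp add: psd_hermitian[OF less.prems(1), of _ a] mult.commute)
        have w: "w $ i = v $ i - (if i = a then s / of_real m else 0)" for i
          by (simp add: w_def axis_def)
        have Mw: "(\<Sum>j\<in>UNIV. M $ i $ j * w $ j) = (\<Sum>j\<in>UNIV. M $ i $ j * v $ j) - M $ i $ a * s / of_real m" for i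
          unfolding w by (simp add: right_diff_distrib sum_subtractf if_distrib[of "\<lambda>x. _ * x"] cong: if_cong)
        have "(\<Sum>j\<in>UNIV. M $ a $ j * w $ j) = 0"
          using m by (simp add: Mw Maa s_def)
        moreover have "cinner w (M *v w) = (\<Sum>i\<in>UNIV. cnj (v $ i) * (\<Sum>j\<in>UNIV. M $ i $ j * w $ j))
            - cnj (s / of_real m) * (\<Sum>j\<in>UNIV. M $ a $ j * w $ j)"
        proof -
          have "cinner w (M *v w) = (\<Sum>i\<in>UNIV. cnj (w $ i) * (\<Sum>j\<in>UNIV. M $ i $ j * w $ j))"
            unfolding cinner_matrix sum_distrib_left by (simp add: mult_ac)
          also have "\<dots> = (\<Sum>i\<in>UNIV. cnj (v $ i) * (\<Sum>j\<in>UNIV. M $ i $ j * w $ j))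
              - (\<Sum>i\<in>UNIV. if i = a then cnj (s / of_real m) * (\<Sum>j\<in>UNIV. M $ a $ j * w $ j) else 0)"
            unfolding w[of i for i] sum_subtractf[symmetric]
            by (intro sum.cong refl) (auto simp: left_diff_distrib)
          finally show ?thesis by simp
        qed
        ultimately have "cinner w (M *v w)
            = (\<Sum>i\<in>UNIV. cnj (v $ i) * ((\<Sum>j\<in>UNIV. M $ i $ j * v $ j) - M $ i $ a * s / of_real m))"
          by (simp only: Mw) simp
        also have "\<dots> = cinner v (M *v v) - cnj s * s / of_real m"
        proof -
          have "(\<Sum>i\<in>UNIV. cnj (v $ i) * ((\<Sum>j\<in>UNIV. M $ i $ j * v $ j) - M $ i $ a * s / of_real m))
              = (\<Sum>i\<in>UNIV. cnj (v $ i) * (\<Sum>j\<in>UNIV. M $ i $ j * v $ j)) - (\<Sum>i\<in>UNIV. cnj (v $ i) * M $ i $ a) * (s / of_real m)"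
            unfolding right_diff_distrib sum_subtractf sum_distrib_right by (simp add: mult_ac)
          then show ?thesis unfolding s' cinner_matrix sum_distrib_left by (simp add: mult_ac)
        qed
        also have "cinner v (M *v v) - cnj s * s / of_real m = cinner v (M' *v v)"
        proof -
          have "cinner v (M' *v v) = cinner v (M *v v) - (\<Sum>i\<in>UNIV. \<Sum>j\<in>UNIV. (cnj (v $ i) * M $ i $ a) * (M $ a $ j * v $ j)) / of_real m"
            unfolding cinner_matrix M' sum_divide_distrib sum_subtractf[symmetric] by (simp add: algebra_simps)
          also have "(\<Sum>i\<in>UNIV. \<Sum>j\<in>UNIV. (cnj (v $ i) * M $ i $ a) * (M $ a $ j * v $ j)) = cnj s * s"
            unfolding sum_product[symmetric] s' s_def ..
          finally show ?thesis by simp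
        qed
        finally have "cinner w (M *v w) = cinner v (M' *v v)" by simp
        then show "cinner v (M' *v v) \<in> \<real> \<and> 0 \<le> Re (cinner v (M' *v v))"
          using less.prems(1) unfolding psd_def by metis
      qed
      moreover have "card {i. M' $ i $ i \<noteq> 0} < n"
        unfolding less.prems(2)[symmetric]
      proof (rule psubset_card_mono)
        have "M' $ a $ a = 0" using m by (simp add: M' Maa)
        moreover have "M' $ i $ i = 0" if "M $ i $ i = 0" for i
          using psd_offdiag[OF less.prems(1), of i a] that by (simp add: M')
        ultimately show "{i. M' $ i $ i \<noteq> 0} \<subset> {i. M $ i $ i \<noteq> 0}" using a by blast
      qed simp
      ultimately obtain rs where "M' = (\<Sum>r\<leftarrow>rs. ketbra r r)" using less.IH by blast
      then have "M = (\<Sum>r\<leftarrow>r # rs. ketbra r r)" by (simp add: M'_def diff_eq_eq add.commute)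
      then show ?thesis by blast
    qed
  qed
  then show ?thesis using assms that by blast
qed

section \<open>The fidelity of an arbitrary instrument\<close>

definition comp3 :: "complex^(('n::finite \<times> 'n) \<times> 'n) \<Rightarrow> 'n \<Rightarrow> 'n \<Rightarrow> 'n \<Rightarrow> complex"
  where "comp3 v a b c = v $ ((a, b), c)"

text \<open>Columns i and j are conjugated on A and B because of the transposition in
  \<open>replicated\<close>; column k on C is not.\<close>

definition phi :: "complex^'n::finite^'n \<Rightarrow> 'n \<Rightarrow> 'n \<Rightarrow> 'n \<Rightarrow> complex^(('n \<times> 'n) \<times> 'n)"
  where "phi U i j k = (\<chi> p. cnj (U $ fst (fst p) $ i) * cnj (U $ snd (fst p) $ j) * U $ snd p $ k)"

lemma sum_UNIV_pair: "(\<Sum>p\<in>(UNIV :: ('a::finite \<times> 'b::finite) set). f p) = (\<Sum>a\<in>UNIV. \<Sum>b\<in>UNIV. f (a, b))"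
  by (simp add: sum.cartesian_product flip: UNIV_Times_UNIV)

lemma cinner_phi: "cinner (phi U i j k) v = amp U i j k (comp3 v)"
  by (simp add: cinner_def sum_UNIV_pair phi_def amp_def comp3_def mult_ac)

lemma kron_nth [simp]: "kron M N $ (p, e) $ (q, f) = M $ p $ q * N $ e $ f"
  by (simp add: kron_def)

lemma sandwich_nth [simp]: "sandwich k M $ p $ q = M $ (p, k) $ (q, k)"
  by (simp add: sandwich_def)

lemma mat_1_nth: "(mat 1 :: complex^'n^'n) $ i $ j = (if i = j then 1 else 0)"
  by (simp add: mat_def)

lemma on_C_mult:
  fixes V :: "complex^'n::finite^'n"
  shows "(on_C V ** M) $ ((p, c), e) $ q = (\<Sum>c'\<in>UNIV. V $ c $ c' * M $ ((p, c'), e) $ q)"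
proof -
  have "(on_C V ** M) $ ((p, c), e) $ q
      = (\<Sum>p'\<in>UNIV. \<Sum>c'\<in>UNIV. \<Sum>e'\<in>UNIV. if e = e' then if p = p' then V $ c $ c' * M $ ((p, c'), e) $ q else 0 else 0)"
    unfolding matrix_matrix_mult_def on_C_def vec_lambda_beta
      sum_UNIV_pair[where 'a="('n \<times> 'n) \<times> 'n" and 'b='n] sum_UNIV_pair[where 'a="'n \<times> 'n" and 'b='n]
    by (intro sum.cong refl) (auto simp: mat_1_nth)
  also have "\<dots> = (\<Sum>c'\<in>UNIV. V $ c $ c' * M $ ((p, c'), e) $ q)"
    by (subst sum.swap) simp
  finally show ?thesis .
qed


lemma mult_on_C:
  fixes V :: "complex^'n::finite^'n"
  shows "(M ** on_C V) $ q $ ((p, c), e) = (\<Sum>c'\<in>UNIV. M $ q $ ((p, c'), e) * V $ c' $ c)"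
proof -
  have "(M ** on_C V) $ q $ ((p, c), e)
      = (\<Sum>p'\<in>UNIV. \<Sum>c'\<in>UNIV. \<Sum>e'\<in>UNIV. if e' = e then if p' = p then M $ q $ ((p, c'), e) * V $ c' $ c else 0 else 0)"
    unfolding matrix_matrix_mult_def on_C_def vec_lambda_beta
      sum_UNIV_pair[where 'a="('n \<times> 'n) \<times> 'n" and 'b='n] sum_UNIV_pair[where 'a="'n \<times> 'n" and 'b='n]
    by (intro sum.cong refl) (auto simp: mat_1_nth)
  also have "\<dots> = (\<Sum>c'\<in>UNIV. M $ q $ ((p, c'), e) * V $ c' $ c)"
    by (subst sum.swap) simp
  finally show ?thesis .
qed

lemma vN_nth: "vN U i $ a $ b = U $ a $ i * cnj (U $ b $ i)"
proof -
  have "(U ** ketbra (axis i 1) (axis i 1)) $ a $ k = (if k = i then U $ a $ i else 0)" for k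
    by (simp add: matrix_matrix_mult_def axis_def if_distrib[of "\<lambda>x. x * _"] if_distrib[of "\<lambda>x. _ * x"]
        if_distrib[of cnj] cong: if_cong)
  then show ?thesis
    unfolding vN_def matrix_matrix_mult_def[of "U ** _"]
    by (simp add: if_distrib[of "\<lambda>x. x * _"] cong: if_cong)
qed

text \<open>The fidelity integrand sees only the diagonal blocks of D, and each block only through
  its expectation in a product vector.\<close>

lemma trace_replicated:
  "trace (replicated R U i j ** kron (vN U i) (vN U j))
    = (\<Sum>k\<in>UNIV. cinner (phi U i j k) (sandwich k (R i j) *v phi U i j k))"
proof -
  let ?u = "\<lambda>p::'a \<times> 'a. U $ fst p $ i * U $ snd p $ j"
  have rep: "replicated R U i j $ q $ p
      = (\<Sum>k\<in>UNIV. \<Sum>c\<in>UNIV. \<Sum>c'\<in>UNIV. cnj (U $ c $ k) * R i j $ ((p, c), k) $ ((q, c'), k) * U $ c' $ k)" for p q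
  proof -
    have "(on_C (cadj U) ** R i j ** on_C U) $ ((p, k), k) $ ((q, k), k)
        = (\<Sum>c\<in>UNIV. \<Sum>c'\<in>UNIV. cnj (U $ c $ k) * R i j $ ((p, c), k) $ ((q, c'), k) * U $ c' $ k)" for k
      unfolding mult_on_C on_C_mult sum_distrib_right cadj_nth by (rule sum.swap)
    then show ?thesis
      unfolding replicated_def by (simp add: Finite_Cartesian_Product.transpose_def sum_component)
  qed
  have kr: "kron (vN U i) (vN U j) $ p $ q = ?u p * cnj (?u q)" for p q
    by (simp add: kron_def vN_nth mult_ac)
  have "trace (replicated R U i j ** kron (vN U i) (vN U j))
      = (\<Sum>q\<in>UNIV. \<Sum>p\<in>UNIV. \<Sum>k\<in>UNIV. \<Sum>c\<in>UNIV. \<Sum>c'\<in>UNIV.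
          ?u p * cnj (U $ c $ k) * R i j $ ((p, c), k) $ ((q, c'), k) * (cnj (?u q) * U $ c' $ k))"
    unfolding trace_def matrix_matrix_mult_def vec_lambda_beta rep kr sum_distrib_right
    by (simp add: mult_ac)
  also have "\<dots> = (\<Sum>k\<in>UNIV. \<Sum>q\<in>UNIV. \<Sum>p\<in>UNIV. \<Sum>c\<in>UNIV. \<Sum>c'\<in>UNIV.
          ?u p * cnj (U $ c $ k) * R i j $ ((p, c), k) $ ((q, c'), k) * (cnj (?u q) * U $ c' $ k))"
    by (rule sum_rotate3)
  also have "\<dots> = (\<Sum>k\<in>UNIV. \<Sum>p\<in>UNIV. \<Sum>c\<in>UNIV. \<Sum>q\<in>UNIV. \<Sum>c'\<in>UNIV.
          ?u p * cnj (U $ c $ k) * R i j $ ((p, c), k) $ ((q, c'), k) * (cnj (?u q) * U $ c' $ k))"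
    by (rule sum.cong[OF refl], rule sum_rotate3[symmetric])
  also have "\<dots> = (\<Sum>k\<in>UNIV. cinner (phi U i j k) (sandwich k (R i j) *v phi U i j k))"
    unfolding cinner_matrix sum_UNIV_pair[where 'a="'a \<times> 'a" and 'b='a] sandwich_nth
    by (simp add: phi_def mult_ac)
  finally show ?thesis .
qed

lemma psd_sandwich:
  assumes "psd M"
  shows "psd (sandwich k M)"
proof -
  have "cinner v (sandwich k M *v v) = cinner (\<chi> p. if snd p = k then v $ fst p else 0) (M *v (\<chi> p. if snd p = k then v $ fst p else 0))" for v
  proof -
    have "(\<Sum>p\<in>UNIV. \<Sum>e\<in>UNIV. \<Sum>q\<in>UNIV. \<Sum>f\<in>UNIV. cnj (if e = k then v $ p else 0) * M $ (p, e) $ (q, f) * (if f = k then v $ q else 0))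
      = (\<Sum>p\<in>UNIV. \<Sum>e\<in>UNIV. if e = k then \<Sum>q\<in>UNIV. \<Sum>f\<in>UNIV. if f = k then cnj (v $ p) * M $ (p, k) $ (q, k) * v $ q else 0 else 0)"
      by (intro sum.cong refl) (auto simp: if_distrib[of "\<lambda>x. _ * x"] cong: if_cong)
    also have "\<dots> = (\<Sum>p\<in>UNIV. \<Sum>q\<in>UNIV. cnj (v $ p) * M $ (p, k) $ (q, k) * v $ q)"
      by simp
    finally show ?thesis
      by (simp only: cinner_matrix sum_UNIV_pair vec_lambda_beta fst_conv snd_conv sandwich_nth)
  qed
  then show ?thesis using assms unfolding psd_def by simp
qed

text \<open>The real part of the trace of M against \<open>kron (P_sgn s) (mat 1)\<close>, written
  in entries.\<close>

definition sym_trace :: "2 \<Rightarrow> complex^(('n::finite \<times> 'n) \<times> 'n)^(('n \<times> 'n) \<times> 'n) \<Rightarrow> real"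
  where "sym_trace s M = (\<Sum>a\<in>UNIV. \<Sum>b\<in>UNIV. \<Sum>c\<in>UNIV.
    (Re (M $ ((a, b), c) $ ((a, b), c)) + sgnval s * Re (M $ ((a, b), c) $ ((b, a), c))) / 2)"

lemma sym_trace_add: "sym_trace s (M + N) = sym_trace s M + sym_trace s N"
  unfolding sym_trace_def sum.distrib[symmetric] by (simp add: algebra_simps add_divide_distrib)

lemma sym_trace_0: "sym_trace s 0 = 0"
  by (simp add: sym_trace_def)

lemma sym_trace_sum: "sym_trace s (\<Sum>i\<in>I. f i) = (\<Sum>i\<in>I. sym_trace s (f i))"
  by (induction I rule: infinite_finite_induct) (auto simp: sym_trace_0 sym_trace_add)

lemma sym_trace_ketbra: "sym_trace s (ketbra r r) = part s (comp3 r)"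
proof -
  let ?w = "comp3 r"
  have "part s ?w = (\<Sum>a\<in>UNIV. \<Sum>b\<in>UNIV. \<Sum>c\<in>UNIV. ((norm (?w a b c))\<^sup>2 + sgnval s * Re (?w a b c * cnj (?w b a c))) / 4
      + ((norm (?w b a c))\<^sup>2 + sgnval s * Re (?w b a c * cnj (?w a b c))) / 4)"
    unfolding part_def sum_divide_distrib
  proof (intro sum.cong refl)
    fix a b c
    have "(norm (of_real (sgnval s) * z))\<^sup>2 = (norm z)\<^sup>2" for z :: complex
      by (simp add: sgnval_def norm_mult)
    then show "(norm (?w a b c + of_real (sgnval s) * ?w b a c))\<^sup>2 / 4
        = ((norm (?w a b c))\<^sup>2 + sgnval s * Re (?w a b c * cnj (?w b a c))) / 4
      + ((norm (?w b a c))\<^sup>2 + sgnval s * Re (?w b a c * cnj (?w a b c))) / 4"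
      unfolding norm_sq_add by (simp only:) (simp add: field_simps)
  qed
  also have "\<dots> = (\<Sum>a\<in>UNIV. \<Sum>b\<in>UNIV. \<Sum>c\<in>UNIV. ((norm (?w a b c))\<^sup>2 + sgnval s * Re (?w a b c * cnj (?w b a c))) / 4)
      + (\<Sum>a\<in>UNIV. \<Sum>b\<in>UNIV. \<Sum>c\<in>UNIV. ((norm (?w b a c))\<^sup>2 + sgnval s * Re (?w b a c * cnj (?w a b c))) / 4)"
    by (simp only: sum.distrib)
  also have "(\<Sum>a\<in>UNIV. \<Sum>b\<in>UNIV. \<Sum>c\<in>UNIV. ((norm (?w b a c))\<^sup>2 + sgnval s * Re (?w b a c * cnj (?w a b c))) / 4)
      = (\<Sum>a\<in>UNIV. \<Sum>b\<in>UNIV. \<Sum>c\<in>UNIV. ((norm (?w a b c))\<^sup>2 + sgnval s * Re (?w a b c * cnj (?w b a c))) / 4)"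
    by (rule sum.swap)
  also have "(\<Sum>a\<in>UNIV. \<Sum>b\<in>UNIV. \<Sum>c\<in>UNIV. ((norm (?w a b c))\<^sup>2 + sgnval s * Re (?w a b c * cnj (?w b a c))) / 4) + \<dots>
      = (\<Sum>a\<in>UNIV. \<Sum>b\<in>UNIV. \<Sum>c\<in>UNIV. ((norm (?w a b c))\<^sup>2 + sgnval s * Re (?w a b c * cnj (?w b a c))) / 2)"
    unfolding sum.distrib[symmetric] by simp
  also have "\<dots> = sym_trace s (ketbra r r)"
  proof -
    have "Re (z * cnj z) = (norm z)\<^sup>2" for z
      by (simp flip: complex_norm_square)
    then show ?thesis unfolding sym_trace_def ketbra_nth by (simp only: comp3_def)
  qed
  finally show ?thesis ..
qed

text \<open>The identity on C in the dual operator makes the trace depend only on the marginal on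
  AB, which the normalization prescribes; the value is d_+ or d_-.\<close>

lemma sym_trace_ptrace:
  assumes "ptrace S = mat 1"
  shows "sym_trace s (S :: complex^(('n::finite \<times> 'n) \<times> 'n)^(('n \<times> 'n) \<times> 'n))
    = real CARD('n) * (real CARD('n) + sgnval s) / 2"
proof -
  have S: "(\<Sum>c\<in>UNIV. S $ (p, c) $ (q, c)) = (if p = q then 1 else 0)" for p q
  proof -
    have "(\<Sum>c\<in>UNIV. S $ (p, c) $ (q, c)) = ptrace S $ p $ q"
      by (simp add: ptrace_def sum_component)
    then show ?thesis unfolding assms mat_1_nth .
  qed
  have "sym_trace s S = (\<Sum>a\<in>UNIV. \<Sum>b\<in>UNIV. (Re (\<Sum>c\<in>UNIV. S $ ((a, b), c) $ ((a, b), c))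
      + sgnval s * Re (\<Sum>c\<in>UNIV. S $ ((a, b), c) $ ((b, a), c))) / 2)"
    unfolding sym_trace_def by (simp add: sum.distrib sum_distrib_left flip: sum_divide_distrib)
  also have "\<dots> = (\<Sum>a\<in>(UNIV::'n set). \<Sum>b\<in>(UNIV::'n set). 1 / 2 + (if b = a then sgnval s / 2 else 0))"
    unfolding S by (intro sum.cong refl) auto
  also have "\<dots> = real CARD('n) * (real CARD('n) + sgnval s) / 2"
    by (simp add: sum.distrib algebra_simps add_divide_distrib)
  finally show ?thesis .
qed

lemma sandwich_sum: "sandwich k (\<Sum>i\<in>I. f i) = (\<Sum>i\<in>I. sandwich k (f i))"
  by (simp add: vec_eq_iff sum_component)

lemma sandwich_kron: "sandwich k (kron S (mat 1)) = S"
  by (simp add: vec_eq_iff mat_1_nth)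

context haar
begin

lemma avg_fidelity_eq:
  "avg_fidelity \<mu> R = (1 / (real CARD('n))\<^sup>2) * (\<Sum>i\<in>UNIV. \<Sum>j\<in>UNIV. \<Sum>k\<in>UNIV.
    E (\<lambda>U. Re (cinner (phi U i j k) (sandwich k (R i j) *v phi U i j k))))"
proof -
  have c: "continuous_on UNIV (\<lambda>U. Re (cinner (phi U i j k) (sandwich k (R i j) *v phi U i j k)))" for i j k
    unfolding cinner_matrix phi_def by (simp, intro continuous_intros)
  show ?thesis
    unfolding avg_fidelity_def trace_replicated Re_sum
    by (subst expectation_sum, rule c) (rule refl)
qed

text \<open>Both sides are additive in M, so a Gram decomposition reduces the claim to
  \<open>Q_bound\<close> for single vectors.\<close>

lemma expectation_bound:
  assumes "psd M" "CARD('n) \<ge> 2"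
  shows "E (\<lambda>U. Re (cinner (phi U i j k) (M *v phi U i j k)))
    \<le> 2 / (real CARD('n) * (real CARD('n) + 1)) * sym_trace 1 M
      + 2 / (3 * real CARD('n) * (real CARD('n) - 1)) * sym_trace 2 M"
proof -
  define y z where "y = 2 / (real CARD('n) * (real CARD('n) + 1))"
    and "z = 2 / (3 * real CARD('n) * (real CARD('n) - 1))"
  obtain rs where M: "M = (\<Sum>r\<leftarrow>rs. ketbra r r)" using psd_gram[OF assms(1)] .
  have int: "integrable \<mu> (\<lambda>U. Re (cinner (phi U i j k) (N *v phi U i j k)))" for N
    unfolding cinner_matrix phi_def by (rule integrable_continuous) (simp, intro continuous_intros)
  have "E (\<lambda>U. Re (cinner (phi U i j k) ((\<Sum>r\<leftarrow>rs. ketbra r r) *v phi U i j k)))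
      \<le> y * sym_trace 1 (\<Sum>r\<leftarrow>rs. ketbra r r) + z * sym_trace 2 (\<Sum>r\<leftarrow>rs. ketbra r r)"
  proof (induction rs)
    case Nil
    then show ?case by (simp add: sym_trace_0 cinner_def)
  next
    case (Cons r rs)
    have "Re (cinner (phi U i j k) (ketbra r r *v phi U i j k)) = (norm (amp U i j k (comp3 r)))\<^sup>2" for U :: "complex^'n^'n"
    proof -
      have "cinner (phi U i j k) (ketbra r r *v phi U i j k) = of_real ((norm (amp U i j k (comp3 r)))\<^sup>2)"
        unfolding cinner_ketbra complex_norm_square cinner_phi[symmetric]
        using cinner_commute[of r "phi U i j k"] by simp
      then show ?thesis by simp
    qed
    then have "E (\<lambda>U. Re (cinner (phi U i j k) (ketbra r r *v phi U i j k))) = Q i j k (comp3 r)"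
      by (simp add: Q_def)
    also have "\<dots> \<le> y * sym_trace 1 (ketbra r r) + z * sym_trace 2 (ketbra r r)"
      unfolding sym_trace_ketbra y_def z_def by (rule Q_bound[OF assms(2)])
    finally have "E (\<lambda>U. Re (cinner (phi U i j k) (ketbra r r *v phi U i j k)))
      + E (\<lambda>U. Re (cinner (phi U i j k) ((\<Sum>r\<leftarrow>rs. ketbra r r) *v phi U i j k)))
      \<le> y * sym_trace 1 (\<Sum>r\<leftarrow>r # rs. ketbra r r) + z * sym_trace 2 (\<Sum>r\<leftarrow>r # rs. ketbra r r)"
      using Cons by (simp add: sym_trace_add algebra_simps)
    then show ?case
      by (simp add: matrix_vector_mult_add_rdistrib cinner_add_right Bochner_Integration.integral_add int)
  qed
  then show ?thesis unfolding M[symmetric] y_def z_def .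
qed

text \<open>Weak duality: the bound on each term is summed and the normalization of the instrument
  evaluates the result.\<close>

theorem avg_fidelity_le:
  assumes "CARD('n) \<ge> 2" and R: "cloning_instrument (R :: 'n \<Rightarrow> 'n \<Rightarrow> 'n op_ABCD)"
  shows "avg_fidelity \<mu> R \<le> 4 / (3 * real CARD('n))"
proof -
  define d where "d = real CARD('n)"
  have d: "d \<ge> 2" using assms by (simp add: d_def)
  define y z where "y = 2 / (d * (d + 1))" and "z = 2 / (3 * d * (d - 1))"
  obtain S :: "'n op_ABC" where S: "(\<Sum>i\<in>UNIV. \<Sum>j\<in>UNIV. R i j) = kron S (mat 1)" "ptrace S = mat 1"
    using R unfolding cloning_instrument_def by blast
  \<comment> \<open>The sum of all \<open>R i j\<close> is the identity on D times S, so every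
    diagonal block k contributes the same S.\<close>
  have tr: "(\<Sum>i\<in>UNIV. \<Sum>j\<in>UNIV. sym_trace s (sandwich k (R i j))) = d * (d + sgnval s) / 2" for s k
    unfolding sym_trace_sum[symmetric] sandwich_sum[symmetric] S(1) sandwich_kron
    using sym_trace_ptrace[OF S(2)] by (simp add: d_def)
  have "(\<Sum>i\<in>UNIV. \<Sum>j\<in>UNIV. \<Sum>k\<in>UNIV. E (\<lambda>U. Re (cinner (phi U i j k) (sandwich k (R i j) *v phi U i j k))))
      \<le> (\<Sum>i\<in>UNIV. \<Sum>j\<in>UNIV. \<Sum>k\<in>UNIV. y * sym_trace 1 (sandwich k (R i j)) + z * sym_trace 2 (sandwich k (R i j)))"
    using R unfolding cloning_instrument_def y_def z_def d_def
    by (intro sum_mono expectation_bound psd_sandwich assms(1)) blast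
  also have "\<dots> = (\<Sum>k\<in>UNIV. \<Sum>i\<in>UNIV. \<Sum>j\<in>UNIV. y * sym_trace 1 (sandwich k (R i j)) + z * sym_trace 2 (sandwich k (R i j)))"
    by (rule sum_rotate3)
  also have "\<dots> = (\<Sum>k\<in>(UNIV::'n set). y * (d * (d + 1) / 2) + z * (d * (d - 1) / 2))"
    using tr[of 1] tr[of 2] by (simp only: sum.distrib sum_distrib_left[symmetric] sgnval_simps) simp
  \<comment> \<open>For each of the d values of k, y d_+ = 1 and z d_- = 1/3.\<close>
  also have "\<dots> = d * (4 / 3)"
    using d by (simp add: y_def z_def d_def[symmetric])
  finally show ?thesis
    using d unfolding avg_fidelity_eq d_def[symmetric] by (simp add: divide_simps power2_eq_square)
qed

end

section \<open>Symmetric instruments\<close>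

definition psi_norm :: "'n::finite itself \<Rightarrow> 2 \<Rightarrow> real"
  where "psi_norm _ a = 1 / sqrt (2 * (real CARD('n) + sgnval a))"

lemma sum_2: "(\<Sum>a\<in>(UNIV::2 set). f a) = f 1 + f 2"
  by (simp add: UNIV_2)

lemma two_cases: "a = 1 \<or> a = (2::2)"
  using exhaust_2 by blast

lemma Psi_nth:
  "Psi a (m::'n::finite) $ ((x, y), z) = of_real (psi_norm TYPE('n) a) *
    ((if x = z then if y = m then 1 else 0 else 0) + of_real (sgnval a) * (if y = z then if x = m then 1 else 0 else 0))"
proof -
  have 1: "(\<Sum>n\<in>UNIV. axis ((n, m), n) 1) $ ((x, y), z) = (if x = z then if y = m then 1 else (0::complex) else 0)"
  proof -
    have "(\<Sum>n\<in>UNIV. axis ((n, m), n) 1) $ ((x, y), z) = (\<Sum>n\<in>UNIV. if n = x then if x = z then if y = m then 1 else 0 else 0 else (0::complex))"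
      unfolding sum_component by (intro sum.cong refl) (auto simp: axis_def)
    then show ?thesis by simp
  qed
  have 2: "(\<Sum>n\<in>UNIV. axis ((m, n), n) 1) $ ((x, y), z) = (if y = z then if x = m then 1 else (0::complex) else 0)"
  proof -
    have "(\<Sum>n\<in>UNIV. axis ((m, n), n) 1) $ ((x, y), z) = (\<Sum>n\<in>UNIV. if n = y then if y = z then if x = m then 1 else 0 else 0 else (0::complex))"
      unfolding sum_component by (intro sum.cong refl) (auto simp: axis_def)
    then show ?thesis by simp
  qed
  show ?thesis
    unfolding Psi_def vector_scaleR_component vector_add_component 1 2 psi_norm_def
    by (simp only: scaleR_conv_of_real[where 'a=complex])
qed

lemma cinner_Psi:
  "cinner (Psi a m) v = of_real (psi_norm TYPE('n) a) * contr a (comp3 v) (m::'n::finite)"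
proof -
  have "cinner (Psi a m) v = (\<Sum>x\<in>UNIV. \<Sum>y\<in>UNIV. \<Sum>z\<in>UNIV.
      (if z = x then if y = m then of_real (psi_norm TYPE('n) a) * comp3 v x m x else 0 else 0)
      + (if z = y then if x = m then of_real (psi_norm TYPE('n) a) * of_real (sgnval a) * comp3 v m y y else 0 else 0))"
    unfolding cinner_def sum_UNIV_pair Psi_nth comp3_def by (intro sum.cong refl) (auto simp: algebra_simps)
  also have "\<dots> = (\<Sum>x\<in>UNIV. of_real (psi_norm TYPE('n) a) * comp3 v x m x)
      + (\<Sum>y\<in>UNIV. of_real (psi_norm TYPE('n) a) * of_real (sgnval a) * comp3 v m y y)"
  proof -
    have "(\<Sum>x\<in>UNIV. \<Sum>y\<in>UNIV. if x = m then f y else 0) = sum f UNIV" for f :: "'n \<Rightarrow> complex"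
      by (subst sum.swap) simp
    then show ?thesis by (simp add: sum.distrib)
  qed
  finally show ?thesis by (simp add: contr_def sum_distrib_left distrib_left mult_ac)
qed

lemma psi_norm_sq:
  assumes "CARD('n::finite) \<ge> 2"
  shows "psi_norm TYPE('n) a * psi_norm TYPE('n) a = 1 / (2 * (real CARD('n) + sgnval a))"
proof -
  have "2 * (real CARD('n) + sgnval a) > 0" using assms by (simp add: sgnval_def)
  then show ?thesis by (simp add: psi_norm_def)
qed

lemma P_sgn_nth: "P_sgn a $ (x, y) $ (x', y')
    = (of_bool (x = x' \<and> y = y') + of_real (sgnval a) * of_bool (x = y' \<and> y = x')) / 2"
proof -
  have half: "(1 / 2) *\<^sub>R w = w / 2" for w :: complex
    by (simp add: scaleR_conv_of_real)
  show ?thesis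
    unfolding P_sgn_def vector_scaleR_component half
    unfolding vector_add_component vector_scaleR_component mat_1_nth swap_AB_def vec_lambda_beta
      fst_conv snd_conv prod.inject of_bool_def scaleR_conv_of_real[where 'a=complex]
    by (rule refl)
qed

lemma cinner_P_sgn:
  "cinner v (kron (P_sgn a) (mat 1) *v v) = (\<Sum>x\<in>UNIV. \<Sum>y\<in>UNIV. \<Sum>z\<in>UNIV.
    cnj (comp3 v x y z) * (comp3 v x y z + of_real (sgnval a) * comp3 v y x z) / 2)"
proof -
  have "cinner v (kron (P_sgn a) (mat 1) *v v) = (\<Sum>x\<in>UNIV. \<Sum>y\<in>UNIV. \<Sum>z\<in>UNIV. \<Sum>x'\<in>UNIV. \<Sum>y'\<in>UNIV. \<Sum>z'\<in>UNIV.
      (if z' = z then if y' = y then if x' = x then cnj (comp3 v x y z) * comp3 v x y z / 2 else 0 else 0 else 0)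
      + (if z' = z then if y' = x then if x' = y then cnj (comp3 v x y z) * (of_real (sgnval a) * comp3 v y x z) / 2 else 0 else 0 else 0))"
    unfolding cinner_matrix sum_UNIV_pair kron_nth P_sgn_nth mat_1_nth comp3_def
    by (intro sum.cong refl) (auto simp: algebra_simps add_divide_distrib)
  then show ?thesis
    by (simp add: sum.distrib algebra_simps add_divide_distrib)
qed

lemma Re_cinner_P_sgn: "Re (cinner v (kron (P_sgn a) (mat 1) *v v)) = part a (comp3 v)"
  unfolding sym_trace_ketbra[symmetric] sym_trace_def cinner_P_sgn ketbra_nth Re_sum comp3_def
  by (intro sum.cong refl) (simp add: algebra_simps)

lemma cinner_sum_matrix: "cinner v (sum f I *v w) = (\<Sum>i\<in>I. cinner v (f i *v w))"
  by (induction I rule: infinite_finite_induct)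
    (auto simp: cinner_add_right matrix_vector_mult_add_rdistrib, auto simp: cinner_def)

lemma cinner_diff_matrix: "cinner v ((M - N) *v w) = cinner v (M *v w) - cinner v (N *v w)"
  unfolding cinner_matrix by (simp add: algebra_simps sum_subtractf)

lemma cinner_cscale: "cinner v (cscale c M *v w) = c * cinner v (M *v w)"
  unfolding cinner_matrix sum_distrib_left by (simp add: cscale_def mult_ac)

lemma psd_hermitianI:
  assumes "\<And>i j. M $ j $ i = cnj (M $ i $ j)" and "\<And>v. 0 \<le> Re (cinner v (M *v v))"
  shows "psd M"
proof -
  have "cinner v (M *v v) = cnj (cinner v (M *v v))" for v
  proof -
    have "cnj (cinner v (M *v v)) = (\<Sum>i\<in>UNIV. \<Sum>j\<in>UNIV. cnj (v $ j) * M $ j $ i * v $ i)"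
      unfolding cinner_matrix by (simp add: assms(1)[symmetric] mult_ac)
    then show ?thesis unfolding cinner_matrix by (subst (asm) sum.swap) simp
  qed
  then have "cinner v (M *v v) \<in> \<real>" for v by (metis Reals_cnj_iff)
  then show ?thesis using assms(2) by (simp add: psd_def)
qed

text \<open>Positivity is Bessel's inequality for the \<open>Psi\<close> vectors inside the
  (anti)symmetric subspace, that is \<open>contr_bound\<close>.\<close>

lemma psd_P_rest:
  assumes "CARD('n::finite) \<ge> 2"
  shows "psd (P_rest a :: 'n op_ABC)"
proof (rule psd_hermitianI)
  show "(P_rest a :: 'n op_ABC) $ q $ p = cnj (P_rest a $ p $ q)" for p q
  proof -
    have "kron (P_sgn a) (mat 1) $ q $ p = cnj (kron (P_sgn a) (mat 1) $ p $ (q :: ('n \<times> 'n) \<times> 'n))" for p q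
    proof -
      obtain x y z x' y' z' where pq: "p = ((x, y), z)" "q = ((x', y'), z')" by (metis surj_pair)
      have e1: "of_bool (x' = x \<and> y' = y) = (of_bool (x = x' \<and> y = y') :: complex)"
        and e2: "of_bool (x' = y \<and> y' = x) = (of_bool (x = y' \<and> y = x') :: complex)"
        by (rule arg_cong[of _ _ of_bool], blast)+
      have e3: "(if z' = z then 1 else 0) = (if z = z' then 1 else (0 :: complex))"
        by (rule if_cong) auto
      have c: "cnj (of_bool b) = of_bool b" "cnj (if b then 1 else 0) = (if b then 1 else 0)" for b
        by simp_all
      show ?thesis
        unfolding pq kron_nth P_sgn_nth mat_1_nth complex_cnj_mult complex_cnj_divide complex_cnj_add
          complex_cnj_complex_of_real complex_cnj_numeral c e1 e2 e3
        by (rule refl)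
    qed
    from this[where p=p and q=q] show ?thesis
      unfolding P_rest_def vector_minus_component sum_component ketbra_nth complex_cnj_diff cnj_sum
      by (simp only: complex_cnj_mult complex_cnj_cnj mult.commute)
  qed
next
  fix v :: "complex^(('n \<times> 'n) \<times> 'n)"
  have "cinner v (ketbra (Psi a m) (Psi a m) *v v) = of_real ((norm (contr a (comp3 v) m))\<^sup>2 / (2 * (real CARD('n) + sgnval a)))" for m
  proof -
    have "cinner v (ketbra (Psi a m) (Psi a m) *v v) = of_real ((norm (cinner (Psi a m) v))\<^sup>2)"
      unfolding cinner_ketbra complex_norm_square using cinner_commute[of v "Psi a m"] by (simp add: mult.commute)
    moreover have "(norm (cinner (Psi a m) v))\<^sup>2 = (psi_norm TYPE('n) a * psi_norm TYPE('n) a) * (norm (contr a (comp3 v) m))\<^sup>2"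
      unfolding cinner_Psi by (simp add: norm_mult power_mult_distrib) (simp add: power2_eq_square)
    ultimately show ?thesis unfolding psi_norm_sq[OF assms] by simp
  qed
  then have "Re (cinner v (P_rest a *v v)) = part a (comp3 v)
      - (\<Sum>m\<in>UNIV. (norm (contr a (comp3 v) m))\<^sup>2) / (2 * (real CARD('n) + sgnval a))"
    unfolding P_rest_def cinner_diff_matrix cinner_sum_matrix minus_complex.sel Re_cinner_P_sgn
    by (simp add: sum_divide_distrib)
  moreover have "2 * (real CARD('n) + sgnval a) > 0" using assms by (simp add: sgnval_def)
  then have "(\<Sum>m\<in>UNIV. (norm (contr a (comp3 v) m))\<^sup>2) / (2 * (real CARD('n) + sgnval a)) \<le> part a (comp3 v)"
    using contr_bound[of a "comp3 v"] by (subst pos_divide_le_eq) (simp_all only: mult.commute)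
  ultimately show "0 \<le> Re (cinner v (P_rest a *v v))" by linarith
qed

lemma cscale_of_real: "cscale (of_real c) M = c *\<^sub>R M"
proof -
  have "(c *\<^sub>R M) $ i $ j = of_real c * M $ i $ j" for i j
    by (simp only: vector_scaleR_component scaleR_conv_of_real[of c "M $ i $ j"])
  then show ?thesis by (simp add: vec_eq_iff cscale_def)
qed

section \<open>Operators attached to the classes and their partial traces\<close>

definition class_op :: "sset \<Rightarrow> cls \<Rightarrow> 'n::finite op_ABC"
  where "class_op s l =
    (\<Sum>a\<in>UNIV. \<Sum>b\<in>UNIV. cscale (s Alpha l $ a $ b) (\<Sum>m\<in>UNIV. ketbra (Psi a m) (Psi b m)))
    + cscale (s Beta l $ 1 $ 1) (P_rest 1) + cscale (s Gamma l $ 2 $ 2) (P_rest 2)"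

lemma sym_R'_eq: "sym_R' s (i::'n::finite) j k
    = (real CARD('n) / real (class_size TYPE('n) (class_of i j k))) *\<^sub>R class_op s (class_of i j k)"
  by (simp add: sym_R'_def class_op_def Let_def)

lemma mat2_nth [simp]: "mat2 a b c e $ 1 $ 1 = a" "mat2 a b c e $ 1 $ 2 = b"
  "mat2 a b c e $ 2 $ 1 = c" "mat2 a b c e $ 2 $ 2 = e"
  by (simp_all add: mat2_def)

text \<open>The \<alpha> part at v is a sum over m of the form of \<open>s Alpha l\<close> at the
  coordinates of v along the two vectors \<open>Psi 1 m\<close> and \<open>Psi 2 m\<close>.\<close>

lemma psd_class_op:
  assumes "CARD('n::finite) \<ge> 2" "symmetric_set TYPE('n) s"
  shows "psd (class_op s l :: 'n op_ABC)"
proof -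
  have "psd (\<Sum>a\<in>UNIV. \<Sum>b\<in>UNIV. cscale (s Alpha l $ a $ b) (\<Sum>m\<in>UNIV. ketbra (Psi a m) (Psi b m)) :: 'n op_ABC)"
  proof -
    have "cinner v ((\<Sum>a\<in>UNIV. \<Sum>b\<in>UNIV. cscale (s Alpha l $ a $ b) (\<Sum>m\<in>UNIV. ketbra (Psi a m) (Psi b m))) *v v)
        = (\<Sum>m\<in>UNIV. cinner (\<chi> a. cinner (Psi a m) v) (s Alpha l *v (\<chi> a. cinner (Psi a m) v)))"
      for v :: "complex^(('n \<times> 'n) \<times> 'n)"
    proof -
      have "cinner v ((\<Sum>a\<in>UNIV. \<Sum>b\<in>UNIV. cscale (s Alpha l $ a $ b) (\<Sum>m\<in>UNIV. ketbra (Psi a m) (Psi b m))) *v v)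
        = (\<Sum>a\<in>UNIV. \<Sum>b\<in>UNIV. \<Sum>m\<in>UNIV. cnj (cinner (Psi a m) v) * s Alpha l $ a $ b * cinner (Psi b m) v)"
        unfolding cinner_sum_matrix cinner_cscale cinner_ketbra sum_distrib_left cinner_commute[of v]
        by (simp add: mult_ac)
      also have "\<dots> = (\<Sum>m\<in>UNIV. \<Sum>a\<in>UNIV. \<Sum>b\<in>UNIV. cnj (cinner (Psi a m) v) * s Alpha l $ a $ b * cinner (Psi b m) v)"
        by (rule sum_rotate3)
      finally show ?thesis unfolding cinner_matrix[of "\<chi> a. cinner (Psi a m) v" for m] vec_lambda_beta .
    qed
    moreover have "psd (s Alpha l)" using assms(2) by (simp add: symmetric_set_def)
    ultimately show ?thesis unfolding psd_def by (auto intro: sum_nonneg)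
  qed
  moreover obtain b c where "0 \<le> b" "s Beta l = mat2 (of_real b) 0 0 0" "0 \<le> c" "s Gamma l = mat2 0 0 0 (of_real c)"
    using assms(2) unfolding symmetric_set_def by metis
  then have "psd (cscale (s Beta l $ 1 $ 1) (P_rest 1) :: 'n op_ABC)" "psd (cscale (s Gamma l $ 2 $ 2) (P_rest 2) :: 'n op_ABC)"
    by (simp_all add: cscale_of_real psd_scaleR psd_P_rest[OF assms(1)])
  ultimately show ?thesis unfolding class_op_def by (intro psd_add)
qed

lemma psd_kron_axis:
  assumes "psd M"
  shows "psd (kron M (ketbra (axis k 1) (axis k 1)))"
proof -
  have "cinner v (kron M (ketbra (axis k 1) (axis k 1)) *v v) = cinner (\<chi> p. v $ (p, k)) (M *v (\<chi> p. v $ (p, k)))" for v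
  proof -
    have "cinner v (kron M (ketbra (axis k 1) (axis k 1)) *v v) = (\<Sum>p\<in>UNIV. \<Sum>e\<in>UNIV. \<Sum>q\<in>UNIV. \<Sum>f\<in>UNIV.
        if f = k then if e = k then cnj (v $ (p, k)) * M $ p $ q * v $ (q, k) else 0 else 0)"
      unfolding cinner_matrix sum_UNIV_pair kron_nth ketbra_nth by (intro sum.cong refl) (auto simp: axis_def)
    also have "\<dots> = (\<Sum>p\<in>UNIV. \<Sum>q\<in>UNIV. \<Sum>e\<in>UNIV. if e = k then cnj (v $ (p, k)) * M $ p $ q * v $ (q, k) else 0)"
      by (rule sum.cong[OF refl], subst sum.swap) simp
    finally show ?thesis unfolding cinner_matrix by simp
  qed
  then show ?thesis using assms unfolding psd_def by simp
qed

lemma ptrace_add: "ptrace (M + N) = ptrace M + ptrace N"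
  by (simp add: vec_eq_iff ptrace_def sum_component sum.distrib)

lemma ptrace_diff: "ptrace (M - N) = ptrace M - ptrace N"
  by (simp add: vec_eq_iff ptrace_def sum_component sum_subtractf)

lemma ptrace_sum: "ptrace (sum f I) = (\<Sum>i\<in>I. ptrace (f i))"
  by (induction I rule: infinite_finite_induct) (auto simp: ptrace_add, auto simp: vec_eq_iff ptrace_def sum_component)

lemma ptrace_cscale: "ptrace (cscale c M) = cscale c (ptrace M)"
  by (simp add: vec_eq_iff ptrace_def sum_component cscale_def sum_distrib_left)

text \<open>For opposite signs both the identity and the swap terms cancel; this is why the
  normalization constraints involve only the diagonal entries of the \<alpha> matrices.\<close>

lemma ptrace_Psi:
  assumes "CARD('n::finite) \<ge> 2"
  shows "ptrace (\<Sum>m\<in>UNIV. ketbra (Psi a m) (Psi b m) :: 'n op_ABC)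
    = (if a = b then cscale (of_real (2 / (real CARD('n) + sgnval a))) (P_sgn a) else 0)"
proof -
  define \<kappa> where "\<kappa> a = complex_of_real (psi_norm TYPE('n) a)" for a
  define \<sigma> where "\<sigma> a = complex_of_real (sgnval a)" for a
  have "ptrace (\<Sum>m\<in>UNIV. ketbra (Psi a m) (Psi b m) :: 'n op_ABC) $ (x, y) $ (x', y')
      = \<kappa> a * \<kappa> b * ((1 + \<sigma> a * \<sigma> b) * of_bool (x = x' \<and> y = y') + (\<sigma> a + \<sigma> b) * of_bool (x = y' \<and> y = x'))" for x y x' y'
  proof -
    have "ptrace (\<Sum>m\<in>UNIV. ketbra (Psi a m) (Psi b m) :: 'n op_ABC) $ (x, y) $ (x', y')
        = (\<Sum>z\<in>UNIV. \<Sum>m\<in>UNIV. Psi a m $ ((x, y), z) * cnj (Psi b m $ ((x', y'), z)))"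
      by (simp add: ptrace_def sum_component)
    also have "\<dots> = (\<Sum>z\<in>UNIV. \<Sum>m\<in>UNIV.
        (if m = y then if z = x then \<kappa> a * \<kappa> b * of_bool (x = x' \<and> y = y') else 0 else 0)
        + (if m = y then if z = x then \<kappa> a * \<kappa> b * \<sigma> b * of_bool (x = y' \<and> y = x') else 0 else 0)
        + (if m = x then if z = y then \<kappa> a * \<kappa> b * \<sigma> a * of_bool (x = y' \<and> y = x') else 0 else 0)
        + (if m = x then if z = y then \<kappa> a * \<kappa> b * \<sigma> a * \<sigma> b * of_bool (x = x' \<and> y = y') else 0 else 0))"
      unfolding Psi_nth \<kappa>_def[symmetric] \<sigma>_def[symmetric]
    proof (intro sum.cong refl)
      fix z m
      have "cnj (\<kappa> b) = \<kappa> b" "cnj (\<sigma> b) = \<sigma> b" by (simp_all add: \<kappa>_def \<sigma>_def)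
      then show "\<kappa> a * ((if x = z then if y = m then 1 else 0 else 0) + \<sigma> a * (if y = z then if x = m then 1 else 0 else 0))
          * cnj (\<kappa> b * ((if x' = z then if y' = m then 1 else 0 else 0) + \<sigma> b * (if y' = z then if x' = m then 1 else 0 else 0)))
        = (if m = y then if z = x then \<kappa> a * \<kappa> b * of_bool (x = x' \<and> y = y') else 0 else 0)
        + (if m = y then if z = x then \<kappa> a * \<kappa> b * \<sigma> b * of_bool (x = y' \<and> y = x') else 0 else 0)
        + (if m = x then if z = y then \<kappa> a * \<kappa> b * \<sigma> a * of_bool (x = y' \<and> y = x') else 0 else 0)
        + (if m = x then if z = y then \<kappa> a * \<kappa> b * \<sigma> a * \<sigma> b * of_bool (x = x' \<and> y = y') else 0 else 0)"
        by (cases "z = x"; cases "m = y"; cases "z = y"; cases "m = x") (auto simp: algebra_simps)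
    qed
    also have "\<dots> = \<kappa> a * \<kappa> b * ((1 + \<sigma> a * \<sigma> b) * of_bool (x = x' \<and> y = y') + (\<sigma> a + \<sigma> b) * of_bool (x = y' \<and> y = x'))"
    proof -
      have "(\<Sum>z\<in>UNIV. \<Sum>m\<in>UNIV.
          (if m = y then if z = x then \<kappa> a * \<kappa> b * P else 0 else 0)
          + (if m = y then if z = x then \<kappa> a * \<kappa> b * \<sigma> b * Q else 0 else 0)
          + (if m = x then if z = y then \<kappa> a * \<kappa> b * \<sigma> a * Q else 0 else 0)
          + (if m = x then if z = y then \<kappa> a * \<kappa> b * \<sigma> a * \<sigma> b * P else 0 else 0))
        = \<kappa> a * \<kappa> b * ((1 + \<sigma> a * \<sigma> b) * P + (\<sigma> a + \<sigma> b) * Q)" for P Q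
        by (simp add: sum.distrib algebra_simps)
      then show ?thesis .
    qed
    finally show ?thesis .
  qed
  note entry = this
  show ?thesis
  proof (cases "a = b")
    case True
    have "\<kappa> b * \<kappa> b = of_real (1 / (2 * (real CARD('n) + sgnval b)))"
      unfolding \<kappa>_def psi_norm_sq[OF assms, symmetric] by simp
    moreover have "\<sigma> b * \<sigma> b = 1" by (simp add: \<sigma>_def sgnval_def)
    moreover have "of_real (1 / (2 * D)) * ((1 + 1) * P + (\<sigma> b + \<sigma> b) * Q) = of_real (2 / D) * ((P + \<sigma> b * Q) / 2)"
      for D :: real and P Q :: complex
      by (cases "D = 0") (simp_all add: field_simps)
    ultimately have "ptrace (\<Sum>m\<in>UNIV. ketbra (Psi b m) (Psi b m) :: 'n op_ABC) $ (x, y) $ (x', y')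
        = cscale (of_real (2 / (real CARD('n) + sgnval b))) (P_sgn b) $ (x, y) $ (x', y')" for x y x' y'
      unfolding entry[unfolded True] cscale_def vec_lambda_beta P_sgn_nth by (simp only: \<sigma>_def)
    then show ?thesis unfolding True by (simp only: vec_eq_iff split_paired_All simp_thms if_True)
  next
    case False
    then have "sgnval a = - sgnval b" using two_cases[of a] two_cases[of b] by (auto simp: sgnval_def)
    then have "1 + \<sigma> a * \<sigma> b = 0" "\<sigma> a + \<sigma> b = 0" by (simp_all add: \<sigma>_def sgnval_def)
    then show ?thesis using False by (simp add: vec_eq_iff entry)
  qed
qed

lemma ptrace_kron_1: "ptrace (kron M (mat 1 :: complex^'k::finite^'k)) = cscale (of_nat CARD('k)) M"
  by (simp add: vec_eq_iff ptrace_def sum_component cscale_def mat_1_nth)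

lemma ptrace_P_rest:
  assumes "CARD('n::finite) \<ge> 2"
  shows "ptrace (P_rest a :: 'n op_ABC) = cscale (of_real (real CARD('n) - 2 / (real CARD('n) + sgnval a))) (P_sgn a)"
proof -
  show ?thesis
    unfolding P_rest_def ptrace_diff ptrace_Psi[OF assms] ptrace_kron_1
    by (simp add: vec_eq_iff cscale_def algebra_simps)
qed

lemma d_sgn_eq: "d_sgn TYPE('n::finite) a = real CARD('n) * (real CARD('n) + sgnval a) / 2"
proof -
  have "Re (P_sgn a $ (x, y) $ (x, y)) = 1 / 2 + (if y = x then sgnval a / 2 else 0)" for x y :: 'n
    unfolding P_sgn_nth by auto
  then show ?thesis
    unfolding d_sgn_def trace_def sum_UNIV_pair Re_sum by (simp add: sum.distrib algebra_simps add_divide_distrib)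
qed

lemma trace_ptrace: "trace (ptrace M) = trace M"
  by (simp add: trace_def ptrace_def sum_component sum_UNIV_pair)

lemma d_rest_eq:
  assumes "CARD('n::finite) \<ge> 2"
  shows "d_rest TYPE('n) a = real CARD('n) * (real CARD('n) * (real CARD('n) + sgnval a) / 2) - real CARD('n)"
proof -
  have tr: "trace (cscale c M) = c * trace M" for c and M :: "'n op_AB"
    by (simp add: trace_def cscale_def sum_distrib_left)
  have "real CARD('n) + sgnval a > 0" using assms by (simp add: sgnval_def)
  then have "(x - 2 / (real CARD('n) + sgnval a)) * (x * (real CARD('n) + sgnval a) / 2)
      = x * (x * (real CARD('n) + sgnval a) / 2) - x" for x
    by (simp add: left_diff_distrib)
  moreover have "d_rest TYPE('n) a = (real CARD('n) - 2 / (real CARD('n) + sgnval a)) * d_sgn TYPE('n) a"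
    unfolding d_rest_def trace_ptrace[of "P_rest a", symmetric] ptrace_P_rest[OF assms] tr d_sgn_def by simp
  ultimately show ?thesis unfolding d_sgn_eq by simp
qed

section \<open>Counting index triples by class\<close>

lemma classes_eq: "classes = UNIV"
  using cls.exhaust by (auto simp: classes_def)

lemma finite_cls [simp]: "finite (UNIV :: cls set)"
  unfolding classes_eq[symmetric] by (simp add: classes_def)

lemma sum_cls: "(\<Sum>l\<in>(UNIV::cls set). f l) = f XX_X + f XX_Y + f XY_X + f XY_Y + f XY_Z"
  unfolding classes_eq[symmetric] classes_def by (simp add: add.assoc)

definition class_count :: "'n::finite \<Rightarrow> cls \<Rightarrow> nat"
  where "class_count k l = card {p. class_of (fst p) (snd p) k = l}"

text \<open>Relabelling all indices by the transposition of k and k' preserves classes.\<close>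

lemma class_count_const:
  fixes k k' :: "'n::finite"
  shows "class_count k l = class_count k' l"
proof -
  define \<sigma> where "\<sigma> = Transposition.transpose k k'"
  have s: "\<sigma> (\<sigma> i) = i" "\<sigma> k = k'" "\<sigma> k' = k" for i
    by (simp_all add: \<sigma>_def)
  have inj: "\<sigma> i = \<sigma> j \<longleftrightarrow> i = j" for i j
    by (metis s(1))
  have "class_of (\<sigma> i) (\<sigma> j) (\<sigma> k) = class_of i j k" for i j k
    by (simp add: class_of_def inj)
  from this[of _ _ k] this[of _ _ k']
  have "bij_betw (map_prod \<sigma> \<sigma>) {p. class_of (fst p) (snd p) k = l} {p. class_of (fst p) (snd p) k' = l}"
    by (intro bij_betwI[where g = "map_prod \<sigma> \<sigma>"]) (auto simp: s)
  then show ?thesis unfolding class_count_def by (rule bij_betw_same_card)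
qed

lemma class_size_count: "class_size TYPE('n::finite) l = CARD('n) * class_count (k::'n) l"
proof -
  have "class_size TYPE('n) l = (\<Sum>i\<in>UNIV. \<Sum>j\<in>UNIV. \<Sum>k\<in>(UNIV::'n set). of_bool (class_of i j k = l))"
  proof -
    have "class_size TYPE('n) l = card {p::'n \<times> 'n \<times> 'n. class_of (fst p) (fst (snd p)) (snd (snd p)) = l}"
      unfolding class_size_def by (rule arg_cong[of _ _ card]) auto
    also have "\<dots> = (\<Sum>p\<in>(UNIV::('n \<times> 'n \<times> 'n) set). of_bool (class_of (fst p) (fst (snd p)) (snd (snd p)) = l))"
      by (simp add: sum_of_bool_eq)
    finally show ?thesis by (simp only: sum_UNIV_pair fst_conv snd_conv)
  qed
  also have "\<dots> = (\<Sum>k\<in>UNIV. \<Sum>i\<in>UNIV. \<Sum>j\<in>(UNIV::'n set). of_bool (class_of i j k = l))"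
    by (rule sum_rotate3)
  also have "\<dots> = (\<Sum>k\<in>(UNIV::'n set). class_count k l)"
  proof -
    have "class_count k l = (\<Sum>p\<in>(UNIV::('n \<times> 'n) set). of_bool (class_of (fst p) (snd p) k = l))" for k :: 'n
      unfolding class_count_def by (simp add: sum_of_bool_eq)
    then show ?thesis by (simp only: sum_UNIV_pair fst_conv snd_conv)
  qed
  also have "\<dots> = (\<Sum>k'\<in>(UNIV::'n set). class_count k l)"
    by (intro sum.cong refl class_count_const)
  finally show ?thesis by simp
qed

text \<open>A class has d times as many triples as it has pairs (i, j) for one fixed k. The weight
  d/n(l) therefore counts each nonempty class exactly once, for every k.\<close>

lemma sum_class_weighted:
  fixes F :: "cls \<Rightarrow> 'b::real_vector" and k :: "'n::finite"
  shows "(\<Sum>i\<in>UNIV. \<Sum>j\<in>UNIV. (real CARD('n) / real (class_size TYPE('n) (class_of i j k))) *\<^sub>R F (class_of i j k))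
    = (\<Sum>l\<in>UNIV. if class_size TYPE('n) l = 0 then 0 else F l)"
proof -
  define G where "G l = (real CARD('n) / real (class_size TYPE('n) l)) *\<^sub>R F l" for l
  have "(\<Sum>i\<in>UNIV. \<Sum>j\<in>UNIV. G (class_of i j k)) = (\<Sum>p\<in>UNIV. G (class_of (fst p) (snd p) k))"
    by (simp add: sum_UNIV_pair)
  also have "\<dots> = (\<Sum>l\<in>UNIV. \<Sum>p | p \<in> UNIV \<and> class_of (fst p) (snd p) k = l. G (class_of (fst p) (snd p) k))"
    by (rule sum.group[symmetric]) auto
  also have "\<dots> = (\<Sum>l\<in>UNIV. real (class_count k l) *\<^sub>R G l)"
    by (intro sum.cong refl) (simp add: class_count_def scaleR_conv_of_real sum_constant_scaleR)
  also have "\<dots> = (\<Sum>l\<in>UNIV. if class_size TYPE('n) l = 0 then 0 else F l)"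
    by (intro sum.cong refl) (simp add: G_def class_size_count[of _ k])
  finally show ?thesis unfolding G_def .
qed

lemma class_size_pos:
  assumes "CARD('n::finite) \<ge> 2" "l = XY_Z \<Longrightarrow> CARD('n) \<ge> 3"
  shows "class_size TYPE('n) l \<noteq> 0"
proof -
  have "\<exists>i j k::'n. class_of i j k = l"
  proof -
    obtain x :: 'n where True by blast
    have "\<exists>y. y \<noteq> x"
    proof (rule ccontr)
      assume "\<not> (\<exists>y. y \<noteq> x)"
      then have "(UNIV :: 'n set) = {x}" by auto
      then have "CARD('n) = 1" by (metis card_1_singleton_iff One_nat_def)
      then show False using assms(1) by simp
    qed
    then obtain y where y: "y \<noteq> x" by blast
    show ?thesis
    proof (cases l)
      case XX_X then show ?thesis by (intro exI[of _ x]) (simp add: class_of_def)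
    next
      case XX_Y then show ?thesis using y by (intro exI[of _ x] exI[of _ y]) (auto simp: class_of_def)
    next
      case XY_X
      have "class_of x y x = XY_X" using y by (auto simp: class_of_def)
      then show ?thesis using XY_X by blast
    next
      case XY_Y
      have "class_of x y y = XY_Y" using y by (auto simp: class_of_def)
      then show ?thesis using XY_Y by blast
    next
      case XY_Z
      have "\<exists>z. z \<noteq> x \<and> z \<noteq> y"
      proof (rule ccontr)
        assume "\<not> (\<exists>z. z \<noteq> x \<and> z \<noteq> y)"
        then have "(UNIV :: 'n set) = {x, y}" by auto
        then have "CARD('n) \<le> 2" using card_insert_le_m1[of 2 "{y}" x] by (simp only:) auto
        then show False using assms(2)[OF XY_Z] by simp
      qed
      then obtain z where "z \<noteq> x" "z \<noteq> y" by blast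
      then have "class_of x y z = XY_Z" using y by (auto simp: class_of_def)
      then show ?thesis using XY_Z by blast
    qed
  qed
  then have "{(i::'n, j, k). class_of i j k = l} \<noteq> {}" by auto
  then show ?thesis unfolding class_size_def by (simp add: card_gt_0_iff)
qed

lemma sum_class_all:
  fixes F :: "cls \<Rightarrow> 'b::real_vector" and k :: "'n::finite"
  assumes "CARD('n) \<ge> 2" "CARD('n) = 2 \<Longrightarrow> F XY_Z = 0"
  shows "(\<Sum>i\<in>UNIV. \<Sum>j\<in>UNIV. (real CARD('n) / real (class_size TYPE('n) (class_of i j k))) *\<^sub>R F (class_of i j k))
    = (\<Sum>l\<in>UNIV. F l)"
proof -
  have "(if class_size TYPE('n) l = 0 then 0 else F l) = F l" for l
    using class_size_pos[OF assms(1), of l] assms by (cases "CARD('n) = 2"; cases "l = XY_Z") force+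
  then show ?thesis unfolding sum_class_weighted by simp
qed

subsection \<open>Symmetric sets define cloning instruments\<close>

lemma kron_sum_left: "kron (sum f I) N = (\<Sum>i\<in>I. kron (f i) N)"
  by (simp add: vec_eq_iff sum_component sum_distrib_right kron_def)

lemma sum_kron_axis:
  fixes M :: "complex^'m::finite^'m"
  shows "(\<Sum>k\<in>(UNIV :: 'k::finite set). kron M (ketbra (axis k 1) (axis k 1))) = kron M (mat 1)"
  unfolding vec_eq_iff
proof (intro allI)
  fix p q :: "'m \<times> 'k"
  obtain x y x' y' where pq: "p = (x, y)" "q = (x', y')" by (metis surj_pair)
  have "(\<Sum>k\<in>UNIV. kron M (ketbra (axis k 1) (axis k 1))) $ p $ q
      = (\<Sum>k\<in>UNIV. if k = y then if y = y' then M $ x $ x' else 0 else 0)"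
    unfolding pq sum_component kron_nth ketbra_nth by (intro sum.cong refl) (auto simp: axis_def)
  then show "(\<Sum>k\<in>UNIV. kron M (ketbra (axis k 1) (axis k 1))) $ p $ q = kron M (mat 1) $ p $ q"
    by (simp add: pq mat_1_nth)
qed

lemma class_op_XY_Z:
  assumes "symmetric_set TYPE('n::finite) s" "CARD('n) = 2"
  shows "(class_op s XY_Z :: 'n op_ABC) = 0"
proof -
  have "s v XY_Z = 0" for v using assms unfolding symmetric_set_def by blast
  then show ?thesis by (simp add: class_op_def cscale_def vec_eq_iff sum_component)
qed

lemma cscale_sum_left: "cscale (sum f I) M = (\<Sum>i\<in>I. cscale (f i) M)"
  by (simp add: vec_eq_iff cscale_def sum_component sum_distrib_right)

lemma P_sgn_add: "P_sgn 1 + P_sgn 2 = mat 1"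
  unfolding P_sgn_def by (simp add: scaleR_add_right[symmetric] flip: scaleR_2)

text \<open>The two scalar constraints, divided by d_+ and d_-, say that the coefficients of P^+ and
  P^- in the partial trace are both 1.\<close>

lemma ptrace_class_op_sum:
  assumes d2: "CARD('n::finite) \<ge> 2" and s: "symmetric_set TYPE('n) s"
  shows "ptrace (\<Sum>l\<in>UNIV. class_op s l :: 'n op_ABC) = mat 1"
proof -
  define D where "D a = real CARD('n) + sgnval a" for a
  have D: "D a > 0" for a using d2 by (simp add: D_def sgnval_def)
  have op: "ptrace (class_op s l :: 'n op_ABC)
      = cscale (of_real (2 / D 1) * s Alpha l $ 1 $ 1 + of_real (real CARD('n) - 2 / D 1) * s Beta l $ 1 $ 1) (P_sgn 1)
        + cscale (of_real (2 / D 2) * s Alpha l $ 2 $ 2 + of_real (real CARD('n) - 2 / D 2) * s Gamma l $ 2 $ 2) (P_sgn 2)" for l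
    unfolding class_op_def sum_2 ptrace_add ptrace_cscale ptrace_Psi[OF d2] ptrace_P_rest[OF d2] D_def[symmetric]
    by (simp add: cscale_def vec_eq_iff algebra_simps)
  have one: "of_real (2 / D a) * A + of_real (real CARD('n) - 2 / D a) * B = (1::complex)"
    if "of_real (d_sgn TYPE('n) a) = of_nat CARD('n) * A + of_real (d_rest TYPE('n) a) * B" for a A B
  proof -
    define e where "e = complex_of_real (D a)"
    define n where "n = complex_of_nat CARD('n)"
    have ne: "e \<noteq> 0" "n \<noteq> 0" using D[of a] by (auto simp: e_def n_def)
    have "n * e / 2 = n * A + (n * (n * e / 2) - n) * B"
      using that unfolding d_sgn_eq d_rest_eq[OF d2] D_def[symmetric] by (simp add: e_def n_def)
    then have "n * (e / 2) = n * (A + (n * e / 2 - 1) * B)" by (simp add: algebra_simps)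
    then have "e / 2 = A + (n * e / 2 - 1) * B" using ne by (simp only: mult_cancel_left) simp
    moreover have "1 = e / 2 * (2 / e)" using ne by simp
    ultimately have "1 = (A + (n * e / 2 - 1) * B) * (2 / e)" by (simp only:)
    also have "\<dots> = of_real (2 / D a) * A + of_real (real CARD('n) - 2 / D a) * B"
      using ne by (simp add: e_def[symmetric] n_def[symmetric] field_simps)
    finally show ?thesis ..
  qed
  have n1: "(\<Sum>l\<in>UNIV. of_real (2 / D 1) * s Alpha l $ 1 $ 1 + of_real (real CARD('n) - 2 / D 1) * s Beta l $ 1 $ 1) = 1"
    unfolding sum.distrib sum_distrib_left[symmetric]
    by (rule one) (use s in \<open>simp add: symmetric_set_def classes_eq\<close>)
  have n2: "(\<Sum>l\<in>UNIV. of_real (2 / D 2) * s Alpha l $ 2 $ 2 + of_real (real CARD('n) - 2 / D 2) * s Gamma l $ 2 $ 2) = 1"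
    unfolding sum.distrib sum_distrib_left[symmetric]
    by (rule one) (use s in \<open>simp add: symmetric_set_def classes_eq\<close>)
  have "cscale 1 M = M" for M :: "'n op_AB" by (simp add: vec_eq_iff cscale_def)
  then show ?thesis
    unfolding ptrace_sum op sum.distrib unfolding cscale_sum_left[symmetric] n1 n2
    by (simp only: P_sgn_add)
qed

text \<open>The witness S is the sum of all class operators: for each k the sum over i and j of
  \<open>sym_R' s i j k\<close> is this same operator.\<close>

theorem cloning_instrument_sym:
  assumes d2: "CARD('n::finite) \<ge> 2" and s: "symmetric_set TYPE('n) s"
  shows "cloning_instrument (sym_instrument s :: 'n \<Rightarrow> 'n \<Rightarrow> 'n op_ABCD)"
  unfolding cloning_instrument_def
proof (intro conjI allI exI)
  show "psd (sym_instrument s i j :: 'n op_ABCD)" for i j :: 'n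
    unfolding sym_instrument_def sym_R'_eq
    by (intro psd_sum psd_kron_axis psd_scaleR psd_class_op d2 s) simp
  show "psd (\<Sum>l\<in>UNIV. class_op s l :: 'n op_ABC)"
    by (intro psd_sum psd_class_op d2 s)
  show "ptrace (\<Sum>l\<in>UNIV. class_op s l :: 'n op_ABC) = mat 1"
    by (rule ptrace_class_op_sum[OF d2 s])
  have "(\<Sum>i\<in>UNIV. \<Sum>j\<in>UNIV. sym_instrument s i j :: 'n op_ABCD)
      = (\<Sum>k\<in>UNIV. \<Sum>i\<in>UNIV. \<Sum>j\<in>UNIV. kron (sym_R' s i j k) (ketbra (axis k 1) (axis k 1)))"
    unfolding sym_instrument_def by (rule sum_rotate3)
  also have "\<dots> = (\<Sum>k\<in>UNIV. kron (\<Sum>l\<in>UNIV. class_op s l) (ketbra (axis k 1) (axis k 1)))"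
  proof (rule sum.cong[OF refl])
    fix k :: 'n
    have "(\<Sum>i\<in>UNIV. \<Sum>j\<in>UNIV. sym_R' s i j k) = (\<Sum>l\<in>UNIV. class_op s l)"
      unfolding sym_R'_eq by (rule sum_class_all[where F = "class_op s", OF d2 class_op_XY_Z[OF s]])
    then show "(\<Sum>i\<in>UNIV. \<Sum>j\<in>UNIV. kron (sym_R' s i j k) (ketbra (axis k 1) (axis k 1)))
        = kron (\<Sum>l\<in>UNIV. class_op s l) (ketbra (axis k 1) (axis k 1))"
      by (simp only: kron_sum_left[symmetric])
  qed
  finally show "(\<Sum>i\<in>UNIV. \<Sum>j\<in>UNIV. sym_instrument s i j :: 'n op_ABCD) = kron (\<Sum>l\<in>UNIV. class_op s l) (mat 1)"
    unfolding sum_kron_axis .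
qed

subsection \<open>The fidelity of a symmetric instrument\<close>

text \<open>The sum over m of the product of the overlaps of \<open>phi U i j k\<close> with
  \<open>Psi a m\<close> and \<open>Psi b m\<close>, with the norms \<open>psi_norm\<close> taken
  out; see \<open>cinner_phi_Psi\<close>.\<close>

definition psi_overlap :: "2 \<Rightarrow> 2 \<Rightarrow> cls \<Rightarrow> real"
  where "psi_overlap a b l = (case l of XX_X \<Rightarrow> (1 + sgnval a) * (1 + sgnval b)
    | XY_X \<Rightarrow> 1 | XY_Y \<Rightarrow> sgnval a * sgnval b | _ \<Rightarrow> 0)"

text \<open>The squared norm of the symmetric or antisymmetric part of
  \<open>phi U i j k\<close>.\<close>

definition sgn_overlap :: "2 \<Rightarrow> cls \<Rightarrow> real"
  where "sgn_overlap a l = (if l = XX_X \<or> l = XX_Y then (1 + sgnval a) / 2 else 1 / 2)"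

text \<open>The contribution of a class to d times the average fidelity. The \<beta> and \<gamma>
  coefficients are overlaps with \<open>P_rest\<close>.\<close>

definition class_fid :: "'n::finite itself \<Rightarrow> sset \<Rightarrow> cls \<Rightarrow> real"
  where "class_fid T s l =
    (\<Sum>a\<in>UNIV. \<Sum>b\<in>UNIV. Re (s Alpha l $ a $ b) * (psi_norm T a * psi_norm T b * psi_overlap a b l))
    + Re (s Beta l $ 1 $ 1) * (sgn_overlap 1 l - psi_norm T 1 * psi_norm T 1 * psi_overlap 1 1 l)
    + Re (s Gamma l $ 2 $ 2) * (sgn_overlap 2 l - psi_norm T 2 * psi_norm T 2 * psi_overlap 2 2 l)"

text \<open>Contracting C with A or B pairs column k with column i or j; orthonormality leaves a
  Kronecker delta and one free column.\<close>

lemma contr_phi: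
  assumes "unitary U"
  shows "contr a (comp3 (phi U i j k)) m
    = (if i = k then cnj (U $ m $ j) else 0) + of_real (sgnval a) * (if j = k then cnj (U $ m $ i) else 0)"
proof -
  have "(\<Sum>n\<in>UNIV. comp3 (phi U i j k) n m n) = cnj (U $ m $ j) * (\<Sum>n\<in>UNIV. U $ n $ k * cnj (U $ n $ i))"
    "(\<Sum>n\<in>UNIV. comp3 (phi U i j k) m n n) = cnj (U $ m $ i) * (\<Sum>n\<in>UNIV. U $ n $ k * cnj (U $ n $ j))"
    by (simp_all add: comp3_def phi_def sum_distrib_left mult_ac)
  then show ?thesis unfolding contr_def unitary_columns[OF assms] by (auto simp: of_bool_def)
qed

lemma sum_contr_phi:
  assumes "unitary U"
  shows "(\<Sum>m\<in>UNIV. cnj (contr a (comp3 (phi U i j k)) m) * contr b (comp3 (phi U i j k)) m)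
    = of_real (psi_overlap a b (class_of i j k))"
proof -
  have one: "(\<Sum>m\<in>UNIV. U $ m $ i * cnj (U $ m $ i)) = 1" for i
    using unitary_columns[OF assms, of i i] by simp
  consider "i = k" "j = k" | "i = k" "j \<noteq> k" | "i \<noteq> k" "j = k" | "i \<noteq> k" "j \<noteq> k" by blast
  then show ?thesis
  proof cases
    case 1
    have "(\<Sum>m\<in>UNIV. cnj (contr a (comp3 (phi U i j k)) m) * contr b (comp3 (phi U i j k)) m)
        = (1 + of_real (sgnval a)) * (1 + of_real (sgnval b)) * (\<Sum>m\<in>UNIV. U $ m $ k * cnj (U $ m $ k))"
      unfolding contr_phi[OF assms] sum_distrib_left using 1 by (intro sum.cong refl) (simp add: algebra_simps)
    then show ?thesis using 1 by (simp add: one class_of_def psi_overlap_def)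
  next
    case 2
    then have "class_of i j k = XY_X" by (auto simp: class_of_def)
    then show ?thesis unfolding contr_phi[OF assms] using 2 one[of j] by (simp add: psi_overlap_def)
  next
    case 3
    then have c: "class_of i j k = XY_Y" by (auto simp: class_of_def)
    have "(\<Sum>m\<in>UNIV. cnj (contr a (comp3 (phi U i j k)) m) * contr b (comp3 (phi U i j k)) m)
        = of_real (sgnval a) * of_real (sgnval b) * (\<Sum>m\<in>UNIV. U $ m $ i * cnj (U $ m $ i))"
      unfolding contr_phi[OF assms] sum_distrib_left using 3 by (intro sum.cong refl) (simp add: algebra_simps)
    then show ?thesis using c by (simp add: one psi_overlap_def)
  next
    case 4
    then have "class_of i j k = XX_Y \<or> class_of i j k = XY_Z" by (auto simp: class_of_def)
    then show ?thesis unfolding contr_phi[OF assms] using 4 by (auto simp: psi_overlap_def)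
  qed
qed

lemma cinner_phi_Psi:
  fixes U :: "complex^'n::finite^'n"
  assumes "unitary U"
  shows "cinner (phi U i j k) ((\<Sum>m\<in>UNIV. ketbra (Psi a m) (Psi b m)) *v phi U i j k)
    = of_real (psi_norm TYPE('n) a * psi_norm TYPE('n) b * psi_overlap a b (class_of i j k))"
proof -
  have "cinner (phi U i j k) ((\<Sum>m\<in>UNIV. ketbra (Psi a m) (Psi b m)) *v phi U i j k)
      = (\<Sum>m\<in>UNIV. cnj (cinner (Psi a m) (phi U i j k)) * cinner (Psi b m) (phi U i j k))"
    unfolding cinner_sum_matrix cinner_ketbra cinner_commute[of "phi U i j k" "Psi _ _"] ..
  also have "\<dots> = of_real (psi_norm TYPE('n) a) * of_real (psi_norm TYPE('n) b)
      * (\<Sum>m\<in>UNIV. cnj (contr a (comp3 (phi U i j k)) m) * contr b (comp3 (phi U i j k)) m)"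
    unfolding cinner_Psi sum_distrib_left by (simp add: mult_ac)
  finally show ?thesis unfolding sum_contr_phi[OF assms] by simp
qed

lemma cinner_phi_P_sgn:
  assumes "unitary U"
  shows "cinner (phi U i j k) (kron (P_sgn a) (mat 1) *v phi U i j k) = of_real (sgn_overlap a (class_of i j k))"
proof -
  have col: "(\<Sum>m\<in>UNIV. U $ m $ p * cnj (U $ m $ q)) = of_bool (p = q)" for p q
    by (rule unitary_columns[OF assms])
  have prod3: "(\<Sum>x\<in>UNIV. \<Sum>y\<in>UNIV. \<Sum>z\<in>UNIV. f x * g y * h z) = sum f UNIV * sum g UNIV * (sum h UNIV :: complex)"
    for f g h :: "'a \<Rightarrow> complex"
    by (simp only: sum_distrib_left[symmetric] sum_distrib_right[symmetric])
  have "cinner (phi U i j k) (kron (P_sgn a) (mat 1) *v phi U i j k) = (\<Sum>x\<in>UNIV. \<Sum>y\<in>UNIV. \<Sum>z\<in>UNIV.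
      (U $ x $ i * cnj (U $ x $ i)) * (U $ y $ j * cnj (U $ y $ j)) * (U $ z $ k * cnj (U $ z $ k) / 2)
      + (U $ x $ i * cnj (U $ x $ j)) * (U $ y $ j * cnj (U $ y $ i)) * (of_real (sgnval a) / 2 * (U $ z $ k * cnj (U $ z $ k))))"
    unfolding cinner_P_sgn comp3_def phi_def by (intro sum.cong refl) (simp add: algebra_simps add_divide_distrib)
  also have "\<dots> = 1 / 2 + of_bool (i = j) * (of_real (sgnval a) / 2)"
    unfolding sum.distrib unfolding prod3 unfolding sum_distrib_left[symmetric] sum_divide_distrib[symmetric] col
    by auto
  also have "\<dots> = of_real (sgn_overlap a (class_of i j k))"
    by (auto simp: sgn_overlap_def class_of_def add_divide_distrib)
  finally show ?thesis .
qed

lemma cinner_phi_class_op: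
  fixes U :: "complex^'n::finite^'n"
  assumes U: "unitary U"
  shows "Re (cinner (phi U i j k) (class_op s (class_of i j k) *v phi U i j k)) = class_fid TYPE('n) s (class_of i j k)"
proof -
  have rest: "cinner (phi U i j k) (P_rest a *v phi U i j k)
      = of_real (sgn_overlap a (class_of i j k) - psi_norm TYPE('n) a * psi_norm TYPE('n) a * psi_overlap a a (class_of i j k))" for a
    unfolding P_rest_def cinner_diff_matrix cinner_phi_Psi[OF U] cinner_phi_P_sgn[OF U] by simp
  show ?thesis
    unfolding class_op_def class_fid_def matrix_vector_mult_add_rdistrib cinner_add_right cinner_sum_matrix[where I = "UNIV :: 2 set"]
      cinner_cscale cinner_phi_Psi[OF U] rest
    by simp
qed

lemma sandwich_sym_instrument: "sandwich k (sym_instrument s i j) = sym_R' s i j k"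
proof -
  have "sandwich k (kron M (ketbra (axis k' 1) (axis k' 1))) = (if k' = k then M else 0)" for k' and M :: "'a op_ABC"
    by (auto simp: vec_eq_iff axis_def)
  then show ?thesis unfolding sym_instrument_def sandwich_sum by simp
qed

context haar
begin

theorem avg_fidelity_sym:
  assumes d2: "CARD('n) \<ge> 2" and s: "symmetric_set TYPE('n) s"
  shows "avg_fidelity \<mu> (sym_instrument s) = (\<Sum>l\<in>UNIV. class_fid TYPE('n) s l) / CARD('n)"
proof -
  have z: "class_fid TYPE('n) s XY_Z = 0" if "CARD('n) = 2"
  proof -
    have "s v XY_Z = 0" for v using s that unfolding symmetric_set_def by blast
    then show ?thesis by (simp add: class_fid_def)
  qed
  have const: "E (\<lambda>U. Re (cinner (phi U i j k) (sandwich k (sym_instrument s i j) *v phi U i j k)))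
      = (real CARD('n) / real (class_size TYPE('n) (class_of i j k))) *\<^sub>R class_fid TYPE('n) s (class_of i j k)" for i j k
  proof -
    have "E (\<lambda>U. Re (cinner (phi U i j k) (sandwich k (sym_instrument s i j) *v phi U i j k)))
        = E (\<lambda>U. (real CARD('n) / real (class_size TYPE('n) (class_of i j k))) *\<^sub>R class_fid TYPE('n) s (class_of i j k))"
    proof (rule expectation_cong)
      fix U :: "complex^'n^'n" assume "U \<in> SU"
      then show "Re (cinner (phi U i j k) (sandwich k (sym_instrument s i j) *v phi U i j k))
        = (real CARD('n) / real (class_size TYPE('n) (class_of i j k))) *\<^sub>R class_fid TYPE('n) s (class_of i j k)"
        unfolding sandwich_sym_instrument sym_R'_eq cscale_of_real[symmetric] cinner_cscale
          cinner_phi_class_op[OF SU_unitary[OF \<open>U \<in> SU\<close>], symmetric] by simp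
    qed
    then show ?thesis by simp
  qed
  have "(\<Sum>i\<in>UNIV. \<Sum>j\<in>UNIV. \<Sum>k\<in>UNIV. E (\<lambda>U. Re (cinner (phi U i j k) (sandwich k (sym_instrument s i j) *v phi U i j k))))
      = (\<Sum>k\<in>(UNIV::'n set). \<Sum>i\<in>UNIV. \<Sum>j\<in>UNIV. (real CARD('n) / real (class_size TYPE('n) (class_of i j k))) *\<^sub>R class_fid TYPE('n) s (class_of i j k))"
    unfolding const by (rule sum_rotate3)
  also have "\<dots> = (\<Sum>k\<in>(UNIV::'n set). \<Sum>l\<in>UNIV. class_fid TYPE('n) s l)"
    by (rule sum.cong[OF refl], rule sum_class_all[where F = "class_fid TYPE('n) s", OF d2 z])
  finally show ?thesis unfolding avg_fidelity_eq by (simp add: power2_eq_square)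
qed

end

section \<open>Optimal sets\<close>

text \<open>Complementary slackness for the classes \<open>xy,x\<close> and \<open>xy,y\<close>: \<open>x\<close> and \<open>y\<close> are the normalized diagonal
  entries of \<open>s\<^sup>\<alpha>\<close>, \<open>t\<close> is plus or minus the real part of the off-diagonal one, and the square
  \<open>(3x - y/3)\<^sup>2\<close> vanishes exactly at the optimal ratio.\<close>

lemma slack_bound:
  fixes x y t :: real
  assumes "t\<^sup>2 \<le> x * y" "0 \<le> x" "0 \<le> y"
  shows "2 * t \<le> 3 * x + y / 3" and "2 * t = 3 * x + y / 3 \<Longrightarrow> y = 9 * x \<and> t = 3 * x"
proof -
  have sq: "(3 * x + y / 3)\<^sup>2 = 4 * (x * y) + (3 * x - y / 3)\<^sup>2"
    by (simp add: power2_eq_square field_simps)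
  have sq2: "(2 * t)\<^sup>2 = 4 * t\<^sup>2" by (simp add: power2_eq_square)
  have "(2 * t)\<^sup>2 \<le> (3 * x + y / 3)\<^sup>2"
    unfolding sq sq2 using assms(1) zero_le_power2[of "3 * x - y / 3"] by linarith
  then show "2 * t \<le> 3 * x + y / 3"
    by (rule power2_le_imp_le) (use assms in simp)
  assume eq: "2 * t = 3 * x + y / 3"
  have "4 * t\<^sup>2 = 4 * (x * y) + (3 * x - y / 3)\<^sup>2" unfolding sq2[symmetric] eq sq ..
  then have "(3 * x - y / 3)\<^sup>2 \<le> 0" using assms(1) by linarith
  then have "3 * x - y / 3 = 0" by (simp only: power2_less_eq_zero_iff)
  then show "y = 9 * x \<and> t = 3 * x" using eq by simp
qed

lemma all_cls: "(\<forall>l. P l) \<longleftrightarrow> P XX_X \<and> P XX_Y \<and> P XY_X \<and> P XY_Y \<and> P XY_Z"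
  by (metis cls.exhaust)

text \<open>Rescaled diagonal entries, for which the fidelity and the constraints in
  \<open>normalization\<close> have coefficients free of d in the \<alpha> terms.\<close>

definition wt :: "'n::finite itself \<Rightarrow> 2 \<Rightarrow> sset \<Rightarrow> cls \<Rightarrow> real"
  where "wt T a s l = psi_norm T a * psi_norm T a * Re (s Alpha l $ a $ a)"

definition coh :: "'n::finite itself \<Rightarrow> sset \<Rightarrow> cls \<Rightarrow> real"
  where "coh T s l = psi_norm T 1 * psi_norm T 2 * Re (s Alpha l $ 1 $ 2)"

lemma class_fid_simps:
  assumes "\<And>l. psd (s Alpha l)"
  shows "class_fid T s XX_X = 4 * wt T 1 s XX_X + Re (s Beta XX_X $ 1 $ 1) * (1 - 4 * (psi_norm T 1 * psi_norm T 1))"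
    "class_fid T s XX_Y = Re (s Beta XX_Y $ 1 $ 1)"
    "class_fid T s XY_X = wt T 1 s XY_X + wt T 2 s XY_X + 2 * coh T s XY_X
      + Re (s Beta XY_X $ 1 $ 1) * (1 / 2 - psi_norm T 1 * psi_norm T 1)
      + Re (s Gamma XY_X $ 2 $ 2) * (1 / 2 - psi_norm T 2 * psi_norm T 2)"
    "class_fid T s XY_Y = wt T 1 s XY_Y + wt T 2 s XY_Y - 2 * coh T s XY_Y
      + Re (s Beta XY_Y $ 1 $ 1) * (1 / 2 - psi_norm T 1 * psi_norm T 1)
      + Re (s Gamma XY_Y $ 2 $ 2) * (1 / 2 - psi_norm T 2 * psi_norm T 2)"
    "class_fid T s XY_Z = Re (s Beta XY_Z $ 1 $ 1) / 2 + Re (s Gamma XY_Z $ 2 $ 2) / 2"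
proof -
  have "Re (s Alpha l $ 2 $ 1) = Re (s Alpha l $ 1 $ 2)" for l
    using psd_hermitian[OF assms, of l 2 1] by simp
  then show "class_fid T s XX_X = 4 * wt T 1 s XX_X + Re (s Beta XX_X $ 1 $ 1) * (1 - 4 * (psi_norm T 1 * psi_norm T 1))"
    "class_fid T s XX_Y = Re (s Beta XX_Y $ 1 $ 1)"
    "class_fid T s XY_X = wt T 1 s XY_X + wt T 2 s XY_X + 2 * coh T s XY_X
      + Re (s Beta XY_X $ 1 $ 1) * (1 / 2 - psi_norm T 1 * psi_norm T 1)
      + Re (s Gamma XY_X $ 2 $ 2) * (1 / 2 - psi_norm T 2 * psi_norm T 2)"
    "class_fid T s XY_Y = wt T 1 s XY_Y + wt T 2 s XY_Y - 2 * coh T s XY_Y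
      + Re (s Beta XY_Y $ 1 $ 1) * (1 / 2 - psi_norm T 1 * psi_norm T 1)
      + Re (s Gamma XY_Y $ 2 $ 2) * (1 / 2 - psi_norm T 2 * psi_norm T 2)"
    "class_fid T s XY_Z = Re (s Beta XY_Z $ 1 $ 1) / 2 + Re (s Gamma XY_Z $ 2 $ 2) / 2"
    by (simp_all add: class_fid_def wt_def coh_def sum_2 psi_overlap_def sgn_overlap_def algebra_simps)
qed

lemma normalization:
  assumes d2: "CARD('n::finite) \<ge> 2" and s: "symmetric_set TYPE('n) s"
  shows "4 * (\<Sum>l\<in>UNIV. wt TYPE('n) 1 s l)
      + (real CARD('n) - 2 / (real CARD('n) + 1)) * (\<Sum>l\<in>UNIV. Re (s Beta l $ 1 $ 1)) = 1"
    and "4 * (\<Sum>l\<in>UNIV. wt TYPE('n) 2 s l)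
      + (real CARD('n) - 2 / (real CARD('n) - 1)) * (\<Sum>l\<in>UNIV. Re (s Gamma l $ 2 $ 2)) = 1"
proof -
  define d where "d = real CARD('n)"
  have d: "d \<ge> 2" using d2 by (simp add: d_def)
  have key: "4 * (1 / (2 * D) * A) + (d - 2 / D) * B = 1"
    if "d * D / 2 = d * A + (d * (d * D / 2) - d) * B" "D > 0" for A B D
  proof -
    have "d * (D / 2) = d * (A + (d * D / 2 - 1) * B)" using that(1) by (simp add: algebra_simps)
    then have "D / 2 = A + (d * D / 2 - 1) * B" using d by (simp only: mult_cancel_left) simp
    moreover have "1 = D / 2 * (2 / D)" using that(2) by simp
    ultimately have "1 = (A + (d * D / 2 - 1) * B) * (2 / D)" by (simp only:)
    also have "\<dots> = 4 * (1 / (2 * D) * A) + (d - 2 / D) * B" using that(2) by (simp add: field_simps)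
    finally show ?thesis ..
  qed
  have "Re (of_real (d_sgn TYPE('n) 1)) = Re (of_nat CARD('n) * (\<Sum>l\<in>classes. s Alpha l $ 1 $ 1)
      + of_real (d_rest TYPE('n) 1) * (\<Sum>l\<in>classes. s Beta l $ 1 $ 1))"
    using s unfolding symmetric_set_def by metis
  then have "d * (d + 1) / 2 = d * (\<Sum>l\<in>UNIV. Re (s Alpha l $ 1 $ 1)) + (d * (d * (d + 1) / 2) - d) * (\<Sum>l\<in>UNIV. Re (s Beta l $ 1 $ 1))"
    unfolding d_sgn_eq d_rest_eq[OF d2] classes_eq d_def[symmetric] by (simp add: d_def)
  from key[OF this] d show "4 * (\<Sum>l\<in>UNIV. wt TYPE('n) 1 s l)
      + (real CARD('n) - 2 / (real CARD('n) + 1)) * (\<Sum>l\<in>UNIV. Re (s Beta l $ 1 $ 1)) = 1"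
    unfolding wt_def psi_norm_sq[OF d2] sum_distrib_left[symmetric] d_def[symmetric] by simp
  have "Re (of_real (d_sgn TYPE('n) 2)) = Re (of_nat CARD('n) * (\<Sum>l\<in>classes. s Alpha l $ 2 $ 2)
      + of_real (d_rest TYPE('n) 2) * (\<Sum>l\<in>classes. s Gamma l $ 2 $ 2))"
    using s unfolding symmetric_set_def by metis
  then have "d * (d - 1) / 2 = d * (\<Sum>l\<in>UNIV. Re (s Alpha l $ 2 $ 2)) + (d * (d * (d - 1) / 2) - d) * (\<Sum>l\<in>UNIV. Re (s Gamma l $ 2 $ 2))"
    unfolding d_sgn_eq d_rest_eq[OF d2] classes_eq d_def[symmetric] by (simp add: d_def)
  from key[OF this] d show "4 * (\<Sum>l\<in>UNIV. wt TYPE('n) 2 s l)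
      + (real CARD('n) - 2 / (real CARD('n) - 1)) * (\<Sum>l\<in>UNIV. Re (s Gamma l $ 2 $ 2)) = 1"
    unfolding wt_def psi_norm_sq[OF d2] sum_distrib_left[symmetric] d_def[symmetric] by simp
qed

lemma psi_norm_prod:
  assumes "CARD('n::finite) \<ge> 2"
  shows "psi_norm TYPE('n) 1 * psi_norm TYPE('n) 2 * sqrt (d_sgn TYPE('n) 1 * d_sgn TYPE('n) 2) = real CARD('n) / 4"
    and "psi_norm TYPE('n) a > 0"
proof -
  define d where "d = real CARD('n)"
  have d: "d \<ge> 2" using assms by (simp add: d_def)
  define x y where "x = sqrt (2 * (d + 1))" and "y = sqrt (2 * (d - 1))"
  have "x > 0" "y > 0" using d by (simp_all add: x_def y_def)
  have "psi_norm TYPE('n) 1 = 1 / x" "psi_norm TYPE('n) 2 = 1 / y"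
    by (simp_all add: psi_norm_def x_def y_def d_def)
  have "d_sgn TYPE('n) 1 * d_sgn TYPE('n) 2 = (d / 4)\<^sup>2 * (2 * (d + 1)) * (2 * (d - 1))"
    unfolding d_sgn_eq d_def[symmetric] by (simp add: power2_eq_square field_simps)
  then have "sqrt (d_sgn TYPE('n) 1 * d_sgn TYPE('n) 2) = d / 4 * x * y"
    using d by (simp add: real_sqrt_mult x_def y_def)
  then show "psi_norm TYPE('n) 1 * psi_norm TYPE('n) 2 * sqrt (d_sgn TYPE('n) 1 * d_sgn TYPE('n) 2) = real CARD('n) / 4"
    using \<open>x > 0\<close> \<open>y > 0\<close> unfolding \<open>psi_norm TYPE('n) 1 = 1 / x\<close> \<open>psi_norm TYPE('n) 2 = 1 / y\<close>
    by (simp add: d_def)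
  show "psi_norm TYPE('n) a > 0" using assms by (simp add: psi_norm_def sgnval_def)
qed

text \<open>The first normalization plus a third of the second, minus the fidelity, is 4/3 - 4/3 = 0
  and is also a sum of nonnegative slacks. Each slack therefore vanishes, and each vanishing slack
  is one of the conclusions or leads to one by \<open>slack_bound\<close>.\<close>

lemma optimal_weights:
  assumes d2: "CARD('n::finite) \<ge> 2" and s: "symmetric_set TYPE('n) s"
    and opt: "(\<Sum>l\<in>UNIV. class_fid TYPE('n) s l) = 4 / 3"
  defines "A \<equiv> wt TYPE('n) 1 s" and "B \<equiv> wt TYPE('n) 2 s" and "t \<equiv> coh TYPE('n) s"
  shows "\<forall>l. s Beta l = 0" "\<forall>l. s Gamma l = 0" "A XX_Y = 0" "A XY_Z = 0" "B XX_X = 0" "B XX_Y = 0" "B XY_Z = 0"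
    "B XY_X = 9 * A XY_X" "t XY_X = 3 * A XY_X" "B XY_Y = 9 * A XY_Y" "t XY_Y = - 3 * A XY_Y"
    "A XX_X + A XY_X + A XY_Y = 1 / 4" "B XY_X + B XY_Y = 1 / 4"
proof -
  define d where "d = real CARD('n)"
  have d: "d \<ge> 2" using d2 by (simp add: d_def)
  define p q where "p = psi_norm TYPE('n) 1" and "q = psi_norm TYPE('n) 2"
  have pq: "p * p = 1 / (2 * (d + 1))" "q * q = 1 / (2 * (d - 1))"
    unfolding p_def q_def psi_norm_sq[OF d2] by (simp_all add: d_def)
  have psd: "psd (s Alpha l)" for l using s by (simp add: symmetric_set_def)
  define \<beta> \<gamma> where "\<beta> l = Re (s Beta l $ 1 $ 1)" and "\<gamma> l = Re (s Gamma l $ 2 $ 2)" for l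
  have \<beta>: "\<beta> l \<ge> 0" "s Beta l = mat2 (of_real (\<beta> l)) 0 0 0" for l
  proof -
    obtain b where "0 \<le> b" "s Beta l = mat2 (of_real b) 0 0 0"
      using s unfolding symmetric_set_def by metis
    then show "\<beta> l \<ge> 0" "s Beta l = mat2 (of_real (\<beta> l)) 0 0 0" by (simp_all add: \<beta>_def)
  qed
  have \<gamma>: "\<gamma> l \<ge> 0" "s Gamma l = mat2 0 0 0 (of_real (\<gamma> l))" for l
  proof -
    obtain c where "0 \<le> c" "s Gamma l = mat2 0 0 0 (of_real c)"
      using s unfolding symmetric_set_def by metis
    then show "\<gamma> l \<ge> 0" "s Gamma l = mat2 0 0 0 (of_real (\<gamma> l))" by (simp_all add: \<gamma>_def)
  qed
  have A: "A l \<ge> 0" and B: "B l \<ge> 0" for l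
    unfolding A_def B_def wt_def by (intro mult_nonneg_nonneg psd_diag(2)[OF psd]; simp add: psi_norm_def)+
  have t: "(t l)\<^sup>2 \<le> A l * B l" for l
  proof -
    have "(Re (s Alpha l $ 1 $ 2))\<^sup>2 \<le> (norm (s Alpha l $ 1 $ 2))\<^sup>2"
      using abs_Re_le_cmod[of "s Alpha l $ 1 $ 2"] by (metis abs_ge_zero power2_abs power_mono)
    then have "(Re (s Alpha l $ 1 $ 2))\<^sup>2 \<le> Re (s Alpha l $ 1 $ 1) * Re (s Alpha l $ 2 $ 2)"
      using psd_offdiag[OF psd, of l 1 2] by linarith
    then have "(p * q)\<^sup>2 * (Re (s Alpha l $ 1 $ 2))\<^sup>2 \<le> (p * q)\<^sup>2 * (Re (s Alpha l $ 1 $ 1) * Re (s Alpha l $ 2 $ 2))"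
      by (rule mult_left_mono) simp
    then show ?thesis unfolding t_def A_def B_def coh_def wt_def p_def[symmetric] q_def[symmetric]
      by (simp add: power2_eq_square mult_ac)
  qed
  \<comment> \<open>The coefficients of \<beta> and \<gamma> in the combined normalization; v
    contains the dual multiplier 1/3.\<close>
  define u v where "u = d - 2 / (d + 1)" and "v = (d - 2 / (d - 1)) / 3"
  have "4 * (\<Sum>l\<in>UNIV. A l) + u * (\<Sum>l\<in>UNIV. \<beta> l) = 1"
    using normalization(1)[OF d2 s] unfolding A_def \<beta>_def u_def d_def .
  then have n1: "4 * A XX_X + 4 * A XX_Y + 4 * A XY_X + 4 * A XY_Y + 4 * A XY_Z
      + (u * \<beta> XX_X + u * \<beta> XX_Y + u * \<beta> XY_X + u * \<beta> XY_Y + u * \<beta> XY_Z) = 1"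
    unfolding sum_cls by (simp add: algebra_simps)
  have "4 * (\<Sum>l\<in>UNIV. B l) + (3 * v) * (\<Sum>l\<in>UNIV. \<gamma> l) = 1"
  proof -
    have "3 * v = d - 2 / (d - 1)" by (simp add: v_def)
    then show ?thesis using normalization(2)[OF d2 s] unfolding B_def \<gamma>_def d_def by (simp only:)
  qed
  then have n2: "4 * B XX_X + 4 * B XX_Y + 4 * B XY_X + 4 * B XY_Y + 4 * B XY_Z
      + (3 * (v * \<gamma> XX_X) + 3 * (v * \<gamma> XX_Y) + 3 * (v * \<gamma> XY_X) + 3 * (v * \<gamma> XY_Y) + 3 * (v * \<gamma> XY_Z)) = 1"
    unfolding sum_cls by (simp add: algebra_simps)
  have f: "4 * A XX_X + \<beta> XX_X * (1 - 4 * (p * p)) + \<beta> XX_Y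
      + (A XY_X + B XY_X + 2 * t XY_X + \<beta> XY_X * (1 / 2 - p * p) + \<gamma> XY_X * (1 / 2 - q * q))
      + (A XY_Y + B XY_Y - 2 * t XY_Y + \<beta> XY_Y * (1 / 2 - p * p) + \<gamma> XY_Y * (1 / 2 - q * q))
      + (\<beta> XY_Z / 2 + \<gamma> XY_Z / 2) = 4 / 3"
    using opt unfolding sum_cls class_fid_simps[of s, OF psd]
    unfolding A_def B_def t_def \<beta>_def \<gamma>_def p_def q_def by simp
  have u: "u > 1"
  proof -
    have "2 / (d + 1) < 1" using d by simp
    then show ?thesis using d unfolding u_def by linarith
  qed
  have \<beta>0: "u * \<beta> l - \<beta> l \<ge> 0" "u * \<beta> l - \<beta> l = 0 \<Longrightarrow> \<beta> l = 0" for l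
    using u \<beta>(1)[of l] by (auto simp: mult_le_cancel_right1 algebra_simps)
  have \<beta>1: "\<beta> l * (1 - 4 * (p * p)) \<le> \<beta> l" "\<beta> l * (1 / 2 - p * p) \<le> \<beta> l" "\<beta> l / 2 \<le> \<beta> l" for l
    using \<beta>(1)[of l] mult_nonneg_nonneg[OF \<beta>(1)[of l], of "p * p"] by (simp_all add: algebra_simps)
  have \<gamma>1: "\<gamma> l * (1 / 2 - q * q) \<le> \<gamma> l / 2" for l
    using mult_nonneg_nonneg[OF \<gamma>(1)[of l], of "q * q"] by (simp add: algebra_simps)
  have \<gamma>0: "v * \<gamma> l - \<gamma> l / 2 \<ge> 0 \<and> (v * \<gamma> l - \<gamma> l / 2 = 0 \<longrightarrow> \<gamma> l = 0)" for l
  proof (cases "CARD('n) = 2")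
    \<comment> \<open>Here v = 0 and no slack is left; \<gamma> vanishes by the convention in
      \<open>symmetric_set\<close>.\<close>
    case True
    then have "s Gamma l = 0" using s unfolding symmetric_set_def by blast
    then show ?thesis by (simp add: \<gamma>_def)
  next
    case False
    then have "d \<ge> 3" using d2 by (simp add: d_def)
    moreover from this have "2 / (d - 1) \<le> 1" by simp
    ultimately have "d - 2 / (d - 1) > 3 / 2" by linarith
    then have "v > 1 / 2" unfolding v_def by simp
    then have "0 \<le> (v - 1 / 2) * \<gamma> l" "(v - 1 / 2) * \<gamma> l = 0 \<Longrightarrow> \<gamma> l = 0"
      using \<gamma>(1)[of l] by simp_all
    then show ?thesis by (simp add: algebra_simps)
  qed
  have g0: "v * \<gamma> l - \<gamma> l / 2 \<ge> 0" for l using \<gamma>0 by blast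
  have x: "2 * t XY_X \<le> 3 * A XY_X + B XY_X / 3" by (rule slack_bound(1)[OF t A B])
  have "(- t XY_Y)\<^sup>2 \<le> A XY_Y * B XY_Y" using t[of XY_Y] by simp
  note y = slack_bound[OF this A B]
  have y1: "- 2 * t XY_Y \<le> 3 * A XY_Y + B XY_Y / 3" using y(1) by simp
  \<comment> \<open>Products with u, v, p and q are given names so that the remaining argument is
    purely linear.\<close>
  define e where "e l = u * \<beta> l - \<beta> l" for l
  define g where "g l = v * \<gamma> l - \<gamma> l / 2" for l
  have ue: "u * \<beta> l = e l + \<beta> l" and vg: "3 * (v * \<gamma> l) = 3 * g l + 3 * \<gamma> l / 2" for l by (simp_all add: e_def g_def)
  have e0: "e l \<ge> 0" and g0: "g l \<ge> 0" for l using \<beta>0(1) g0 by (simp_all add: e_def g_def)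
  define f1 f2 f3 f4 f5 where "f1 = \<beta> XX_X * (1 - 4 * (p * p))" and "f2 = \<beta> XY_X * (1 / 2 - p * p)"
    and "f3 = \<gamma> XY_X * (1 / 2 - q * q)" and "f4 = \<beta> XY_Y * (1 / 2 - p * p)" and "f5 = \<gamma> XY_Y * (1 / 2 - q * q)"
  have f_le: "f1 \<le> \<beta> XX_X" "f2 \<le> \<beta> XY_X" "f3 \<le> \<gamma> XY_X / 2" "f4 \<le> \<beta> XY_Y" "f5 \<le> \<gamma> XY_Y / 2"
    unfolding f1_def f2_def f3_def f4_def f5_def using \<beta>1 \<gamma>1 by blast+
  note facts = n1[unfolded ue] n2[unfolded vg] f[folded f1_def f2_def f3_def f4_def f5_def] x y1 f_le
    A[of XX_X] A[of XX_Y] A[of XY_X] A[of XY_Y] A[of XY_Z]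
    B[of XX_X] B[of XX_Y] B[of XY_X] B[of XY_Y] B[of XY_Z]
    e0[of XX_X] e0[of XX_Y] e0[of XY_X] e0[of XY_Y] e0[of XY_Z]
    g0[of XX_X] g0[of XX_Y] g0[of XY_X] g0[of XY_Y] g0[of XY_Z]
    \<beta>(1)[of XY_Z] \<gamma>(1)[of XX_X] \<gamma>(1)[of XX_Y]
  have "e XX_X = 0" "e XX_Y = 0" "e XY_X = 0" "e XY_Y = 0" "e XY_Z = 0"
    using facts by linarith+
  then have "u * \<beta> XX_X - \<beta> XX_X = 0" "u * \<beta> XX_Y - \<beta> XX_Y = 0" "u * \<beta> XY_X - \<beta> XY_X = 0"
    "u * \<beta> XY_Y - \<beta> XY_Y = 0" "u * \<beta> XY_Z - \<beta> XY_Z = 0"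
    unfolding e_def .
  then have b0: "\<forall>l. \<beta> l = 0" unfolding all_cls by (intro conjI \<beta>0(2))
  have "g XX_X = 0" "g XX_Y = 0" "g XY_X = 0" "g XY_Y = 0" "g XY_Z = 0"
    using facts by linarith+
  then have "v * \<gamma> XX_X - \<gamma> XX_X / 2 = 0" "v * \<gamma> XX_Y - \<gamma> XX_Y / 2 = 0" "v * \<gamma> XY_X - \<gamma> XY_X / 2 = 0"
    "v * \<gamma> XY_Y - \<gamma> XY_Y / 2 = 0" "v * \<gamma> XY_Z - \<gamma> XY_Z / 2 = 0"
    unfolding g_def .
  then have c0: "\<forall>l. \<gamma> l = 0" unfolding all_cls using \<gamma>0 by blast
  show "\<forall>l. s Beta l = 0" "\<forall>l. s Gamma l = 0"
    using \<beta>(2) b0 \<gamma>(2) c0 by (simp_all add: vec_eq_iff forall_2)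
  show a0: "A XX_Y = 0" "A XY_Z = 0" "B XX_X = 0" "B XX_Y = 0" "B XY_Z = 0"
    using facts by linarith+
  \<comment> \<open>Each side of 4 A + 4 B/3 - (A + B + 2 t) = 0, up to the sign of t: the slack of
    the two coherent classes.\<close>
  have "2 * t XY_X = 3 * A XY_X + B XY_X / 3" "2 * (- t XY_Y) = 3 * A XY_Y + B XY_Y / 3"
    using facts by linarith+
  from slack_bound(2)[OF t A B this(1)] y(2)[OF this(2)]
  show "B XY_X = 9 * A XY_X" "t XY_X = 3 * A XY_X" "B XY_Y = 9 * A XY_Y" "t XY_Y = - 3 * A XY_Y"
    by auto
  show "A XX_X + A XY_X + A XY_Y = 1 / 4" "B XY_X + B XY_Y = 1 / 4"
    using n1 n2 a0 b0 c0 by simp_all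
qed

section \<open>Rank-one matrices and the segment between the two optimal sets\<close>

lemma mat2_eqI:
  assumes "M $ 1 $ 1 = a" "M $ 1 $ 2 = b" "M $ 2 $ 1 = c" "M $ 2 $ 2 = e"
  shows "M = mat2 a b c e"
  using assms by (simp add: vec_eq_iff forall_2)

lemma ketbra_mat2:
  "ketbra (vector [of_real x, of_real y]) (vector [of_real x, of_real y])
    = mat2 (of_real (x * x)) (of_real (x * y)) (of_real (x * y)) (of_real (y * y))"
  by (rule mat2_eqI) simp_all

text \<open>Every row is a multiple of one nonzero row, so this row is a basis of the row
  space.\<close>

lemma rank_ketbra:
  assumes "v \<noteq> 0"
  shows "rank (ketbra v v) = 1"
proof -
  obtain i where i: "v $ i \<noteq> 0" using assms by (auto simp: vec_eq_iff)
  define r where "r = row i (ketbra v v)"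
  have r: "r = v $ i *s (\<chi> j. cnj (v $ j))" by (simp add: r_def row_def vec_eq_iff)
  have "r $ i \<noteq> 0" using i by (simp add: r)
  then have "r \<noteq> 0" by auto
  have "{r} \<subseteq> rows (ketbra v v)" unfolding rows_def r_def by blast
  moreover have "row k (ketbra v v) = (v $ k / v $ i) *s r" for k
    using i by (simp add: r row_def vec_eq_iff)
  then have "row k (ketbra v v) \<in> vec.span {r}" for k
    by (simp only:) (intro vec.span_scale vec.span_base singletonI)
  then have "rows (ketbra v v) \<subseteq> vec.span {r}" unfolding rows_def by blast
  ultimately show ?thesis
    unfolding row_rank_def_gen using \<open>r \<noteq> 0\<close> by (intro vec.dim_unique[of "{r}"]) auto
qed

lemma sigma_z_conj: "sigma_z ** mat2 a b c e ** sigma_z = mat2 a (- b) (- c) e"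
  by (rule mat2_eqI) (simp_all add: sigma_z_def matrix_matrix_mult_def sum_2)

text \<open>The segment joining the two optimal sets, which share the matrix A. The endpoints, the
  midpoint and all convex combinations are thus covered by one computation.\<close>

definition opt_family :: "'n::finite itself \<Rightarrow> real \<Rightarrow> sset"
  where "opt_family T t = alpha_set ((\<lambda>_. 0)(XX_X := opt_A T, XY_X := (1 - t) *\<^sub>R opt_B T,
    XY_Y := t *\<^sub>R (sigma_z ** opt_B T ** sigma_z)))"

lemma opt_family_simps:
  "opt_family T t Alpha XX_X = opt_A T" "opt_family T t Alpha XX_Y = 0"
  "opt_family T t Alpha XY_X = (1 - t) *\<^sub>R opt_B T"
  "opt_family T t Alpha XY_Y = t *\<^sub>R (sigma_z ** opt_B T ** sigma_z)"
  "opt_family T t Alpha XY_Z = 0" "opt_family T t Beta l = 0" "opt_family T t Gamma l = 0"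
  by (simp_all add: opt_family_def alpha_set_def)

lemma sset_eqI:
  assumes "\<And>l. s Alpha l = s' Alpha l" "\<And>l. s Beta l = s' Beta l" "\<And>l. s Gamma l = s' Gamma l"
  shows "s = (s' :: sset)"
proof (intro ext)
  show "s v l = s' v l" for v l by (cases v) (simp_all add: assms)
qed

lemma opt_family_eq:
  "opt_family T 0 = opt_set_1 T" "opt_family T 1 = opt_set_2 T" "opt_family T (1 / 2) = opt_set_mid T"
  "(\<lambda>v l. (1 - t) *\<^sub>R opt_set_1 T v l + t *\<^sub>R opt_set_2 T v l) = opt_family T t"
  unfolding opt_family_def opt_set_1_def opt_set_2_def opt_set_mid_def
  by (rule sset_eqI; auto simp: alpha_set_def scaleR_add_left[symmetric])+

context
  fixes T :: "'n::finite itself"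
  assumes d2: "CARD('n) \<ge> 2"
begin

lemma d_sgn_pos: "d_sgn TYPE('n) a > 0"
  using d2 unfolding d_sgn_eq by (simp add: sgnval_def)

lemma opt_A_ketbra: "\<exists>v. v \<noteq> 0 \<and> opt_A TYPE('n) = ketbra v v"
proof -
  define x where "x = sqrt ((9 * d_sgn TYPE('n) 1 - d_sgn TYPE('n) 1) / (9 * real CARD('n)))"
  have x: "x > 0" unfolding x_def using d_sgn_pos[of 1] d2 by simp
  have xx: "x * x = (9 * d_sgn TYPE('n) 1 - d_sgn TYPE('n) 1) / (9 * real CARD('n))"
    unfolding x_def using d_sgn_pos[of 1] by simp
  show ?thesis
  proof (intro exI conjI)
    show "vector [of_real x, of_real 0] \<noteq> (0 :: complex^2)"
      using x by (simp add: vec_eq_iff forall_2)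
    show "opt_A TYPE('n) = ketbra (vector [of_real x, of_real 0]) (vector [of_real x, of_real 0])"
      unfolding ketbra_mat2 xx opt_A_def by simp
  qed
qed

text \<open>The sign \<sigma> treats B and its conjugate by \<open>sigma_z\<close> together:
  conjugation flips the second entry of the vector.\<close>

lemma opt_B_ketbra:
  assumes "\<sigma> = 1 \<or> \<sigma> = - 1"
  shows "\<exists>v. v \<noteq> 0 \<and> mat2 (opt_B TYPE('n) $ 1 $ 1) (of_real \<sigma> * opt_B TYPE('n) $ 1 $ 2)
    (of_real \<sigma> * opt_B TYPE('n) $ 2 $ 1) (opt_B TYPE('n) $ 2 $ 2) = ketbra v v"
proof -
  define x y where "x = sqrt (d_sgn TYPE('n) 1 / (9 * real CARD('n)))" and "y = sqrt (d_sgn TYPE('n) 2 / real CARD('n))"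
  have x: "x > 0" unfolding x_def using d_sgn_pos[of 1] d2 by simp
  have xx: "x * x = d_sgn TYPE('n) 1 / (9 * real CARD('n))" "y * y = d_sgn TYPE('n) 2 / real CARD('n)"
    unfolding x_def y_def using d_sgn_pos[of 1] d_sgn_pos[of 2] by simp_all
  have xy: "x * y = sqrt (d_sgn TYPE('n) 1 * d_sgn TYPE('n) 2) / (3 * real CARD('n))"
  proof -
    have "x * y = sqrt ((d_sgn TYPE('n) 1 * d_sgn TYPE('n) 2) / (3 * real CARD('n))\<^sup>2)"
      unfolding x_def y_def real_sqrt_mult[symmetric] by (simp add: power2_eq_square)
    then show ?thesis unfolding real_sqrt_divide real_sqrt_abs by simp
  qed
  show ?thesis
  proof (intro exI conjI)
    show "vector [of_real x, of_real (\<sigma> * y)] \<noteq> (0 :: complex^2)"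
      using x by (simp add: vec_eq_iff forall_2)
    have "x * (\<sigma> * y) = \<sigma> * (x * y)" "\<sigma> * y * (\<sigma> * y) = y * y" using assms by auto
    then show "mat2 (opt_B TYPE('n) $ 1 $ 1) (of_real \<sigma> * opt_B TYPE('n) $ 1 $ 2)
        (of_real \<sigma> * opt_B TYPE('n) $ 2 $ 1) (opt_B TYPE('n) $ 2 $ 2)
      = ketbra (vector [of_real x, of_real (\<sigma> * y)]) (vector [of_real x, of_real (\<sigma> * y)])"
      unfolding ketbra_mat2 by (simp only: xx xy opt_B_def mat2_nth of_real_mult)
  qed
qed

lemma opt_B_rank_one:
  "\<exists>v. v \<noteq> 0 \<and> opt_B TYPE('n) = ketbra v v"
  "\<exists>v. v \<noteq> 0 \<and> sigma_z ** opt_B TYPE('n) ** sigma_z = ketbra v v"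
proof -
  have "opt_B TYPE('n) = mat2 (opt_B TYPE('n) $ 1 $ 1) (of_real 1 * opt_B TYPE('n) $ 1 $ 2)
    (of_real 1 * opt_B TYPE('n) $ 2 $ 1) (opt_B TYPE('n) $ 2 $ 2)"
    by (rule mat2_eqI) simp_all
  then show "\<exists>v. v \<noteq> 0 \<and> opt_B TYPE('n) = ketbra v v"
    using opt_B_ketbra[of 1] by metis
  have "sigma_z ** opt_B TYPE('n) ** sigma_z = mat2 (opt_B TYPE('n) $ 1 $ 1) (of_real (- 1) * opt_B TYPE('n) $ 1 $ 2)
    (of_real (- 1) * opt_B TYPE('n) $ 2 $ 1) (opt_B TYPE('n) $ 2 $ 2)"
    unfolding opt_B_def sigma_z_conj by simp
  then show "\<exists>v. v \<noteq> 0 \<and> sigma_z ** opt_B TYPE('n) ** sigma_z = ketbra v v"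
    using opt_B_ketbra[of "- 1"] by metis
qed

lemma symmetric_opt_family:
  assumes "0 \<le> t" "t \<le> 1"
  shows "symmetric_set TYPE('n) (opt_family TYPE('n) t)"
  unfolding symmetric_set_def
proof (intro conjI)
  have "psd (opt_A TYPE('n))" "psd (opt_B TYPE('n))" "psd (sigma_z ** opt_B TYPE('n) ** sigma_z)"
    using opt_A_ketbra opt_B_rank_one psd_ketbra by metis+
  then show "\<forall>l. psd (opt_family TYPE('n) t Alpha l)"
    using assms by (simp add: all_cls opt_family_simps psd_0 psd_scaleR)
  have "(0 :: complex^2^2) = mat2 (of_real 0) 0 0 0" "(0 :: complex^2^2) = mat2 0 0 0 (of_real 0)"
    by (rule mat2_eqI; simp)+
  then show "\<forall>l. \<exists>b. 0 \<le> b \<and> opt_family TYPE('n) t Beta l = mat2 (of_real b) 0 0 0"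
    "\<forall>l. \<exists>c. 0 \<le> c \<and> opt_family TYPE('n) t Gamma l = mat2 0 0 0 (of_real c)"
    unfolding opt_family_simps by blast+
  have "opt_family TYPE('n) t v XY_Z = 0" for v by (cases v) (simp_all add: opt_family_simps)
  then show "CARD('n) = 2 \<longrightarrow> (\<forall>v. opt_family TYPE('n) t v XY_Z = 0) \<and> (\<forall>l. opt_family TYPE('n) t Gamma l = 0)"
    by (simp add: opt_family_simps)
  have n: "of_nat CARD('n) \<noteq> (0::complex)" by simp
  have *: "(1 - t) *\<^sub>R z + t *\<^sub>R z = z" for z :: complex
    by (simp add: scaleR_add_left[symmetric])
  have "(\<Sum>l\<in>UNIV. opt_family TYPE('n) t Alpha l $ 1 $ 1) = opt_A TYPE('n) $ 1 $ 1 + opt_B TYPE('n) $ 1 $ 1"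
    unfolding sum_cls opt_family_simps opt_B_def sigma_z_conj
    by (simp add: * flip: add.assoc)
  then show "complex_of_real (d_sgn TYPE('n) 1) = of_nat CARD('n) * (\<Sum>l\<in>classes. opt_family TYPE('n) t Alpha l $ 1 $ 1)
      + of_real (d_rest TYPE('n) 1) * (\<Sum>l\<in>classes. opt_family TYPE('n) t Beta l $ 1 $ 1)"
    unfolding classes_eq opt_family_simps opt_A_def opt_B_def using n by (simp add: field_simps)
  have "(\<Sum>l\<in>UNIV. opt_family TYPE('n) t Alpha l $ 2 $ 2) = opt_B TYPE('n) $ 2 $ 2"
    unfolding sum_cls opt_family_simps opt_B_def sigma_z_conj opt_A_def by (simp add: *)
  then show "complex_of_real (d_sgn TYPE('n) 2) = of_nat CARD('n) * (\<Sum>l\<in>classes. opt_family TYPE('n) t Alpha l $ 2 $ 2)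
      + of_real (d_rest TYPE('n) 2) * (\<Sum>l\<in>classes. opt_family TYPE('n) t Gamma l $ 2 $ 2)"
    unfolding classes_eq opt_family_simps opt_B_def using n by (simp add: field_simps)
qed

lemma psi_norm_d_sgn: "psi_norm TYPE('n) a * psi_norm TYPE('n) a * d_sgn TYPE('n) a = real CARD('n) / 4"
proof -
  have "real CARD('n) + sgnval a > 0" using d2 by (simp add: sgnval_def)
  moreover have "1 / (2 * D) * (x * D / 2) = x / 4" if "D > 0" for x D :: real
    using that by simp
  ultimately show ?thesis unfolding psi_norm_sq[OF d2] d_sgn_eq by blast
qed

text \<open>These numbers solve the equality conditions when a single coherent class is used: its B
  weight is 1/4, so its A weight is 1/36 and its coherence 3/36, and 1/4 - 1/36 = 2/9 remains for
  xx,x.\<close>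

lemma opt_weights:
  "psi_norm TYPE('n) 1 * psi_norm TYPE('n) 1 * Re (opt_A TYPE('n) $ 1 $ 1) = 2 / 9"
  "psi_norm TYPE('n) 1 * psi_norm TYPE('n) 1 * Re (opt_B TYPE('n) $ 1 $ 1) = 1 / 36"
  "psi_norm TYPE('n) 2 * psi_norm TYPE('n) 2 * Re (opt_B TYPE('n) $ 2 $ 2) = 1 / 4"
  "psi_norm TYPE('n) 1 * psi_norm TYPE('n) 2 * Re (opt_B TYPE('n) $ 1 $ 2) = 1 / 12"
proof -
  have n: "real CARD('n) > 0" by simp
  have r: "Re (opt_A TYPE('n) $ 1 $ 1) = d_sgn TYPE('n) 1 * (8 / (9 * real CARD('n)))"
    "Re (opt_B TYPE('n) $ 1 $ 1) = d_sgn TYPE('n) 1 * (1 / (9 * real CARD('n)))"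
    "Re (opt_B TYPE('n) $ 2 $ 2) = d_sgn TYPE('n) 2 * (1 / real CARD('n))"
    "Re (opt_B TYPE('n) $ 1 $ 2) = sqrt (d_sgn TYPE('n) 1 * d_sgn TYPE('n) 2) * (1 / (3 * real CARD('n)))"
    unfolding opt_A_def opt_B_def mat2_nth by simp_all
  show "psi_norm TYPE('n) 1 * psi_norm TYPE('n) 1 * Re (opt_A TYPE('n) $ 1 $ 1) = 2 / 9"
    "psi_norm TYPE('n) 1 * psi_norm TYPE('n) 1 * Re (opt_B TYPE('n) $ 1 $ 1) = 1 / 36"
    "psi_norm TYPE('n) 2 * psi_norm TYPE('n) 2 * Re (opt_B TYPE('n) $ 2 $ 2) = 1 / 4"
    "psi_norm TYPE('n) 1 * psi_norm TYPE('n) 2 * Re (opt_B TYPE('n) $ 1 $ 2) = 1 / 12"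
    unfolding r mult.assoc[symmetric] psi_norm_d_sgn psi_norm_prod(1)[OF d2] using n by simp_all
qed

text \<open>The class xx,x contributes 8/9; the classes xy,x and xy,y share the remaining 4/9 in the
  ratio 1 - t to t.\<close>

lemma class_fid_opt_family:
  assumes "0 \<le> t" "t \<le> 1"
  shows "(\<Sum>l\<in>UNIV. class_fid TYPE('n) (opt_family TYPE('n) t) l) = 4 / 3"
proof -
  have psd: "psd (opt_family TYPE('n) t Alpha l)" for l
    using symmetric_opt_family[OF assms] by (simp add: symmetric_set_def)
  have B: "(sigma_z ** opt_B TYPE('n) ** sigma_z) $ 1 $ 1 = opt_B TYPE('n) $ 1 $ 1"
    "(sigma_z ** opt_B TYPE('n) ** sigma_z) $ 2 $ 2 = opt_B TYPE('n) $ 2 $ 2"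
    "(sigma_z ** opt_B TYPE('n) ** sigma_z) $ 1 $ 2 = - opt_B TYPE('n) $ 1 $ 2"
    by (simp_all add: opt_B_def sigma_z_conj)
  have "wt TYPE('n) 1 (opt_family TYPE('n) t) XX_X = 2 / 9"
    "wt TYPE('n) 1 (opt_family TYPE('n) t) XY_X = (1 - t) * (1 / 36)"
    "wt TYPE('n) 2 (opt_family TYPE('n) t) XY_X = (1 - t) * (1 / 4)"
    "coh TYPE('n) (opt_family TYPE('n) t) XY_X = (1 - t) * (1 / 12)"
    "wt TYPE('n) 1 (opt_family TYPE('n) t) XY_Y = t * (1 / 36)"
    "wt TYPE('n) 2 (opt_family TYPE('n) t) XY_Y = t * (1 / 4)"
    "coh TYPE('n) (opt_family TYPE('n) t) XY_Y = - t * (1 / 12)"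
    unfolding wt_def coh_def opt_family_simps opt_weights[symmetric] by (simp_all add: B)
  then show ?thesis
    unfolding sum_cls class_fid_simps[of "opt_family TYPE('n) t", OF psd]
    by (simp only: opt_family_simps) (simp add: field_simps)
qed

lemma sparse_opt:
  "sparse_set TYPE('n) (opt_set_1 TYPE('n))" "sparse_set TYPE('n) (opt_set_2 TYPE('n))"
proof -
  have rank: "rank (opt_A TYPE('n)) = 1" "rank (opt_B TYPE('n)) = 1" "rank (sigma_z ** opt_B TYPE('n) ** sigma_z) = 1"
    using opt_A_ketbra opt_B_rank_one rank_ketbra by metis+
  have card2: "card {(v, l). s v l \<noteq> 0} \<le> 2"
    if "{(v, l). s v l \<noteq> 0} \<subseteq> {(Alpha, XX_X), (Alpha, l')}" for s :: sset and l'
    using card_mono[OF _ that] card_insert_le_m1[of 2 "{(Alpha, l')}" "(Alpha, XX_X)"] by simp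
  have s1: "symmetric_set TYPE('n) (opt_set_1 TYPE('n))"
    using symmetric_opt_family[of 0] by (simp add: opt_family_eq)
  have s2: "symmetric_set TYPE('n) (opt_set_2 TYPE('n))"
    using symmetric_opt_family[of 1] by (simp add: opt_family_eq)
  have nth: "opt_set_1 TYPE('n) v l = (if v = Alpha \<and> l = XX_X then opt_A TYPE('n)
      else if v = Alpha \<and> l = XY_X then opt_B TYPE('n) else 0)"
    "opt_set_2 TYPE('n) v l = (if v = Alpha \<and> l = XX_X then opt_A TYPE('n)
      else if v = Alpha \<and> l = XY_Y then sigma_z ** opt_B TYPE('n) ** sigma_z else 0)" for v l
    by (cases v; simp add: opt_set_1_def opt_set_2_def alpha_set_def)+
  show "sparse_set TYPE('n) (opt_set_1 TYPE('n))"
    unfolding sparse_set_def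
    by (intro conjI s1 card2[of _ XY_X]) (auto simp: nth(1) rank split: if_splits)
  show "sparse_set TYPE('n) (opt_set_2 TYPE('n))"
    unfolding sparse_set_def
    by (intro conjI s2 card2[of _ XY_Y]) (auto simp: nth(2) rank split: if_splits)
qed

lemma opt_B_nonzero: "opt_B TYPE('n) \<noteq> 0"
  using opt_weights(3) by auto

lemma opt_set_distinct: "opt_set_1 TYPE('n) \<noteq> opt_set_2 TYPE('n)"
proof
  assume "opt_set_1 TYPE('n) = opt_set_2 TYPE('n)"
  then have "opt_set_1 TYPE('n) Alpha XY_X = opt_set_2 TYPE('n) Alpha XY_X" by simp
  then show False using opt_B_nonzero by (simp add: opt_set_1_def opt_set_2_def alpha_set_def)
qed

section \<open>Uniqueness among sparse sets\<close>

lemma psd_zero_diag: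
  assumes "psd (M :: complex^2^2)" "Re (M $ 2 $ 2) = 0"
  shows "M = mat2 (of_real (Re (M $ 1 $ 1))) 0 0 0"
proof (rule mat2_eqI)
  show "M $ 1 $ 1 = of_real (Re (M $ 1 $ 1))" by (rule psd_diag(1)[OF assms(1)])
  show "M $ 1 $ 2 = 0" "M $ 2 $ 1 = 0" "M $ 2 $ 2 = 0"
    using psd_offdiag[OF assms(1), of 1 2] psd_offdiag[OF assms(1), of 2 1] psd_offdiag[OF assms(1), of 2 2] assms(2)
    by simp_all
qed

text \<open>If the real part of the off-diagonal entry already saturates the minor, no room is left
  for an imaginary part.\<close>

lemma psd_rank_one_form:
  assumes "psd (M :: complex^2^2)" "(Re (M $ 1 $ 2))\<^sup>2 = Re (M $ 1 $ 1) * Re (M $ 2 $ 2)"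
  shows "M = mat2 (of_real (Re (M $ 1 $ 1))) (of_real (Re (M $ 1 $ 2))) (of_real (Re (M $ 1 $ 2))) (of_real (Re (M $ 2 $ 2)))"
proof -
  have "(norm (M $ 1 $ 2))\<^sup>2 = (Re (M $ 1 $ 2))\<^sup>2 + (Im (M $ 1 $ 2))\<^sup>2" by (rule cmod_power2)
  then have "(Im (M $ 1 $ 2))\<^sup>2 \<le> 0" using psd_offdiag[OF assms(1), of 1 2] assms(2) by linarith
  then have "Im (M $ 1 $ 2) = 0" by simp
  then have off: "M $ 1 $ 2 = of_real (Re (M $ 1 $ 2))" by (simp add: complex_eq_iff)
  have "M $ 2 $ 1 = cnj (M $ 1 $ 2)" by (rule psd_hermitian[OF assms(1)])
  also have "\<dots> = of_real (Re (M $ 1 $ 2))" by (subst off) simp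
  finally show ?thesis
    by (intro mat2_eqI psd_diag(1)[OF assms(1)] off)
qed

text \<open>Optimality alone leaves the split between xy,x and xy,y free. Since xx,x must be
  present, the limit of two nonzero elements excludes one of these classes, and the weights then
  determine every entry.\<close>

lemma optimal_sparse:
  assumes s: "sparse_set TYPE('n) s" and opt: "(\<Sum>l\<in>UNIV. class_fid TYPE('n) s l) = 4 / 3"
  shows "s = opt_set_1 TYPE('n) \<or> s = opt_set_2 TYPE('n)"
proof -
  define A B t where "A = wt TYPE('n) 1 s" and "B = wt TYPE('n) 2 s" and "t = coh TYPE('n) s"
  define p q where "p = psi_norm TYPE('n) 1" and "q = psi_norm TYPE('n) 2"
  have pq: "p > 0" "q > 0" unfolding p_def q_def by (rule psi_norm_prod(2)[OF d2])+
  have sym: "symmetric_set TYPE('n) s" using s by (simp add: sparse_set_def)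
  have psd: "psd (s Alpha l)" for l using sym by (simp add: symmetric_set_def)
  have def1: "A l = p * p * Re (s Alpha l $ 1 $ 1)" and def2: "B l = q * q * Re (s Alpha l $ 2 $ 2)"
    and def3: "t l = p * q * Re (s Alpha l $ 1 $ 2)" for l
    by (simp_all add: A_def B_def t_def wt_def coh_def p_def q_def)
  note w = optimal_weights[OF d2 sym opt, folded A_def B_def t_def]
  note o = opt_weights[folded p_def q_def]
  have zero: "s Alpha l = 0" if "A l = 0" "B l = 0" for l
  proof -
    have d: "Re (s Alpha l $ 1 $ 1) = 0" "Re (s Alpha l $ 2 $ 2) = 0" using that pq by (simp_all add: def1 def2)
    show ?thesis using psd_zero_diag[OF psd d(2)] unfolding d(1) by (simp add: vec_eq_iff forall_2)
  qed
  have z: "s Alpha XX_Y = 0" "s Alpha XY_Z = 0" using w by (auto intro: zero)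
  have val: "Re (s Alpha l $ 1 $ 1) = Re (opt_B TYPE('n) $ 1 $ 1)" "Re (s Alpha l $ 2 $ 2) = Re (opt_B TYPE('n) $ 2 $ 2)"
    "Re (s Alpha l $ 1 $ 2) = \<sigma> * Re (opt_B TYPE('n) $ 1 $ 2)"
    if "A l = 1 / 36" "B l = 1 / 4" "t l = \<sigma> * (1 / 12)" for l \<sigma>
  proof -
    have "p * p * Re (s Alpha l $ 1 $ 1) = p * p * Re (opt_B TYPE('n) $ 1 $ 1)" using that(1) o(2) by (simp only: def1)
    then show "Re (s Alpha l $ 1 $ 1) = Re (opt_B TYPE('n) $ 1 $ 1)" using pq by simp
    have "q * q * Re (s Alpha l $ 2 $ 2) = q * q * Re (opt_B TYPE('n) $ 2 $ 2)" using that(2) o(3) by (simp only: def2)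
    then show "Re (s Alpha l $ 2 $ 2) = Re (opt_B TYPE('n) $ 2 $ 2)" using pq by simp
    have "p * q * Re (s Alpha l $ 1 $ 2) = \<sigma> * (p * q * Re (opt_B TYPE('n) $ 1 $ 2))" using that(3) o(4) by (simp only: def3)
    then have "p * q * Re (s Alpha l $ 1 $ 2) = p * q * (\<sigma> * Re (opt_B TYPE('n) $ 1 $ 2))" by (simp add: mult_ac)
    then show "Re (s Alpha l $ 1 $ 2) = \<sigma> * Re (opt_B TYPE('n) $ 1 $ 2)" using pq by simp
  qed
  have B_form: "s Alpha l = mat2 (opt_B TYPE('n) $ 1 $ 1) (of_real \<sigma> * opt_B TYPE('n) $ 1 $ 2)
      (of_real \<sigma> * opt_B TYPE('n) $ 1 $ 2) (opt_B TYPE('n) $ 2 $ 2)"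
    if "A l = 1 / 36" "B l = 1 / 4" "t l = \<sigma> * (1 / 12)" "\<sigma> * \<sigma> = 1" for l \<sigma>
  proof -
    note v = val[OF that(1-3)]
    have "(p * q)\<^sup>2 * (Re (s Alpha l $ 1 $ 2))\<^sup>2 = (t l)\<^sup>2" by (simp add: def3 power_mult_distrib)
    also have "\<dots> = A l * B l"
    proof -
      have "(\<sigma> * (1 / 12))\<^sup>2 = \<sigma> * \<sigma> / 144" by (simp add: power2_eq_square)
      then show ?thesis unfolding that(1-3) that(4) by simp
    qed
    also have "\<dots> = (p * q)\<^sup>2 * (Re (s Alpha l $ 1 $ 1) * Re (s Alpha l $ 2 $ 2))"
      by (simp add: def1 def2 power2_eq_square)
    finally have "(Re (s Alpha l $ 1 $ 2))\<^sup>2 = Re (s Alpha l $ 1 $ 1) * Re (s Alpha l $ 2 $ 2)" using pq by simp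
    from psd_rank_one_form[OF psd this] show ?thesis unfolding v by (simp add: opt_B_def)
  qed
  have A_form: "s Alpha XX_X = opt_A TYPE('n)" if "A XX_X = 2 / 9"
  proof -
    have "Re (s Alpha XX_X $ 2 $ 2) = 0" using w(5) pq by (simp add: def2)
    moreover have "p * p * Re (s Alpha XX_X $ 1 $ 1) = p * p * Re (opt_A TYPE('n) $ 1 $ 1)"
      using that o(1) by (simp only: def1)
    then have "Re (s Alpha XX_X $ 1 $ 1) = Re (opt_A TYPE('n) $ 1 $ 1)" using pq by simp
    ultimately show ?thesis using psd_zero_diag[OF psd, of XX_X] by (simp add: opt_A_def)
  qed
  have "s Alpha XY_X = 0 \<or> s Alpha XY_Y = 0"
  proof (rule ccontr)
    assume nz: "\<not> ?thesis"
    have "s Alpha XX_X \<noteq> 0"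
    proof
      assume "s Alpha XX_X = 0"
      then have "A XX_X = 0" by (simp add: def1)
      \<comment> \<open>Without xx,x the A weights of the two coherent classes would add up to 1/4,
        and their B weights, nine times as large, to 9/4 instead of 1/4.\<close>
      then show False using w(8) w(10) w(12) w(13) by linarith
    qed
    then have "{(Alpha, XX_X), (Alpha, XY_X), (Alpha, XY_Y)} \<subseteq> {(v, l). s v l \<noteq> 0}" using nz by auto
    moreover have "finite (UNIV :: irrep set)"
      by (rule finite_subset[of _ "{Alpha, Beta, Gamma}"]) (use irrep.exhaust in auto)
    then have "finite {(v, l). s v l \<noteq> 0}"
      using finite_subset[OF subset_UNIV finite_Prod_UNIV[OF _ finite_cls]] by blast
    ultimately have "card {(Alpha, XX_X), (Alpha, XY_X), (Alpha, XY_Y)} \<le> card {(v, l). s v l \<noteq> 0}"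
      by (intro card_mono)
    then show False using s by (simp add: sparse_set_def)
  qed
  then show ?thesis
  proof
    assume y: "s Alpha XY_X = 0"
    then have "A XY_X = 0" "B XY_X = 0" by (simp_all add: def1 def2)
    then have v: "A XY_Y = 1 / 36" "B XY_Y = 1 / 4" "t XY_Y = - 1 * (1 / 12)" "A XX_X = 2 / 9"
      using w by linarith+
    have "s Alpha XY_Y = sigma_z ** opt_B TYPE('n) ** sigma_z"
      unfolding B_form[OF v(1-3), simplified] by (simp add: opt_B_def sigma_z_conj)
    have "s Alpha l = opt_set_2 TYPE('n) Alpha l" for l
      by (cases l) (simp_all add: opt_set_2_def alpha_set_def y z A_form[OF v(4)] \<open>s Alpha XY_Y = _\<close>)
    then have "s = opt_set_2 TYPE('n)"
      by (intro sset_eqI) (simp_all add: w(1,2)[rule_format] opt_set_2_def alpha_set_def)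
    then show ?thesis by simp
  next
    assume y: "s Alpha XY_Y = 0"
    then have "A XY_Y = 0" "B XY_Y = 0" by (simp_all add: def1 def2)
    then have v: "A XY_X = 1 / 36" "B XY_X = 1 / 4" "t XY_X = 1 * (1 / 12)" "A XX_X = 2 / 9"
      using w by linarith+
    have "s Alpha XY_X = opt_B TYPE('n)"
      unfolding B_form[OF v(1-3), simplified] by (simp add: opt_B_def)
    have "s Alpha l = opt_set_1 TYPE('n) Alpha l" for l
      by (cases l) (simp_all add: opt_set_1_def alpha_set_def y z A_form[OF v(4)] \<open>s Alpha XY_X = _\<close>)
    then have "s = opt_set_1 TYPE('n)"
      by (intro sset_eqI) (simp_all add: w(1,2)[rule_format] opt_set_1_def alpha_set_def)
    then show ?thesis by simp
  qed
qed

end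

theorem mainTheorem1:
  fixes \<mu> :: "(complex^'n^'n) measure"
  assumes "CARD('n) \<ge> 2"
    and "haar_SU \<mu>"
  shows
    "(\<exists>R :: 'n \<Rightarrow> 'n \<Rightarrow> 'n op_ABCD.
        cloning_instrument R \<and> avg_fidelity \<mu> R = 4 / (3 * real CARD('n))) \<and>
     (\<forall>R :: 'n \<Rightarrow> 'n \<Rightarrow> 'n op_ABCD.
        cloning_instrument R \<longrightarrow> avg_fidelity \<mu> R \<le> 4 / (3 * real CARD('n))) \<and>
     (\<forall>s. symmetric_set TYPE('n) s \<longrightarrow>
        cloning_instrument (sym_instrument s :: 'n \<Rightarrow> 'n \<Rightarrow> 'n op_ABCD)) \<and>
     (\<forall>R :: 'n \<Rightarrow> 'n \<Rightarrow> 'n op_ABCD. cloning_instrument R \<longrightarrow>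
        (\<exists>s. sparse_set TYPE('n) s \<and>
             avg_fidelity \<mu> R \<le> avg_fidelity \<mu> (sym_instrument s))) \<and>
     opt_set_1 TYPE('n) \<noteq> opt_set_2 TYPE('n) \<and>
     (\<forall>s. sparse_set TYPE('n) s \<and>
          avg_fidelity \<mu> (sym_instrument s) = 4 / (3 * real CARD('n))
        \<longleftrightarrow> s = opt_set_1 TYPE('n) \<or> s = opt_set_2 TYPE('n)) \<and>
     d_sgn TYPE('n) 1 = real CARD('n) * (real CARD('n) + 1) / 2 \<and>
     d_sgn TYPE('n) 2 = real CARD('n) * (real CARD('n) - 1) / 2 \<and>
     (\<forall>t::real. 0 \<le> t \<and> t \<le> 1 \<longrightarrow>
        (let s = (\<lambda>v l. (1 - t) *\<^sub>R opt_set_1 TYPE('n) v l + t *\<^sub>R opt_set_2 TYPE('n) v l)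
         in symmetric_set TYPE('n) s \<and>
            avg_fidelity \<mu> (sym_instrument s) = 4 / (3 * real CARD('n)))) \<and>
     symmetric_set TYPE('n) (opt_set_mid TYPE('n)) \<and>
     avg_fidelity \<mu> (sym_instrument (opt_set_mid TYPE('n))) = 4 / (3 * real CARD('n))"
proof -
  interpret haar \<mu> by (unfold_locales) (rule assms(2))
  note d2 = assms(1)
  have fid: "avg_fidelity \<mu> (sym_instrument s) = 4 / (3 * real CARD('n))
      \<longleftrightarrow> (\<Sum>l\<in>UNIV. class_fid TYPE('n) s l) = 4 / 3" if "symmetric_set TYPE('n) s" for s
    unfolding avg_fidelity_sym[OF d2 that] using d2 by (simp add: field_simps)
  have family: "symmetric_set TYPE('n) (opt_family TYPE('n) t)"
      "avg_fidelity \<mu> (sym_instrument (opt_family TYPE('n) t)) = 4 / (3 * real CARD('n))" if "0 \<le> t" "t \<le> 1" for t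
    using fid[OF symmetric_opt_family[OF d2 that]] class_fid_opt_family[OF d2 that] symmetric_opt_family[OF d2 that]
    by blast+
  note opt1 = family[of 0, unfolded opt_family_eq, simplified]
  note opt2 = family[of 1, unfolded opt_family_eq, simplified]
  note mid = family[of "1 / 2", unfolded opt_family_eq, simplified]
  show ?thesis
  proof (intro conjI)
    show "\<exists>R :: 'n \<Rightarrow> 'n \<Rightarrow> 'n op_ABCD. cloning_instrument R \<and> avg_fidelity \<mu> R = 4 / (3 * real CARD('n))"
      using cloning_instrument_sym[OF d2 opt1(1)] opt1(2) by blast
    show "\<forall>R :: 'n \<Rightarrow> 'n \<Rightarrow> 'n op_ABCD. cloning_instrument R \<longrightarrow> avg_fidelity \<mu> R \<le> 4 / (3 * real CARD('n))"
      using avg_fidelity_le[OF d2] by blast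
    show "\<forall>s. symmetric_set TYPE('n) s \<longrightarrow> cloning_instrument (sym_instrument s :: 'n \<Rightarrow> 'n \<Rightarrow> 'n op_ABCD)"
      using cloning_instrument_sym[OF d2] by blast
    \<comment> \<open>No symmetrization of R is carried out: a single sparse set attains the
      universal bound and so dominates every instrument.\<close>
    show "\<forall>R :: 'n \<Rightarrow> 'n \<Rightarrow> 'n op_ABCD. cloning_instrument R \<longrightarrow>
        (\<exists>s. sparse_set TYPE('n) s \<and> avg_fidelity \<mu> R \<le> avg_fidelity \<mu> (sym_instrument s))"
      using avg_fidelity_le[OF d2] sparse_opt(1)[OF d2] opt1(2) by metis
    show "opt_set_1 TYPE('n) \<noteq> opt_set_2 TYPE('n)"
      by (rule opt_set_distinct[OF d2])
    show "\<forall>s. sparse_set TYPE('n) s \<and> avg_fidelity \<mu> (sym_instrument s) = 4 / (3 * real CARD('n))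
        \<longleftrightarrow> s = opt_set_1 TYPE('n) \<or> s = opt_set_2 TYPE('n)"
    proof (intro allI iffI)
      fix s assume s: "sparse_set TYPE('n) s \<and> avg_fidelity \<mu> (sym_instrument s) = 4 / (3 * real CARD('n))"
      then have "symmetric_set TYPE('n) s" by (simp add: sparse_set_def)
      then show "s = opt_set_1 TYPE('n) \<or> s = opt_set_2 TYPE('n)"
        using optimal_sparse[OF d2] fid s by blast
    next
      fix s assume "s = opt_set_1 TYPE('n) \<or> s = opt_set_2 TYPE('n)"
      then show "sparse_set TYPE('n) s \<and> avg_fidelity \<mu> (sym_instrument s) = 4 / (3 * real CARD('n))"
        using sparse_opt[OF d2] opt1(2) opt2(2) by blast
    qed
    show "d_sgn TYPE('n) 1 = real CARD('n) * (real CARD('n) + 1) / 2"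
      "d_sgn TYPE('n) 2 = real CARD('n) * (real CARD('n) - 1) / 2"
      unfolding d_sgn_eq by simp_all
    show "\<forall>t::real. 0 \<le> t \<and> t \<le> 1 \<longrightarrow>
        (let s = (\<lambda>v l. (1 - t) *\<^sub>R opt_set_1 TYPE('n) v l + t *\<^sub>R opt_set_2 TYPE('n) v l)
         in symmetric_set TYPE('n) s \<and> avg_fidelity \<mu> (sym_instrument s) = 4 / (3 * real CARD('n)))"
      unfolding Let_def opt_family_eq using family by blast
    show "symmetric_set TYPE('n) (opt_set_mid TYPE('n))"
      "avg_fidelity \<mu> (sym_instrument (opt_set_mid TYPE('n))) = 4 / (3 * real CARD('n))"
      using mid by simp_all
  qed
qed

end
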